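(* Let $V$ be a function satisfying the uniform Lyapunov assumption (UL-A) stated in the context, with associated constants $b,\delta$. Suppose, in addition, that there exists a finite positive constant $C$ such that, for each $n$ and all $x\in\mathbb{R}^d$, $$\big(|DV(x)|+|D^2V(x)|+[V]_{2,1,B_x(\bar\ell/\sqrt{n})}\big)(1+|x|)\le C\,V(x).$$ Then, for all sufficiently large $n$ and all $x\in\widehat{E}^n$, $$\mathbb{E}_x\big[V(\widehat{X}^n(t))\big]\le V(x)+\mathbb{E}_x\Big[\int_0^t\Big(-\frac{\delta}{2}V(\widehat{X}^n(s))+b\Big)ds\Big],\qquad t\ge0.$$ Consequently, $\widehat{X}^n$ is ergodic for all such $n$ and, furthermore, with $\nu^n$ the steady-state distribution of $\widehat{X}^n$, $$\limsup_{n\to\infty}\nu^n(V)\le\frac{2b}{\delta}.$$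
   Context: Setting. For each $n\in\mathbb{N}$, $X^n$ is a continuous time Markov chain (CTMC) on a countable state space $E^n\subset\mathbb{R}^d$, with transition rates $\beta^n_{y-x}(x)=q^n_{x,y}$, $x,y\in E^n$ (so $\beta^n_\ell(x)$ is the rate of a jump $\ell$ from state $x$). Put $F^n(x)=\sum_\ell \ell\,\beta^n_\ell(x)$ and $a^n_{ij}(x)=\sum_\ell \ell_i\ell_j\beta^n_\ell(x)$ for $x\in E^n$; $F^n$ and $a^n$ are extended to $\mathbb{R}^d$, the extensions being part of the data and denoted the same way. There is a unique $\bar{x}^n_\infty\in\mathbb{R}^d$ with $F^n(\bar{x}^n_\infty)=0$. Define $\widehat{X}^n=(X^n-\bar{x}^n_\infty)/\sqrt{n}$, with state space $\widehat{E}^n$, and, for $x\in\mathbb{R}^d$, $\widehat{F}^n(x)=F^n(\bar{x}^n_\infty+\sqrt{n}x)/\sqrt{n}$, $\bar{a}^n(x)=a^n(\bar{x}^n_\infty+\sqrt{n}x)/n$. Standing assumptions. For each $n$, $X^n$ is nonexplosive, irreducible and positive recurrent; jump sizes are uniformly bounded: $\bar\ell=\sup\{|\ell|:\beta^n_\ell(x)>0\text{ for some }n,\ x\in E^n\}<\infty$, and $n$ is taken large enough that $\bar\ell/\sqrt{n}\le 1$; there are constants $K_F,K_a$ with, for all $n$ and $x,y\in\mathbb{R}^d$, $|\widehat{F}^n(x)-\widehat{F}^n(y)|\le K_F|x-y|$ and $|\bar{a}^n(x)-\bar{a}^n(0)|\le \frac{K_a}{\sqrt n}|x|$; $\bar{a}^n(0)$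 is positive definite for each $n$ and $\bar{a}^n(0)\to\bar{a}$ with $\bar a$ positive definite. For $f\in C^2(\mathbb{R}^d)$, $\mathcal{A}^nf(x)=\sum_{i}\widehat{F}^n_i(x)\frac{\partial f}{\partial x_i}(x)+\frac12\sum_{i,j}\bar{a}^n_{ij}(0)\frac{\partial^2 f}{\partial x_i\partial x_j}(x)$. Definitions. $V\in C^2(\mathbb{R}^d)$ is norm-like if $V(x)\to\infty$ as $|x|\to\infty$. $V\in C^2(\mathbb{R}^d)$ is sub-exponential if $V\ge1$ and there are constants $c_1,c_2,c_3$ with $|DV(x)|\vee|D^2V(x)|\le c_1e^{c_2|x|}$ and $\sup_{|y|\le1}V(x+y)/V(x)\le c_3$ for all $x\in\mathbb{R}^d$. $B_x(M)$ is the open Euclidean ball of radius $M$ about $x$, $\overline{B}_x(M)$ its closure. Assumption (UL-A) on $V$: $V\in C^2(\mathbb{R}^d)$ is sub-exponential and norm-like and there are finite positive constants $b,\delta,K$ not depending on $n$ such that $\mathcal{A}^nV(x)\le-\delta V(x)+b\mathbf{1}_{\overline{B}_0(K)}(x)$ for all $n$ and $x\in\mathbb{R}^d$, and, for each $n$ and all $x\in\widehat{E}^n$, $\mathbb{E}_x\big[\int_0^t\big((1+|\widehat{X}^n(s)|)^4V(\widehat{X}^n(s))\big)^2ds\big]<\infty$ for all $t\ge0$. For $\Psi\in C^2(\mathbb{R}^d)$, $[\Psi]_{2,1,B_x(\bar\ell/\sqrt n)}=\sup_{y,z\in B_x(\bar\ell/\sqrt n)}\frac{|D^2\Psi(y)-D^2\Psi(z)|}{|y-z|}$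 (possibly infinite; convention $0/0=0$). $\nu(V)=\int V\,d\nu$. *)

theory Defs
  imports "HOL-Probability.Probability"
begin

section \<open>Functions of class $C^2$ on Euclidean space\<close>

definition partial_deriv :: "'d::finite \<Rightarrow> (real^'d \<Rightarrow> real) \<Rightarrow> real^'d \<Rightarrow> real" where
  "partial_deriv i f x = frechet_derivative f (at x) (axis i 1)"

definition grad :: "(real^'d::finite \<Rightarrow> real) \<Rightarrow> real^'d \<Rightarrow> real^'d" where
  "grad f x = (\<chi> i. partial_deriv i f x)"

definition hess :: "(real^'d::finite \<Rightarrow> real) \<Rightarrow> real^'d \<Rightarrow> real^'d^'d" where
  "hess f x = (\<chi> i j. partial_deriv i (partial_deriv j f) x)"

definition C2 :: "(real^'d::finite \<Rightarrow> real) \<Rightarrow> bool" where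
  "C2 f \<longleftrightarrow>
     (\<forall>x. f differentiable (at x)) \<and>
     (\<forall>i x. partial_deriv i f differentiable (at x)) \<and>
     (\<forall>i j. continuous_on UNIV (partial_deriv i (partial_deriv j f)))"

definition norm_like :: "(real^'d::finite \<Rightarrow> real) \<Rightarrow> bool" where
  "norm_like V \<longleftrightarrow> C2 V \<and> filterlim V at_top at_infinity"

text \<open>The norm on matrices, here and below, is the library norm on \<open>real^'d^'d\<close>,
  i.e. the Frobenius norm.\<close>

definition sub_exponential :: "(real^'d::finite \<Rightarrow> real) \<Rightarrow> bool" where
  "sub_exponential V \<longleftrightarrow> C2 V \<and> (\<forall>x. V x \<ge> 1) \<and>
     (\<exists>c1 c2 c3. \<forall>x.
        max (norm (grad V x)) (norm (hess V x)) \<le> c1 * exp (c2 * norm x) \<and>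
        (\<forall>y. norm y \<le> 1 \<longrightarrow> V (x + y) / V x \<le> c3))"

text \<open>The seminorm $[f]_{2,1,B_x(r)}$ may be infinite. Terms with \<open>y = z\<close> contribute 0,
  by \<open>0 / 0 = 0\<close>.\<close>

definition hess_lip :: "(real^'d::finite \<Rightarrow> real) \<Rightarrow> real^'d \<Rightarrow> real \<Rightarrow> ennreal" where
  "hess_lip f x r =
     (SUP y\<in>ball x r. SUP z\<in>ball x r. ennreal (norm (hess f y - hess f z) / norm (y - z)))"

definition pos_def :: "real^'d^'d::finite \<Rightarrow> bool" where
  "pos_def A \<longleftrightarrow> (\<forall>v. v \<noteq> 0 \<longrightarrow> v \<bullet> (A *v v) > 0)"

section \<open>Continuous time Markov chains\<close>

text \<open>A chain on the countable set \<open>E\<close> is given by its rates \<open>q x y\<close> for distinct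
  \<open>x, y \<in> E\<close>; all other values of \<open>q\<close> are irrelevant.\<close>

definition transition_rates :: "'a set \<Rightarrow> ('a \<Rightarrow> 'a \<Rightarrow> real) \<Rightarrow> bool" where
  "transition_rates E q \<longleftrightarrow> countable E \<and> E \<noteq> {} \<and>
     (\<forall>x\<in>E. (\<forall>y\<in>E - {x}. q x y \<ge> 0) \<and> (\<lambda>y. q x y) summable_on (E - {x}))"

definition exit_rate :: "'a set \<Rightarrow> ('a \<Rightarrow> 'a \<Rightarrow> real) \<Rightarrow> 'a \<Rightarrow> real" where
  "exit_rate E q x = (\<Sum>\<^sub>\<infinity>y\<in>E - {x}. q x y)"

definition jump_prob :: "'a set \<Rightarrow> ('a \<Rightarrow> 'a \<Rightarrow> real) \<Rightarrow> 'a \<Rightarrow> 'a \<Rightarrow> real" where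
  "jump_prob E q x y =
     (if exit_rate E q x = 0 then (if y = x then 1 else 0)
      else if y = x then 0 else q x y / exit_rate E q x)"

text \<open>Jump chain / holding time description. Under \<open>P x\<close>, \<open>Y\<close> is a discrete time Markov
  chain started at \<open>x\<close> with transition matrix \<open>jump_prob E q\<close>, and given \<open>Y\<close> the holding
  times \<open>S k\<close> are independent and exponential with rates \<open>exit_rate E q (Y k)\<close>. The holding
  time in an absorbing state is infinite, which is why \<open>S\<close> takes values in \<open>ennreal\<close>.\<close>

definition ctmc ::
  "'a set \<Rightarrow> ('a \<Rightarrow> 'a \<Rightarrow> real) \<Rightarrow> ('a \<Rightarrow> 'w measure) \<Rightarrow>
   (nat \<Rightarrow> 'w \<Rightarrow> 'a) \<Rightarrow> (nat \<Rightarrow> 'w \<Rightarrow> ennreal) \<Rightarrow> bool" where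
  "ctmc E q P Y S \<longleftrightarrow> transition_rates E q \<and>
     (\<forall>x\<in>E. prob_space (P x) \<and>
        (\<forall>k. Y k \<in> measurable (P x) (count_space E) \<and> S k \<in> borel_measurable (P x)) \<and>
        (\<forall>k ys ss. (\<forall>i\<le>k. ys i \<in> E \<and> ss i \<ge> 0) \<longrightarrow>
           measure (P x) {\<omega> \<in> space (P x). \<forall>i\<le>k. Y i \<omega> = ys i \<and> S i \<omega> > ennreal (ss i)} =
             (if ys 0 = x then 1 else 0) * (\<Prod>i<k. jump_prob E q (ys i) (ys (Suc i))) *
             (\<Prod>i\<le>k. exp (- exit_rate E q (ys i) * ss i))))"

text \<open>The state at time \<open>t \<ge> 0\<close>: \<open>Y k\<close>, where \<open>k\<close> is the number of jumps in \<open>[0, t]\<close>.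
  After an explosion the value is unspecified.\<close>

definition path ::
  "(nat \<Rightarrow> 'w \<Rightarrow> 'a) \<Rightarrow> (nat \<Rightarrow> 'w \<Rightarrow> ennreal) \<Rightarrow> real \<Rightarrow> 'w \<Rightarrow> 'a" where
  "path Y S t \<omega> = Y (LEAST k. ennreal t < (\<Sum>i\<le>k. S i \<omega>)) \<omega>"

definition nonexplosive ::
  "'a set \<Rightarrow> ('a \<Rightarrow> 'w measure) \<Rightarrow> (nat \<Rightarrow> 'w \<Rightarrow> ennreal) \<Rightarrow> bool" where
  "nonexplosive E P S \<longleftrightarrow> (\<forall>x\<in>E. AE \<omega> in P x. (\<Sum>k. S k \<omega>) = \<infinity>)"

definition irreducible_rates :: "'a set \<Rightarrow> ('a \<Rightarrow> 'a \<Rightarrow> real) \<Rightarrow> bool" where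
  "irreducible_rates E q \<longleftrightarrow>
     (\<forall>x\<in>E. \<forall>y\<in>E. (x, y) \<in> {(u, v). u \<in> E \<and> v \<in> E \<and> u \<noteq> v \<and> q u v > 0}\<^sup>*)"

text \<open>First return to \<open>x\<close>: the first time at or after the first jump at which the chain is
  in \<open>x\<close>; infinite if there is none.\<close>

definition return_time ::
  "(nat \<Rightarrow> 'w \<Rightarrow> 'a) \<Rightarrow> (nat \<Rightarrow> 'w \<Rightarrow> ennreal) \<Rightarrow> 'a \<Rightarrow> 'w \<Rightarrow> ennreal" where
  "return_time Y S x \<omega> = Inf {ennreal t | t. t \<ge> 0 \<and> ennreal t \<ge> S 0 \<omega> \<and> path Y S t \<omega> = x}"

definition positive_recurrent ::
  "'a set \<Rightarrow> ('a \<Rightarrow> 'a \<Rightarrow> real) \<Rightarrow> ('a \<Rightarrow> 'w measure) \<Rightarrow>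
   (nat \<Rightarrow> 'w \<Rightarrow> 'a) \<Rightarrow> (nat \<Rightarrow> 'w \<Rightarrow> ennreal) \<Rightarrow> bool" where
  "positive_recurrent E q P Y S \<longleftrightarrow>
     (\<forall>x\<in>E. exit_rate E q x = 0 \<or> (\<integral>\<^sup>+\<omega>. return_time Y S x \<omega> \<partial>P x) < \<infinity>)"

text \<open>For a process \<open>X\<close> on \<open>E\<close>, with law \<open>P x\<close> when started at \<open>x\<close>:\<close>

definition trans_prob ::
  "('a \<Rightarrow> 'w measure) \<Rightarrow> (real \<Rightarrow> 'w \<Rightarrow> 'a) \<Rightarrow> real \<Rightarrow> 'a \<Rightarrow> 'a set \<Rightarrow> real" where
  "trans_prob P X t x A = measure (P x) {\<omega> \<in> space (P x). X t \<omega> \<in> A}"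

definition stationary ::
  "'a set \<Rightarrow> ('a \<Rightarrow> 'w measure) \<Rightarrow> (real \<Rightarrow> 'w \<Rightarrow> 'a) \<Rightarrow> 'a pmf \<Rightarrow> bool" where
  "stationary E P X \<nu> \<longleftrightarrow> set_pmf \<nu> \<subseteq> E \<and>
     (\<forall>t\<ge>0. \<forall>A. A \<subseteq> E \<longrightarrow>
        measure_pmf.prob \<nu> A = measure_pmf.expectation \<nu> (\<lambda>x. trans_prob P X t x A))"

text \<open>Ergodicity: a unique stationary distribution, and convergence to it in total variation
  from every initial state.\<close>

definition ergodic ::
  "'a set \<Rightarrow> ('a \<Rightarrow> 'w measure) \<Rightarrow> (real \<Rightarrow> 'w \<Rightarrow> 'a) \<Rightarrow> bool" where
  "ergodic E P X \<longleftrightarrow> (\<exists>!\<nu>. stationary E P X \<nu>) \<and>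
     (\<forall>\<nu>. stationary E P X \<nu> \<longrightarrow> (\<forall>x\<in>E.
        ((\<lambda>t. SUP A\<in>Pow E. \<bar>trans_prob P X t x A - measure_pmf.prob \<nu> A\<bar>) \<longlongrightarrow> 0) at_top))"

section \<open>Sequences of chains and their scaling\<close>

text \<open>$\beta_\ell(x)$\<close>

definition jump_rate ::
  "(real^'d::finite) set \<Rightarrow> (real^'d \<Rightarrow> real^'d \<Rightarrow> real) \<Rightarrow> real^'d \<Rightarrow> real^'d \<Rightarrow> real" where
  "jump_rate E q l x = (if x \<in> E \<and> x + l \<in> E \<and> l \<noteq> 0 then q x (x + l) else 0)"

definition jump_sizes ::
  "(nat \<Rightarrow> (real^'d::finite) set) \<Rightarrow> (nat \<Rightarrow> real^'d \<Rightarrow> real^'d \<Rightarrow> real) \<Rightarrow> real set" where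
  "jump_sizes E q = {norm l | l n x. n \<ge> 1 \<and> x \<in> E n \<and> jump_rate (E n) (q n) l x > 0}"

text \<open>$\bar\ell$. Inserting 0 only matters if there are no jumps at all: the supremum of the
  empty set of reals is unspecified.\<close>

definition max_jump ::
  "(nat \<Rightarrow> (real^'d::finite) set) \<Rightarrow> (nat \<Rightarrow> real^'d \<Rightarrow> real^'d \<Rightarrow> real) \<Rightarrow> real" where
  "max_jump E q = Sup (insert 0 (jump_sizes E q))"

text \<open>The range of the index \<open>n\<close>: "\<open>n\<close> is taken large enough that
  $\bar\ell/\sqrt n \le 1$".\<close>

definition indices ::
  "(nat \<Rightarrow> (real^'d::finite) set) \<Rightarrow> (nat \<Rightarrow> real^'d \<Rightarrow> real^'d \<Rightarrow> real) \<Rightarrow> nat set" where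
  "indices E q = {n. n \<ge> 1 \<and> max_jump E q / sqrt (real n) \<le> 1}"

definition is_drift ::
  "(real^'d::finite) set \<Rightarrow> (real^'d \<Rightarrow> real^'d \<Rightarrow> real) \<Rightarrow> (real^'d \<Rightarrow> real^'d) \<Rightarrow> bool" where
  "is_drift E q F \<longleftrightarrow> (\<forall>x\<in>E. F x = (\<Sum>\<^sub>\<infinity>l. jump_rate E q l x *\<^sub>R l))"

definition is_diffusion ::
  "(real^'d::finite) set \<Rightarrow> (real^'d \<Rightarrow> real^'d \<Rightarrow> real) \<Rightarrow> (real^'d \<Rightarrow> real^'d^'d) \<Rightarrow> bool" where
  "is_diffusion E q a \<longleftrightarrow>
     (\<forall>x\<in>E. \<forall>i j. a x $ i $ j = (\<Sum>\<^sub>\<infinity>l. (l $ i) * (l $ j) * jump_rate E q l x))"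

text \<open>In the following \<open>xb n\<close> is the zero $\bar x^n_\infty$ of the drift. \<open>unscale xb n\<close> is the
  inverse of the map $x \mapsto (x - \bar x^n_\infty)/\sqrt n$ for \<open>n \<ge> 1\<close>.\<close>

definition unscale :: "(nat \<Rightarrow> real^'d::finite) \<Rightarrow> nat \<Rightarrow> real^'d \<Rightarrow> real^'d" where
  "unscale xb n x = xb n + sqrt (real n) *\<^sub>R x"

definition scale :: "(nat \<Rightarrow> real^'d::finite) \<Rightarrow> nat \<Rightarrow> real^'d \<Rightarrow> real^'d" where
  "scale xb n x = (x - xb n) /\<^sub>R sqrt (real n)"

definition E_hat ::
  "(nat \<Rightarrow> (real^'d::finite) set) \<Rightarrow> (nat \<Rightarrow> real^'d) \<Rightarrow> nat \<Rightarrow> (real^'d) set" where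
  "E_hat E xb n = scale xb n ` E n"

text \<open>The law of the scaled chain started at \<open>x\<close>.\<close>

definition P_hat ::
  "(nat \<Rightarrow> real^'d::finite \<Rightarrow> 'w measure) \<Rightarrow> (nat \<Rightarrow> real^'d) \<Rightarrow> nat \<Rightarrow> real^'d \<Rightarrow> 'w measure" where
  "P_hat P xb n x = P n (unscale xb n x)"

definition X_hat ::
  "(nat \<Rightarrow> nat \<Rightarrow> 'w \<Rightarrow> real^'d::finite) \<Rightarrow> (nat \<Rightarrow> nat \<Rightarrow> 'w \<Rightarrow> ennreal) \<Rightarrow>
   (nat \<Rightarrow> real^'d) \<Rightarrow> nat \<Rightarrow> real \<Rightarrow> 'w \<Rightarrow> real^'d" where
  "X_hat Y S xb n t \<omega> = scale xb n (path (Y n) (S n) t \<omega>)"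

definition F_hat ::
  "(nat \<Rightarrow> real^'d::finite \<Rightarrow> real^'d) \<Rightarrow> (nat \<Rightarrow> real^'d) \<Rightarrow> nat \<Rightarrow> real^'d \<Rightarrow> real^'d" where
  "F_hat F xb n x = F n (unscale xb n x) /\<^sub>R sqrt (real n)"

definition a_bar ::
  "(nat \<Rightarrow> real^'d::finite \<Rightarrow> real^'d^'d) \<Rightarrow> (nat \<Rightarrow> real^'d) \<Rightarrow> nat \<Rightarrow> real^'d \<Rightarrow> real^'d^'d" where
  "a_bar a xb n x = a n (unscale xb n x) /\<^sub>R real n"

definition diff_gen ::
  "(nat \<Rightarrow> real^'d::finite \<Rightarrow> real^'d) \<Rightarrow> (nat \<Rightarrow> real^'d \<Rightarrow> real^'d^'d) \<Rightarrow> (nat \<Rightarrow> real^'d) \<Rightarrow>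
   nat \<Rightarrow> (real^'d \<Rightarrow> real) \<Rightarrow> real^'d \<Rightarrow> real" where
  "diff_gen F a xb n f x =
     (\<Sum>i\<in>UNIV. F_hat F xb n x $ i * partial_deriv i f x) +
     1/2 * (\<Sum>i\<in>UNIV. \<Sum>j\<in>UNIV.
        a_bar a xb n 0 $ i $ j * partial_deriv i (partial_deriv j f) x)"

definition standing_assumptions ::
  "(nat \<Rightarrow> (real^'d::finite) set) \<Rightarrow> (nat \<Rightarrow> real^'d \<Rightarrow> real^'d \<Rightarrow> real) \<Rightarrow>
   (nat \<Rightarrow> real^'d \<Rightarrow> 'w measure) \<Rightarrow> (nat \<Rightarrow> nat \<Rightarrow> 'w \<Rightarrow> real^'d) \<Rightarrow>
   (nat \<Rightarrow> nat \<Rightarrow> 'w \<Rightarrow> ennreal) \<Rightarrow> (nat \<Rightarrow> real^'d \<Rightarrow> real^'d) \<Rightarrow>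
   (nat \<Rightarrow> real^'d \<Rightarrow> real^'d^'d) \<Rightarrow> (nat \<Rightarrow> real^'d) \<Rightarrow> bool" where
  "standing_assumptions E q P Y S F a xb \<longleftrightarrow>
     bdd_above (jump_sizes E q) \<and>
     (\<forall>n\<in>indices E q.
        ctmc (E n) (q n) (P n) (Y n) (S n) \<and>
        nonexplosive (E n) (P n) (S n) \<and>
        irreducible_rates (E n) (q n) \<and>
        positive_recurrent (E n) (q n) (P n) (Y n) (S n) \<and>
        is_drift (E n) (q n) (F n) \<and>
        is_diffusion (E n) (q n) (a n) \<and>
        (\<forall>x. F n x = 0 \<longleftrightarrow> x = xb n) \<and>
        pos_def (a_bar a xb n 0)) \<and>
     (\<exists>K_F. \<forall>n\<in>indices E q. \<forall>x y.
        norm (F_hat F xb n x - F_hat F xb n y) \<le> K_F * norm (x - y)) \<and>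
     (\<exists>K_a. \<forall>n\<in>indices E q. \<forall>x.
        norm (a_bar a xb n x - a_bar a xb n 0) \<le> K_a / sqrt (real n) * norm x) \<and>
     (\<exists>ab. pos_def ab \<and> (\<lambda>n. a_bar a xb n 0) \<longlonglongrightarrow> ab)"

definition UL_A ::
  "(nat \<Rightarrow> (real^'d::finite) set) \<Rightarrow> (nat \<Rightarrow> real^'d \<Rightarrow> real^'d \<Rightarrow> real) \<Rightarrow>
   (nat \<Rightarrow> real^'d \<Rightarrow> 'w measure) \<Rightarrow> (nat \<Rightarrow> nat \<Rightarrow> 'w \<Rightarrow> real^'d) \<Rightarrow>
   (nat \<Rightarrow> nat \<Rightarrow> 'w \<Rightarrow> ennreal) \<Rightarrow> (nat \<Rightarrow> real^'d \<Rightarrow> real^'d) \<Rightarrow>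
   (nat \<Rightarrow> real^'d \<Rightarrow> real^'d^'d) \<Rightarrow> (nat \<Rightarrow> real^'d) \<Rightarrow>
   (real^'d \<Rightarrow> real) \<Rightarrow> real \<Rightarrow> real \<Rightarrow> real \<Rightarrow> bool" where
  "UL_A E q P Y S F a xb V b \<delta> K \<longleftrightarrow>
     C2 V \<and> sub_exponential V \<and> norm_like V \<and> b > 0 \<and> \<delta> > 0 \<and> K > 0 \<and>
     (\<forall>n\<in>indices E q. \<forall>x.
        diff_gen F a xb n V x \<le> - \<delta> * V x + b * indicator (cball 0 K) x) \<and>
     (\<forall>n\<in>indices E q. \<forall>x\<in>E_hat E xb n. \<forall>t\<ge>0.
        (\<integral>\<^sup>+\<omega>. (\<integral>\<^sup>+s\<in>{0..t}.
           ennreal (((1 + norm (X_hat Y S xb n s \<omega>)) ^ 4 * V (X_hat Y S xb n s \<omega>))\<^sup>2)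
           \<partial>lborel) \<partial>P_hat P xb n x) < \<infinity>)"

end

theory Submission
  imports Defs
begin

text \<open>For large \<open>n\<close> a second-order Taylor expansion turns the drift condition for the diffusion generator
  into one for the generator \<open>L\<close> of the scaled chain, \<open>L V \<le> - (\<delta> / 2) V + b\<close>: replacing the jump moments
  by the coefficients of the diffusion and bounding the Taylor remainder costs \<open>O(V / sqrt n)\<close>.

  Conditioning on the first jump shows that the transition semigroup is the minimal solution of a
  renewal equation. By induction on the number of jumps this gives the integrated Lyapunov inequality,
  without any integrability hypothesis on \<open>V\<close>, as well as the semigroup property. The Laplace transform
  of the renewal equation, decomposed at the first return to a fixed state, identifies the limit of
  \<open>\<lambda> R_\<lambda>\<close> for \<open>\<lambda> \<rightarrow> 0\<close> as an invariant distribution, because the mean return time is finite.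
  Uniqueness and convergence in total variation follow from the positivity of all transition
  probabilities. Finally, a stationary law integrates the truncations \<open>min V m\<close> to at most \<open>2 b / \<delta>\<close>, by
  averaging the Lyapunov inequality over a long time interval.\<close>

section \<open>Convergence to equilibrium for positive kernels\<close>

text \<open>The hypothesis on \<open>V\<close> carries the weight \<open>1 + norm x\<close> because
  both errors in the drift grow linearly: the diffusion coefficient is only Lipschitz, and the
  Taylor remainder is multiplied by the second moment of the jumps, which itself grows at most
  linearly. After division by \<open>sqrt n\<close> both are a small multiple of \<open>V\<close>,
  and large \<open>n\<close> means that this multiple is below \<open>\<delta> / 2\<close>; the
  other half of the decay rate remains for the chain and produces \<open>2 * b / \<delta>\<close>.
  Functions with values in \<open>ennreal\<close> allow the renewal equation to be manipulated where
  expectations of \<open>V\<close> could be infinite; finiteness is an outcome of the Lyapunov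
  inequality. The probabilistic input is the description of the chain after its first jump. In place
  of a strong Markov property at the return time, the Laplace transform turns regeneration into a
  linear equation whose bounded solutions are unique. Truncation of \<open>V\<close> is forced
  because the stationary mean of \<open>V\<close> could a priori be infinite, so that the inequality
  cannot be integrated and the means of \<open>V\<close> cancelled.\<close>

lemma integrable_pmf_bounded:
  fixes f :: "'a \<Rightarrow> real"
  assumes "\<And>x. x \<in> set_pmf p \<Longrightarrow> \<bar>f x\<bar> \<le> B"
  shows "integrable (measure_pmf p) f"
  by (rule measure_pmf.integrable_const_bound[where B=B]) (auto simp: AE_measure_pmf_iff assms)

lemma expectation_pmf_bounds:
  fixes f :: "'a \<Rightarrow> real"
  assumes "\<And>x. x \<in> set_pmf p \<Longrightarrow> c \<le> f x \<and> f x \<le> d"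
  shows "c \<le> measure_pmf.expectation p f" "measure_pmf.expectation p f \<le> d"
proof -
  have i: "integrable (measure_pmf p) f"
    by (rule integrable_pmf_bounded[where B="max \<bar>c\<bar> \<bar>d\<bar>"]) (use assms in fastforce)
  show "c \<le> measure_pmf.expectation p f"
    by (rule measure_pmf.integral_ge_const[OF i]) (auto simp: AE_measure_pmf_iff assms)
  show "measure_pmf.expectation p f \<le> d"
    by (rule measure_pmf.integral_le_const[OF i]) (auto simp: AE_measure_pmf_iff assms)
qed

text \<open>The shift by \<open>B\<close> makes the integrand nonnegative, so that the identity for
  nonnegative integrals applies. The shift cancels because every law involved has mass 1.\<close>

lemma expectation_bind_pmf:
  fixes f :: "'b \<Rightarrow> real"
  assumes B: "\<And>y. \<bar>f y\<bar> \<le> B"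
  shows "measure_pmf.expectation (bind_pmf p k) f =
    measure_pmf.expectation p (\<lambda>x. measure_pmf.expectation (k x) f)"
proof -
  have b: "0 \<le> f y + B" "\<bar>f y + B\<bar> \<le> 2 * B" for y using B[of y] by auto
  have i: "integrable (measure_pmf r) f" for r :: "'b pmf"
    using B by (rule integrable_pmf_bounded)
  have bnd: "\<bar>measure_pmf.expectation r f\<bar> \<le> B" for r :: "'b pmf"
  proof -
    have "-B \<le> f y \<and> f y \<le> B" for y using B[of y] by auto
    then show ?thesis using expectation_pmf_bounds[of r "-B" f B] by auto
  qed
  have i2: "integrable (measure_pmf p) (\<lambda>x. measure_pmf.expectation (k x) f)"
    using bnd by (rule integrable_pmf_bounded)
  have nn: "(\<integral>\<^sup>+y. ennreal (f y + B) \<partial>measure_pmf r) = ennreal (measure_pmf.expectation r f + B)"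
    for r :: "'b pmf"
    by (subst nn_integral_eq_integral) (use b i in auto)
  have "ennreal (measure_pmf.expectation (bind_pmf p k) f + B)
    = (\<integral>\<^sup>+y. ennreal (f y + B) \<partial>measure_pmf (bind_pmf p k))"
    by (simp only: nn)
  also have "\<dots> = (\<integral>\<^sup>+x. ennreal (measure_pmf.expectation (k x) f + B) \<partial>measure_pmf p)"
    by (subst nn_integral_bind_pmf) (simp only: nn)
  also have "\<dots> = ennreal (measure_pmf.expectation p (\<lambda>x. measure_pmf.expectation (k x) f) + B)"
  proof (subst nn_integral_eq_integral)
    show "AE x in measure_pmf p. 0 \<le> measure_pmf.expectation (k x) f + B"
    proof (rule AE_pmfI)
      fix x show "0 \<le> measure_pmf.expectation (k x) f + B" using bnd[of "k x"] by linarith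
    qed
  qed (use i2 in auto)
  finally have "measure_pmf.expectation (bind_pmf p k) f + B =
     measure_pmf.expectation p (\<lambda>x. measure_pmf.expectation (k x) f) + B"
  proof (rule ennreal_inj[THEN iffD1, rotated 2])
    show "0 \<le> measure_pmf.expectation (bind_pmf p k) f + B"
      using bnd[of "bind_pmf p k"] by auto
    have "- B \<le> measure_pmf.expectation (k x) f \<and> measure_pmf.expectation (k x) f \<le> B" for x
      using bnd[of "k x"] by auto
    from expectation_pmf_bounds(1)[of p "-B" "\<lambda>x. measure_pmf.expectation (k x) f", OF this]
    show "0 \<le> measure_pmf.expectation p (\<lambda>x. measure_pmf.expectation (k x) f) + B" by simp
  qed
  then show ?thesis by simp
qed

text \<open>Total variation distance, with test functions valued in the unit interval instead of
  events. Averaging over a Markov kernel preserves this class of functions, whereas it does not map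
  indicators to indicators.\<close>

definition tv :: "'a pmf \<Rightarrow> 'a pmf \<Rightarrow> real" where
  "tv \<mu> \<nu> = (SUP g\<in>{g::'a \<Rightarrow> real. \<forall>z. 0 \<le> g z \<and> g z \<le> 1}.
     \<bar>measure_pmf.expectation \<mu> g - measure_pmf.expectation \<nu> g\<bar>)"

lemma tv_aux:
  assumes "\<And>z. 0 \<le> g z \<and> g z \<le> (1::real)"
  shows "\<bar>measure_pmf.expectation \<mu> g - measure_pmf.expectation \<nu> g\<bar> \<le> 1"
proof -
  have "0 \<le> measure_pmf.expectation r g \<and> measure_pmf.expectation r g \<le> 1" for r
    using expectation_pmf_bounds[of r 0 g 1] assms by auto
  from this[of \<mu>] this[of \<nu>] show ?thesis by linarith
qed

lemma tv_bdd: "bdd_above ((\<lambda>g. \<bar>measure_pmf.expectation \<mu> g - measure_pmf.expectation \<nu> g\<bar>) `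
   {g::'a \<Rightarrow> real. \<forall>z. 0 \<le> g z \<and> g z \<le> 1})"
  by (rule bdd_aboveI[where M=1]) (auto intro: tv_aux)

lemma tv_ge:
  assumes "\<And>z. 0 \<le> g z \<and> g z \<le> (1::real)"
  shows "\<bar>measure_pmf.expectation \<mu> g - measure_pmf.expectation \<nu> g\<bar> \<le> tv \<mu> \<nu>"
  unfolding tv_def by (rule cSUP_upper[OF _ tv_bdd]) (use assms in auto)

lemma tv_le:
  assumes "\<And>g. (\<And>z. 0 \<le> g z \<and> g z \<le> (1::real)) \<Longrightarrow>
    \<bar>measure_pmf.expectation \<mu> g - measure_pmf.expectation \<nu> g\<bar> \<le> c"
  shows "tv \<mu> \<nu> \<le> c"
  unfolding tv_def by (rule cSUP_least) (auto intro!: assms exI[of _ "\<lambda>_. 0"])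

lemma tv_nonneg: "0 \<le> tv \<mu> \<nu>"
  using tv_ge[of "\<lambda>_. 0" \<mu> \<nu>] by simp

lemma tv_le_1: "tv \<mu> \<nu> \<le> 1"
  by (rule tv_le) (rule tv_aux)

lemma tv_self [simp]: "tv \<mu> \<mu> = 0"
  by (rule antisym[OF tv_le tv_nonneg]) simp

lemma expectation_01:
  assumes "\<And>z. 0 \<le> g z \<and> g z \<le> (1::real)"
  shows "0 \<le> measure_pmf.expectation \<mu> g \<and> measure_pmf.expectation \<mu> g \<le> 1"
  using expectation_pmf_bounds[of \<mu> 0 g 1] assms by auto

lemma tv_ge_measure: "\<bar>measure_pmf.prob \<mu> A - measure_pmf.prob \<nu> A\<bar> \<le> tv \<mu> \<nu>"
proof -
  have "\<bar>measure_pmf.expectation \<mu> (indicator A) - measure_pmf.expectation \<nu> (indicator A)\<bar> \<le> tv \<mu> \<nu>"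
    by (rule tv_ge) (simp add: indicator_def)
  then show ?thesis by simp
qed

lemma tv_bind_le: "tv (bind_pmf \<mu> k) (bind_pmf \<nu> k) \<le> tv \<mu> \<nu>"
proof (rule tv_le)
  fix g :: "'a \<Rightarrow> real" assume g: "\<And>z. 0 \<le> g z \<and> g z \<le> 1"
  then have 1: "\<bar>g y\<bar> \<le> 1" for y by simp
  show "\<bar>measure_pmf.expectation (bind_pmf \<mu> k) g - measure_pmf.expectation (bind_pmf \<nu> k) g\<bar> \<le> tv \<mu> \<nu>"
    unfolding expectation_bind_pmf[OF 1] by (intro tv_ge expectation_01 g)
qed

text \<open>Convexity of the distance: with the two starting points drawn independently, the
  difference of the expectations is the mean of the differences for fixed starting points, and each
  of these is at most \<open>tv (k x) (l y)\<close>.\<close>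

lemma tv_bind_le_expectation:
  "tv (bind_pmf \<mu> k) (bind_pmf \<nu> l) \<le>
    measure_pmf.expectation (pair_pmf \<mu> \<nu>) (\<lambda>(x, y). tv (k x) (l y))"
proof (rule tv_le)
  fix g :: "'a \<Rightarrow> real" assume g: "\<And>z. 0 \<le> g z \<and> g z \<le> 1"
  then have 1: "\<bar>g y\<bar> \<le> 1" for y by simp
  have b: "\<bar>measure_pmf.expectation r g\<bar> \<le> 1" for r :: "'a pmf"
    using expectation_01[OF g, of r] by (simp add: abs_le_iff)
  let ?Ek = "\<lambda>z. measure_pmf.expectation (k (fst z)) g"
  let ?El = "\<lambda>z. measure_pmf.expectation (l (snd z)) g"
  have i: "integrable (measure_pmf (pair_pmf \<mu> \<nu>)) ?Ek" "integrable (measure_pmf (pair_pmf \<mu> \<nu>)) ?El"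
    by (auto intro!: integrable_pmf_bounded[where B=1] b)
  have "\<bar>measure_pmf.expectation (bind_pmf \<mu> k) g - measure_pmf.expectation (bind_pmf \<nu> l) g\<bar>
    = \<bar>measure_pmf.expectation (pair_pmf \<mu> \<nu>) ?Ek - measure_pmf.expectation (pair_pmf \<mu> \<nu>) ?El\<bar>"
    unfolding expectation_bind_pmf[OF 1]
      expectation_pair_pmf_fst[of \<mu> \<nu> "\<lambda>x. measure_pmf.expectation (k x) g"]
      expectation_pair_pmf_snd[of \<mu> \<nu> "\<lambda>x. measure_pmf.expectation (l x) g"] ..
  also have "\<dots> = \<bar>measure_pmf.expectation (pair_pmf \<mu> \<nu>) (\<lambda>z. ?Ek z - ?El z)\<bar>"
    by (subst Bochner_Integration.integral_diff[OF i]) simp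
  also have "\<dots> \<le> measure_pmf.expectation (pair_pmf \<mu> \<nu>) (\<lambda>z. \<bar>?Ek z - ?El z\<bar>)"
    by (rule integral_abs_bound)
  also have "\<dots> \<le> measure_pmf.expectation (pair_pmf \<mu> \<nu>) (\<lambda>(x, y). tv (k x) (l y))"
  proof (rule integral_mono)
    show "integrable (measure_pmf (pair_pmf \<mu> \<nu>)) (\<lambda>z. \<bar>?Ek z - ?El z\<bar>)"
      using i by auto
    show "integrable (measure_pmf (pair_pmf \<mu> \<nu>)) (\<lambda>(x, y). tv (k x) (l y))"
      by (rule integrable_pmf_bounded[where B=1]) (auto simp: tv_nonneg tv_le_1)
  qed (auto intro!: tv_ge g)
  finally show "\<bar>measure_pmf.expectation (bind_pmf \<mu> k) g - measure_pmf.expectation (bind_pmf \<nu> l) g\<bar>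
    \<le> measure_pmf.expectation (pair_pmf \<mu> \<nu>) (\<lambda>(x, y). tv (k x) (l y))" .
qed

text \<open>Two independent copies of a chain move by the product kernel. If \<open>\<mu>\<close>
  and \<open>\<nu>\<close> are one invariant law, this shows that its product is invariant for the
  pair.\<close>

lemma pair_bind_pmf:
  "bind_pmf (pair_pmf \<mu> \<nu>) (\<lambda>z. pair_pmf (k (fst z)) (l (snd z))) = pair_pmf (bind_pmf \<mu> k) (bind_pmf \<nu> l)"
  unfolding pair_pmf_def bind_assoc_pmf bind_return_pmf fst_conv snd_conv
  by (intro bind_pmf_cong[OF refl]) (rule bind_commute_pmf)

text \<open>\<open>g - f\<close> is nonnegative on the support and has mean 0. Under an invariant
  law a function and its one-step average have the same mean, so a one-sided inequality between them
  becomes an identity at every point of the support.\<close>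

lemma expectation_eq_imp_eq:
  fixes f g :: "'a \<Rightarrow> real"
  assumes le: "\<And>x. x \<in> set_pmf p \<Longrightarrow> f x \<le> g x"
    and B: "\<And>x. \<bar>f x\<bar> \<le> B" "\<And>x. \<bar>g x\<bar> \<le> B"
    and eq: "measure_pmf.expectation p f = measure_pmf.expectation p g"
    and x: "x \<in> set_pmf p"
  shows "f x = g x"
proof -
  have i: "integrable (measure_pmf p) f" "integrable (measure_pmf p) g"
    using B by (auto intro: integrable_pmf_bounded)
  have "AE x in measure_pmf p. g x - f x = 0"
    using i eq le
    by (intro integral_nonneg_eq_0_iff_AE[THEN iffD1]) (auto simp: AE_measure_pmf_iff)
  with x show ?thesis by (auto simp: AE_measure_pmf_iff)
qed

text \<open>The limit of \<open>tv (p n x) (p n y)\<close> is a bounded function, harmonic for two independent copies of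
  the chain. So is its square, by invariance of \<open>\<pi> \<times> \<pi>\<close>; hence the limit has zero variance under the
  everywhere positive law of one step and is constant.\<close>

lemma tv_pmf_powers_tendsto_0:
  fixes p :: "nat \<Rightarrow> 'a \<Rightarrow> 'a pmf"
  assumes ck: "\<And>m n x. x \<in> E \<Longrightarrow> p (m + n) x = bind_pmf (p m x) (p n)"
    and supp: "\<And>x. x \<in> E \<Longrightarrow> set_pmf (p 1 x) = E"
    and \<pi>: "set_pmf \<pi> = E" "bind_pmf \<pi> (p 1) = \<pi>"
    and x: "x \<in> E" and y: "y \<in> E"
  shows "(\<lambda>n. tv (p n x) (p n y)) \<longlonglongrightarrow> 0"
proof -
  define T where "T n z = tv (p n (fst z)) (p n (snd z))" for n z
  define D where "D z = (INF n. T n z)" for z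
  define Q where "Q z = pair_pmf (p 1 (fst z)) (p 1 (snd z))" for z
  have T01: "0 \<le> T n z" "T n z \<le> 1" for n z unfolding T_def by (simp_all add: tv_nonneg tv_le_1)
  have dec: "T (Suc n) z \<le> T n z" if "z \<in> E \<times> E" for n z
    using ck[of "fst z" n 1] ck[of "snd z" n 1] that tv_bind_le[of "p n (fst z)" "p 1" "p n (snd z)"]
    unfolding T_def by auto
  have lim: "(\<lambda>n. T n z) \<longlonglongrightarrow> D z" if "z \<in> E \<times> E" for z
    unfolding D_def
    by (rule LIMSEQ_decseq_INF) (auto intro!: bdd_belowI[of _ 0] decseq_SucI dec that simp: T01)
  have D01: "0 \<le> D z" "D z \<le> 1" for z
  proof -
    show "0 \<le> D z" unfolding D_def by (rule cINF_greatest) (auto simp: T01)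
    show "D z \<le> 1" unfolding D_def
      by (rule cINF_lower2[of _ _ 0]) (auto intro!: bdd_belowI[of _ 0] simp: T01)
  qed
  have setQ: "set_pmf (Q z) = E \<times> E" if "z \<in> E \<times> E" for z
    using that supp[of "fst z"] supp[of "snd z"] by (simp add: Q_def mem_Times_iff)
  \<comment> \<open>Each copy takes one step on its own; convexity of \<open>tv\<close> bounds
    \<open>T (Suc n) z\<close> by the mean of \<open>T n\<close> over the pair so reached, and
    dominated convergence gives the same for the limit.\<close>
  have sub: "D z \<le> measure_pmf.expectation (Q z) D" if z: "z \<in> E \<times> E" for z
  proof (rule LIMSEQ_le[where X="\<lambda>n. T (Suc n) z" and Y="\<lambda>n. measure_pmf.expectation (Q z) (T n)"])
    show "(\<lambda>n. T (Suc n) z) \<longlonglongrightarrow> D z" using lim[OF z] by (rule LIMSEQ_Suc)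
    show "(\<lambda>n. measure_pmf.expectation (Q z) (T n)) \<longlonglongrightarrow> measure_pmf.expectation (Q z) D"
    proof (rule integral_dominated_convergence[where w="\<lambda>_. 1"])
      show "AE x in measure_pmf (Q z). (\<lambda>i. T i x) \<longlonglongrightarrow> D x"
        by (auto simp: AE_measure_pmf_iff setQ[OF z] intro!: lim)
    qed (auto simp: T01)
    have "T (Suc n) z \<le> measure_pmf.expectation (Q z) (T n)" for n
    proof -
      have "T (Suc n) z = tv (bind_pmf (p 1 (fst z)) (p n)) (bind_pmf (p 1 (snd z)) (p n))"
        unfolding T_def using ck[of _ 1 n] z by auto
      also have "\<dots> \<le> measure_pmf.expectation (Q z) (T n)"
        using tv_bind_le_expectation[of "p 1 (fst z)" "p n" "p 1 (snd z)" "p n"]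
        unfolding T_def Q_def by (simp add: case_prod_beta')
      finally show ?thesis .
    qed
    then have *: "\<exists>N. \<forall>n\<ge>N. T (Suc n) z \<le> measure_pmf.expectation (Q z) (T n)" by blast
    show "\<exists>N. \<forall>n\<ge>N. T (Suc n) z \<le> measure_pmf.expectation (Q z) (T n)" by (rule *)
  qed
  have inv: "bind_pmf (pair_pmf \<pi> \<pi>) Q = pair_pmf \<pi> \<pi>"
    using pair_bind_pmf[of \<pi> \<pi> "p 1" "p 1"] unfolding \<pi>(2) Q_def[abs_def] .
  have inv': "measure_pmf.expectation (pair_pmf \<pi> \<pi>) (\<lambda>z. measure_pmf.expectation (Q z) f) =
     measure_pmf.expectation (pair_pmf \<pi> \<pi>) f" if "\<And>z. 0 \<le> f z \<and> f z \<le> 1" for f :: "'a \<times> 'a \<Rightarrow> real"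
  proof -
    have "\<bar>f z\<bar> \<le> 1" for z using that[of z] by auto
    from expectation_bind_pmf[of f, OF this, of "pair_pmf \<pi> \<pi>" Q] show ?thesis unfolding inv by (rule sym)
  qed
  have E01: "\<bar>measure_pmf.expectation (Q z) f\<bar> \<le> 1" if "\<And>z. 0 \<le> f z \<and> f z \<le> 1" for f :: "'a \<times> 'a \<Rightarrow> real" and z
    using expectation_01[of f "Q z"] that by auto
  have sq: "(D z)\<^sup>2 \<le> 1" for z using D01[of z] by (simp add: power_le_one)
  note Q1 = expectation_01[of D, OF conjI[OF D01], THEN conjunct2]
    expectation_01[of "\<lambda>w. (D w)\<^sup>2", OF conjI[OF zero_le_power2 sq], THEN conjunct2] E01[of D, OF conjI[OF D01]] E01[of "\<lambda>w. (D w)\<^sup>2", OF conjI[OF zero_le_power2 sq]]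
  \<comment> \<open>\<open>sub\<close> bounds \<open>D\<close> by its one-step average, and both
    have the same mean under the invariant product law, whose support is
    \<open>E \<times> E\<close>.\<close>
  have harm: "D z = measure_pmf.expectation (Q z) D" if z: "z \<in> E \<times> E" for z
    by (rule expectation_eq_imp_eq[where p="pair_pmf \<pi> \<pi>" and B=1])
       (use z \<pi> in \<open>auto intro!: sub Q1 inv'[symmetric] simp: D01\<close>)
  have int: "integrable (measure_pmf (Q z)) D" "integrable (measure_pmf (Q z)) (\<lambda>w. (D w)\<^sup>2)" for z
    by (auto intro!: integrable_pmf_bounded[where B=1] simp: D01 sq)
  have var: "measure_pmf.expectation (Q z) (\<lambda>w. (D w - D z)\<^sup>2) =
      measure_pmf.expectation (Q z) (\<lambda>w. (D w)\<^sup>2) - (D z)\<^sup>2" if z: "z \<in> E \<times> E" for z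
  proof -
    have "measure_pmf.expectation (Q z) (\<lambda>w. (D w - D z)\<^sup>2) =
      measure_pmf.expectation (Q z) (\<lambda>w. (D w)\<^sup>2 - 2 * D z * D w + (D z)\<^sup>2)"
      by (simp add: power2_diff algebra_simps)
    also have "\<dots> = measure_pmf.expectation (Q z) (\<lambda>w. (D w)\<^sup>2) -
        2 * D z * measure_pmf.expectation (Q z) D + (D z)\<^sup>2"
      using int by simp
    finally show ?thesis using harm[OF z] by (simp add: power2_eq_square)
  qed
  \<comment> \<open>The variance over one step is nonnegative, which makes the square of
    \<open>D\<close> subharmonic; equal means then force equality once more.\<close>
  have sub2: "(D z)\<^sup>2 \<le> measure_pmf.expectation (Q z) (\<lambda>w. (D w)\<^sup>2)" if z: "z \<in> E \<times> E" for z
  proof -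
    have "0 \<le> measure_pmf.expectation (Q z) (\<lambda>w. (D w - D z)\<^sup>2)" by simp
    then show ?thesis using var[OF z] by simp
  qed
  have eq2: "(D z)\<^sup>2 = measure_pmf.expectation (Q z) (\<lambda>w. (D w)\<^sup>2)" if z: "z \<in> E \<times> E" for z
    by (rule expectation_eq_imp_eq[where p="pair_pmf \<pi> \<pi>" and B=1])
       (use z \<pi> in \<open>auto intro!: sub2 Q1 inv'[symmetric] simp: D01 sq\<close>)
  have z: "(x, y) \<in> E \<times> E" using x y by simp
  have "AE w in measure_pmf (Q (x,y)). (D w - D (x,y))\<^sup>2 = 0"
  proof (rule integral_nonneg_eq_0_iff_AE[THEN iffD1])
    show "integrable (measure_pmf (Q (x,y))) (\<lambda>w. (D w - D (x,y))\<^sup>2)"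
    proof (rule integrable_pmf_bounded[where B=1])
      fix w
      have "\<bar>D w - D (x,y)\<bar> \<le> 1" using D01[of w] D01[of "(x,y)"] by auto
      then show "\<bar>(D w - D (x,y))\<^sup>2\<bar> \<le> 1" by (simp add: abs_square_le_1)
    qed
    show "measure_pmf.expectation (Q (x,y)) (\<lambda>w. (D w - D (x,y))\<^sup>2) = 0"
      using var[OF z] eq2[OF z] by simp
  qed auto
  then have "\<forall>w\<in>E \<times> E. (D w - D (x,y))\<^sup>2 = 0"
    by (simp only: AE_measure_pmf_iff setQ[OF z])
  \<comment> \<open>The constant is read off on the diagonal, which one step charges: two copies
    started in the same state are at distance 0.\<close>
  then have "(D (x, x) - D (x, y))\<^sup>2 = 0" using x by blast
  then have "D (x, x) = D (x, y)" by simp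
  moreover have "D (x, x) = 0" unfolding D_def T_def by simp
  ultimately show ?thesis using lim[OF z] unfolding T_def by simp
qed

text \<open>Invariance writes \<open>\<pi>\<close> as the mixture of the laws \<open>p t y\<close>,
  so the distance is at most the \<open>\<pi>\<close>-mean of \<open>tv (p t x) (p t y)\<close>,
  which vanishes along the integers. Invariance also makes the distance nonincreasing in
  \<open>t\<close>, so the integers control all times.\<close>

lemma tv_tendsto_0:
  fixes p :: "real \<Rightarrow> 'a \<Rightarrow> 'a pmf"
  assumes ck: "\<And>s t x. s \<ge> 0 \<Longrightarrow> t \<ge> 0 \<Longrightarrow> x \<in> E \<Longrightarrow> p (s + t) x = bind_pmf (p s x) (p t)"
    and supp: "\<And>t x. t > 0 \<Longrightarrow> x \<in> E \<Longrightarrow> set_pmf (p t x) = E"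
    and \<pi>: "set_pmf \<pi> \<subseteq> E" "\<And>t. t \<ge> 0 \<Longrightarrow> bind_pmf \<pi> (p t) = \<pi>"
    and x: "x \<in> E"
  shows "((\<lambda>t. tv (p t x) \<pi>) \<longlongrightarrow> 0) at_top"
proof -
  \<comment> \<open>Positivity of the kernel at time 1 spreads any invariant law over the whole of
    \<open>E\<close>.\<close>
  have E: "set_pmf \<pi> = E"
  proof -
    have "set_pmf \<pi> = (\<Union>y\<in>set_pmf \<pi>. set_pmf (p 1 y))" using \<pi>(2)[of 1] by (metis set_bind_pmf zero_le_one)
    also have "\<dots> = E" using supp[of 1] \<pi>(1) set_pmf_not_empty[of \<pi>] by fastforce
    finally show ?thesis .
  qed
  have bnd: "tv (p (real n) x) \<pi> \<le> measure_pmf.expectation \<pi> (\<lambda>y. tv (p (real n) x) (p (real n) y))" for n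
  proof -
    have "tv (p (real n) x) \<pi> = tv (bind_pmf (return_pmf x) (p (real n))) (bind_pmf \<pi> (p (real n)))"
      using \<pi>(2)[of "real n"] by (simp add: bind_return_pmf)
    also have "\<dots> \<le> measure_pmf.expectation \<pi> (\<lambda>y. tv (p (real n) x) (p (real n) y))"
      by (rule order_trans[OF tv_bind_le_expectation]) (simp add: pair_return_pmf1)
    finally show ?thesis .
  qed
  have lim: "(\<lambda>n. tv (p (real n) x) \<pi>) \<longlonglongrightarrow> 0"
  proof (rule tendsto_sandwich[OF _ _ tendsto_const])
    have "(\<lambda>n. measure_pmf.expectation \<pi> (\<lambda>y. tv (p (real n) x) (p (real n) y)))
       \<longlonglongrightarrow> measure_pmf.expectation \<pi> (\<lambda>y. 0)"
    proof (rule integral_dominated_convergence[where w="\<lambda>_. 1"])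
      show "AE y in measure_pmf \<pi>. (\<lambda>n. tv (p (real n) x) (p (real n) y)) \<longlonglongrightarrow> 0"
      proof (rule AE_pmfI)
        fix y assume "y \<in> set_pmf \<pi>"
        then show "(\<lambda>n. tv (p (real n) x) (p (real n) y)) \<longlonglongrightarrow> 0"
          using tv_pmf_powers_tendsto_0[of E "\<lambda>n. p (real n)" \<pi> x y] ck supp \<pi> E x by auto
      qed
    qed (auto simp: tv_nonneg tv_le_1)
    then show "(\<lambda>n. measure_pmf.expectation \<pi> (\<lambda>y. tv (p (real n) x) (p (real n) y))) \<longlonglongrightarrow> 0" by simp
  qed (auto simp: tv_nonneg bnd)
  have mono: "tv (p t x) \<pi> \<le> tv (p s x) \<pi>" if "0 \<le> s" "s \<le> t" for s t
    using ck[of s "t - s" x] that x \<pi>(2)[of "t - s"] tv_bind_le[of "p s x" "p (t - s)" \<pi>] by auto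
  have lim2: "((\<lambda>t. tv (p (real (nat \<lfloor>t\<rfloor>)) x) \<pi>) \<longlongrightarrow> 0) at_top"
    by (rule filterlim_compose[OF lim])
       (rule filterlim_compose[OF filterlim_nat_sequentially filterlim_floor_sequentially])
  show ?thesis
  proof (rule tendsto_sandwich[OF _ _ tendsto_const lim2])
    show "\<forall>\<^sub>F t in at_top. 0 \<le> tv (p t x) \<pi>" by (simp add: tv_nonneg)
    show "\<forall>\<^sub>F t in at_top. tv (p t x) \<pi> \<le> tv (p (real (nat \<lfloor>t\<rfloor>)) x) \<pi>"
      using eventually_ge_at_top[of "0::real"]
    proof eventually_elim
      case (elim t)
      then show ?case by (intro mono) (auto simp: of_nat_floor)
    qed
  qed
qed

text \<open>A pmf is determined by its singletons; a singleton outside \<open>E\<close> has mass 0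
  on both sides, so testing subsets of \<open>E\<close> is enough.\<close>

lemma stationary_iff_bind_pmf:
  assumes p: "\<And>t x A. t \<ge> 0 \<Longrightarrow> x \<in> E \<Longrightarrow> A \<subseteq> E \<Longrightarrow> trans_prob P X t x A = measure_pmf.prob (p t x) A"
    and supp: "\<And>t x. t \<ge> 0 \<Longrightarrow> x \<in> E \<Longrightarrow> set_pmf (p t x) \<subseteq> E"
  shows "stationary E P X \<nu> \<longleftrightarrow> set_pmf \<nu> \<subseteq> E \<and> (\<forall>t\<ge>0. bind_pmf \<nu> (p t) = \<nu>)"
proof -
  have ex: "measure_pmf.expectation \<nu> (\<lambda>x. trans_prob P X t x A) = measure_pmf.prob (bind_pmf \<nu> (p t)) A"
    if "set_pmf \<nu> \<subseteq> E" "t \<ge> 0" "A \<subseteq> E" for t A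
  proof -
    have "measure_pmf.expectation \<nu> (\<lambda>x. trans_prob P X t x A) =
        measure_pmf.expectation \<nu> (\<lambda>x. measure_pmf.prob (p t x) A)"
      by (intro integral_cong_AE) (use that in \<open>auto simp: AE_measure_pmf_iff intro!: p\<close>)
    also have "\<dots> = measure_pmf.expectation (bind_pmf \<nu> (p t)) (indicator A)"
      by (subst expectation_bind_pmf[where B=1]) (auto simp: indicator_def)
    finally show ?thesis by simp
  qed
  show ?thesis
  proof (intro iffI conjI allI impI)
    fix t :: real assume st: "stationary E P X \<nu>" and t: "0 \<le> t"
    then have sub: "set_pmf \<nu> \<subseteq> E" unfolding stationary_def by simp
    show "bind_pmf \<nu> (p t) = \<nu>"
    proof (rule pmf_eqI)
      fix y
      show "pmf (bind_pmf \<nu> (p t)) y = pmf \<nu> y"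
      proof (cases "y \<in> E")
        case True
        then have "measure_pmf.prob \<nu> {y} = measure_pmf.prob (bind_pmf \<nu> (p t)) {y}"
          using st t ex[OF sub t, of "{y}"] unfolding stationary_def by simp
        then show ?thesis by (simp add: measure_pmf_single)
      next
        case False
        then have "y \<notin> set_pmf \<nu>" "y \<notin> set_pmf (bind_pmf \<nu> (p t))"
          using sub supp[OF t] by (auto simp: subset_iff)
        then show ?thesis by (metis pmf_eq_0_set_pmf)
      qed
    qed
  next
    assume "set_pmf \<nu> \<subseteq> E \<and> (\<forall>t\<ge>0. bind_pmf \<nu> (p t) = \<nu>)"
    then show "stationary E P X \<nu>" unfolding stationary_def by (simp add: ex)
  qed (simp add: stationary_def)
qed

lemma ergodic_pmfI:
  assumes p: "\<And>t x A. t \<ge> 0 \<Longrightarrow> x \<in> E \<Longrightarrow> A \<subseteq> E \<Longrightarrow> trans_prob P X t x A = measure_pmf.prob (p t x) A"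
    and ck: "\<And>s t x. s \<ge> 0 \<Longrightarrow> t \<ge> 0 \<Longrightarrow> x \<in> E \<Longrightarrow> p (s + t) x = bind_pmf (p s x) (p t)"
    and supp0: "\<And>t x. t \<ge> 0 \<Longrightarrow> x \<in> E \<Longrightarrow> set_pmf (p t x) \<subseteq> E"
    and supp: "\<And>t x. t > 0 \<Longrightarrow> x \<in> E \<Longrightarrow> set_pmf (p t x) = E"
    and \<pi>: "set_pmf \<pi> \<subseteq> E" "\<And>t. t \<ge> 0 \<Longrightarrow> bind_pmf \<pi> (p t) = \<pi>"
  shows "ergodic E P X"
proof -
  have st: "stationary E P X \<nu> \<longleftrightarrow> set_pmf \<nu> \<subseteq> E \<and> (\<forall>t\<ge>0. bind_pmf \<nu> (p t) = \<nu>)" for \<nu>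
    using p supp0 by (rule stationary_iff_bind_pmf)
  have E: "E \<noteq> {}" using \<pi>(1) set_pmf_not_empty[of \<pi>] by auto
  then obtain x where x: "x \<in> E" by auto
  \<comment> \<open>Uniqueness is a by-product of convergence: from one fixed state the transition
    laws converge pointwise to every stationary law.\<close>
  have uniq: "\<nu> = \<pi>" if "stationary E P X \<nu>" for \<nu>
  proof (rule pmf_eqI)
    fix y
    have lim: "((\<lambda>t. pmf (p t x) y) \<longlongrightarrow> pmf \<nu> y) at_top" if "stationary E P X \<nu>" for \<nu>
    proof -
      have a: "((\<lambda>t. tv (p t x) \<nu>) \<longlongrightarrow> 0) at_top"
        using that x by (intro tv_tendsto_0[of E p]) (simp_all add: st ck supp)
      have b: "\<bar>pmf (p t x) y - pmf \<nu> y\<bar> \<le> tv (p t x) \<nu>" for t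
        using tv_ge_measure[of "p t x" "{y}" \<nu>] by (simp add: measure_pmf_single)
      show ?thesis
        by (rule LIM_zero_cancel, rule Lim_null_comparison[OF _ a]) (simp add: b)
    qed
    have "stationary E P X \<pi>" by (simp add: \<pi> st)
    from tendsto_unique[OF _ lim[OF that] lim[OF this]] show "pmf \<nu> y = pmf \<pi> y" by simp
  qed
  show ?thesis unfolding ergodic_def
  proof (intro conjI allI impI ballI)
    show "\<exists>!\<nu>. stationary E P X \<nu>" by (rule ex1I[OF st[THEN iffD2] uniq]) (simp add: \<pi>)
    fix \<nu> x assume \<nu>: "stationary E P X \<nu>" and x: "x \<in> E"
    have lim: "((\<lambda>t. tv (p t x) \<nu>) \<longlongrightarrow> 0) at_top"
      using \<nu> x by (intro tv_tendsto_0[of E p]) (simp_all add: st ck supp)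
    show "((\<lambda>t. SUP A\<in>Pow E. \<bar>trans_prob P X t x A - measure_pmf.prob \<nu> A\<bar>) \<longlongrightarrow> 0) at_top"
    proof (rule tendsto_sandwich[OF _ _ tendsto_const lim])
      have le: "\<bar>trans_prob P X t x A - measure_pmf.prob \<nu> A\<bar> \<le> tv (p t x) \<nu>" if "t \<ge> 0" "A \<subseteq> E" for t A
        using tv_ge_measure[of "p t x" A \<nu>] p[OF that(1) x that(2)] by simp
      show "\<forall>\<^sub>F t in at_top. (SUP A\<in>Pow E. \<bar>trans_prob P X t x A - measure_pmf.prob \<nu> A\<bar>) \<le> tv (p t x) \<nu>"
        using eventually_ge_at_top[of "0::real"]
      proof eventually_elim
        case (elim t)
        show ?case by (rule cSUP_least) (auto intro: le[OF elim])
      qed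
      show "\<forall>\<^sub>F t in at_top. 0 \<le> (SUP A\<in>Pow E. \<bar>trans_prob P X t x A - measure_pmf.prob \<nu> A\<bar>)"
        using eventually_ge_at_top[of "0::real"]
      proof eventually_elim
        case (elim t)
        have bdd: "bdd_above ((\<lambda>A. \<bar>trans_prob P X t x A - measure_pmf.prob \<nu> A\<bar>) ` Pow E)"
          using le[OF elim] by (intro bdd_aboveI[where M="tv (p t x) \<nu>"]) blast
        show ?case
          by (rule cSUP_upper2[OF bdd _, of "{}"]) auto
      qed
    qed
  qed
qed

section \<open>The minimal semigroup of a jump process\<close>

lemma nn_integral_pmf_conv_count_space:
  "(\<integral>\<^sup>+y. f y \<partial>measure_pmf p) = (\<integral>\<^sup>+y. ennreal (pmf p y) * f y \<partial>count_space (set_pmf p))"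
proof -
  have "(\<integral>\<^sup>+y. f y \<partial>measure_pmf p) = (\<integral>\<^sup>+y. ennreal (pmf p y) * f y * indicator (set_pmf p) y \<partial>count_space UNIV)"
    unfolding nn_integral_measure_pmf
    by (intro nn_integral_cong) (simp add: indicator_def pmf_eq_0_set_pmf)
  also have "\<dots> = (\<integral>\<^sup>+y. ennreal (pmf p y) * f y \<partial>count_space (set_pmf p))"
    by (subst nn_integral_count_space_indicator) simp_all
  finally show ?thesis .
qed

text \<open>The integrand is measurable in \<open>t\<close> for each fixed \<open>y\<close> only. A
  pmf lives on a countable set, over which a family of measurable functions is jointly
  measurable.\<close>

lemma borel_measurable_nn_integral_pmf [measurable (raw)]:
  assumes [measurable]: "\<And>y. (\<lambda>t. f t y) \<in> borel_measurable M"
  shows "(\<lambda>t. \<integral>\<^sup>+y. f t y \<partial>measure_pmf p) \<in> borel_measurable M"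
proof -
  interpret sigma_finite_measure "count_space (set_pmf p)"
    by (rule sigma_finite_measure_count_space_countable) simp
  have "(\<lambda>(y, t). ennreal (pmf p y) * f t y) \<in> borel_measurable (count_space (set_pmf p) \<Otimes>\<^sub>M M)"
    by (rule measurable_pair_measure_countable1) simp_all
  then have "(\<lambda>(t, y). ennreal (pmf p y) * f t y) \<in> borel_measurable (M \<Otimes>\<^sub>M count_space (set_pmf p))"
    by (subst measurable_pair_swap_iff) (simp add: case_prod_beta')
  then show ?thesis
    unfolding nn_integral_pmf_conv_count_space by (rule borel_measurable_nn_integral)
qed

lemma nn_integral_pmf_swap:
  assumes [measurable]: "\<And>y. (\<lambda>t. f t y) \<in> borel_measurable M"
  shows "(\<integral>\<^sup>+t. \<integral>\<^sup>+y. f t y \<partial>measure_pmf p \<partial>M) = (\<integral>\<^sup>+y. \<integral>\<^sup>+t. f t y \<partial>M \<partial>measure_pmf p)"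
proof -
  have "(\<integral>\<^sup>+t. \<integral>\<^sup>+y. f t y \<partial>measure_pmf p \<partial>M) =
      (\<integral>\<^sup>+y. \<integral>\<^sup>+t. ennreal (pmf p y) * f t y \<partial>M \<partial>count_space (set_pmf p))"
    unfolding nn_integral_pmf_conv_count_space by (rule nn_integral_count_space_nn_integral) simp_all
  also have "\<dots> = (\<integral>\<^sup>+y. \<integral>\<^sup>+t. f t y \<partial>M \<partial>measure_pmf p)"
    unfolding nn_integral_pmf_conv_count_space by (simp add: nn_integral_cmult)
  finally show ?thesis .
qed

lemma nn_integral_lborel_shift:
  fixes h :: "real \<Rightarrow> ennreal"
  assumes "h \<in> borel_measurable borel"
  shows "(\<integral>\<^sup>+t. h (t + s) \<partial>lborel) = (\<integral>\<^sup>+t. h t \<partial>lborel)"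
  using nn_integral_real_affine[OF assms, of 1 s] by (simp add: add.commute)

abbreviation expd :: "real \<Rightarrow> real \<Rightarrow> ennreal" where
  "expd l s \<equiv> ennreal (exponential_density l s)"

lemma borel_measurable_expd: "expd l \<in> borel_measurable borel"
  unfolding exponential_density_def by measurable

lemma nn_integral_expd: "l > 0 \<Longrightarrow> (\<integral>\<^sup>+s. expd l s \<partial>lborel) = 1"
proof -
  assume "l > 0"
  then interpret prob_space "density lborel (exponential_density l)"
    by (rule prob_space_exponential_density)
  show ?thesis using emeasure_space_1 borel_measurable_expd[of l] by (simp add: emeasure_density)
qed

locale jump_process =
  fixes r :: "'a \<Rightarrow> real" and J :: "'a \<Rightarrow> 'a pmf"
  assumes r_pos: "\<And>x. 0 < r x"
begin

text \<open>Conditioning on the first jump: with probability \<open>exp (- r x * t)\<close> the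
  chain still sits in \<open>x\<close> at time \<open>t\<close>, otherwise it restarts from the
  state after the jump. The integral has no upper limit \<open>t\<close> because \<open>w\<close> is
  meant to vanish at negative times; the indicator keeps this convention.\<close>

definition step :: "('a \<Rightarrow> ennreal) \<Rightarrow> (real \<Rightarrow> 'a \<Rightarrow> ennreal) \<Rightarrow> real \<Rightarrow> 'a \<Rightarrow> ennreal" where
  "step f w t x = indicator {0..} t * (f x * ennreal (exp (- r x * t))) +
     (\<integral>\<^sup>+s. expd (r x) s * (\<integral>\<^sup>+y. w (t - s) y \<partial>measure_pmf (J x)) \<partial>lborel)"

text \<open>Expectation of \<open>f\<close> at time \<open>t\<close> on the event of fewer than
  \<open>k\<close> jumps up to \<open>t\<close>; each application of \<open>step\<close> allows one
  jump more.\<close>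

primrec semigroup_upto :: "nat \<Rightarrow> ('a \<Rightarrow> ennreal) \<Rightarrow> real \<Rightarrow> 'a \<Rightarrow> ennreal" where
  "semigroup_upto 0 f = (\<lambda>t x. 0)"
| "semigroup_upto (Suc k) f = step f (semigroup_upto k f)"

definition semigroup :: "('a \<Rightarrow> ennreal) \<Rightarrow> real \<Rightarrow> 'a \<Rightarrow> ennreal" where
  "semigroup f t x = (SUP k. semigroup_upto k f t x)"

lemma measurable_step [measurable (raw)]:
  assumes [measurable]: "\<And>y. (\<lambda>t. w t y) \<in> borel_measurable borel"
  shows "(\<lambda>t. step f w t x) \<in> borel_measurable borel"
  unfolding step_def by measurable

lemma measurable_semigroup_upto [measurable]: "(\<lambda>t. semigroup_upto k f t x) \<in> borel_measurable borel"
  by (induction k arbitrary: x) simp_all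

lemma measurable_semigroup [measurable]: "(\<lambda>t. semigroup f t x) \<in> borel_measurable borel"
  unfolding semigroup_def by measurable

lemma step_mono:
  assumes "\<And>x. f x \<le> f' x" "\<And>t y. w t y \<le> w' t y"
  shows "step f w t x \<le> step f' w' t x"
  unfolding step_def
  by (intro add_mono mult_left_mono mult_right_mono nn_integral_mono assms) simp_all

lemma semigroup_upto_mono: "(\<And>x. f x \<le> g x) \<Longrightarrow> semigroup_upto k f t x \<le> semigroup_upto k g t x"
  by (induction k arbitrary: t x) (auto intro: step_mono)

lemma semigroup_upto_Suc_le: "semigroup_upto k f t x \<le> semigroup_upto (Suc k) f t x"
proof (induction k arbitrary: t x)
  case (Suc k)
  then show ?case by (auto intro: step_mono simp del: semigroup_upto.simps simp: semigroup_upto.simps(2)[of k] semigroup_upto.simps(2)[of "Suc k"])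
qed simp

lemma incseq_semigroup_upto: "incseq (\<lambda>k. semigroup_upto k f t x)"
  using semigroup_upto_Suc_le by (rule incseq_SucI)

lemma semigroup_mono: "(\<And>x. f x \<le> g x) \<Longrightarrow> semigroup f t x \<le> semigroup g t x"
  unfolding semigroup_def by (rule SUP_mono') (rule semigroup_upto_mono)

lemma step_neg:
  assumes "\<And>t x. t < 0 \<Longrightarrow> w t x = 0" "t < 0"
  shows "step f w t x = 0"
proof -
  have z: "expd (r x) s * (\<integral>\<^sup>+y. w (t - s) y \<partial>measure_pmf (J x)) = 0" for s
    using assms by (cases "s < 0") (simp_all add: exponential_density_def)
  have "(\<integral>\<^sup>+s. expd (r x) s * (\<integral>\<^sup>+y. w (t - s) y \<partial>measure_pmf (J x)) \<partial>lborel) = (\<integral>\<^sup>+s. 0 \<partial>(lborel :: real measure))"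
    by (rule nn_integral_cong) (rule z)
  then show ?thesis using assms(2) by (simp add: step_def)
qed

lemma semigroup_upto_neg: "t < 0 \<Longrightarrow> semigroup_upto k f t x = 0"
  by (induction k arbitrary: t x) (simp_all add: step_neg)

lemma semigroup_neg: "t < 0 \<Longrightarrow> semigroup f t x = 0"
  unfolding semigroup_def by (simp add: semigroup_upto_neg)

lemma semigroup_step: "semigroup f t x = step f (semigroup f) t x"
proof -
  have inc: "incseq (\<lambda>k. \<integral>\<^sup>+y. semigroup_upto k f t y \<partial>measure_pmf p)" for t p
    by (intro incseq_SucI nn_integral_mono semigroup_upto_Suc_le)
  have "(SUP k. semigroup_upto k f t x) = (SUP k. semigroup_upto (Suc k) f t x)"
  proof (rule antisym)
    show "(SUP k. semigroup_upto k f t x) \<le> (SUP k. semigroup_upto (Suc k) f t x)"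
      by (rule SUP_mono) (use semigroup_upto_Suc_le in blast)
  qed (rule SUP_mono, blast)
  also have "\<dots> = indicator {0..} t * (f x * ennreal (exp (- r x * t))) +
     (SUP k. \<integral>\<^sup>+s. expd (r x) s * (\<integral>\<^sup>+y. semigroup_upto k f (t - s) y \<partial>measure_pmf (J x)) \<partial>lborel)"
    by (simp add: step_def ennreal_SUP_add_right)
  also have "(SUP k. \<integral>\<^sup>+s. expd (r x) s * (\<integral>\<^sup>+y. semigroup_upto k f (t - s) y \<partial>measure_pmf (J x)) \<partial>lborel) =
     (\<integral>\<^sup>+s. (SUP k. expd (r x) s * (\<integral>\<^sup>+y. semigroup_upto k f (t - s) y \<partial>measure_pmf (J x))) \<partial>lborel)"
  proof (rule nn_integral_monotone_convergence_SUP[symmetric])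
    show "incseq (\<lambda>k s. expd (r x) s * (\<integral>\<^sup>+y. semigroup_upto k f (t - s) y \<partial>measure_pmf (J x)))"
      using inc by (auto simp: incseq_def le_fun_def intro!: mult_left_mono)
  qed measurable
  also have "\<dots> = (\<integral>\<^sup>+s. expd (r x) s * (\<integral>\<^sup>+y. semigroup f (t - s) y \<partial>measure_pmf (J x)) \<partial>lborel)"
    unfolding semigroup_def
    by (subst nn_integral_monotone_convergence_SUP)
       (auto simp: SUP_mult_left_ennreal incseq_def le_fun_def intro!: incseq_semigroup_upto[THEN incseqD])
  finally show ?thesis unfolding step_def semigroup_def .
qed

text \<open>Minimality: the iteration starts from 0, which lies below every supersolution, and
  \<open>step\<close> is monotone.\<close>

lemma semigroup_upto_le_supersolution:
  assumes "\<And>t x. step f w t x \<le> w t x"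
  shows "semigroup_upto k f t x \<le> w t x"
proof (induction k arbitrary: t x)
  case (Suc k)
  have "step f (semigroup_upto k f) t x \<le> step f w t x" using Suc by (intro step_mono) simp_all
  also note assms
  finally show ?case by simp
qed simp

lemma semigroup_le_supersolution:
  assumes "\<And>t x. step f w t x \<le> w t x"
  shows "semigroup f t x \<le> w t x"
  unfolding semigroup_def by (rule SUP_least) (rule semigroup_upto_le_supersolution[OF assms])

lemma step_add:
  assumes [measurable]: "\<And>y. (\<lambda>t. w t y) \<in> borel_measurable borel" "\<And>y. (\<lambda>t. w' t y) \<in> borel_measurable borel"
  shows "step (\<lambda>x. f x + g x) (\<lambda>t x. w t x + w' t x) t x = step f w t x + step g w' t x"
  unfolding step_def
  by (simp add: nn_integral_add distrib_left distrib_right ac_simps)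

lemma semigroup_upto_add: "semigroup_upto k (\<lambda>x. f x + g x) = (\<lambda>t x. semigroup_upto k f t x + semigroup_upto k g t x)"
proof (induction k)
  case (Suc k)
  show ?case by (intro ext) (simp add: Suc step_add)
qed (simp add: fun_eq_iff)

lemma semigroup_add: "semigroup (\<lambda>x. f x + g x) t x = semigroup f t x + semigroup g t x"
  unfolding semigroup_def semigroup_upto_add by (rule ennreal_SUP_add) (rule incseq_semigroup_upto)+

lemma step_cmult:
  assumes [measurable]: "\<And>y. (\<lambda>t. w t y) \<in> borel_measurable borel"
  shows "step (\<lambda>x. c * f x) (\<lambda>t x. c * w t x) t x = c * step f w t x"
proof -
  have "(\<integral>\<^sup>+s. expd (r x) s * (\<integral>\<^sup>+y. c * w (t - s) y \<partial>measure_pmf (J x)) \<partial>lborel) =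
    (\<integral>\<^sup>+s. c * (expd (r x) s * (\<integral>\<^sup>+y. w (t - s) y \<partial>measure_pmf (J x))) \<partial>lborel)"
    by (simp add: nn_integral_cmult ac_simps)
  also have "\<dots> = c * (\<integral>\<^sup>+s. expd (r x) s * (\<integral>\<^sup>+y. w (t - s) y \<partial>measure_pmf (J x)) \<partial>lborel)"
    by (rule nn_integral_cmult) measurable
  finally show ?thesis unfolding step_def by (simp add: distrib_left ac_simps)
qed

lemma semigroup_upto_cmult: "semigroup_upto k (\<lambda>x. c * f x) = (\<lambda>t x. c * semigroup_upto k f t x)"
proof (induction k)
  case (Suc k)
  show ?case by (intro ext) (simp add: Suc step_cmult)
qed (simp add: fun_eq_iff)

lemma semigroup_cmult: "semigroup (\<lambda>x. c * f x) t x = c * semigroup f t x"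
  unfolding semigroup_def semigroup_upto_cmult by (simp add: SUP_mult_left_ennreal)

text \<open>For the trajectory up to \<open>t + h\<close> the first jump falls before or after
  \<open>t\<close>. Jumps before \<open>t\<close> give the integral in \<open>step\<close>; those
  after \<open>t\<close>, by lack of memory of the exponential law, are the first jumps of a chain
  started afresh in \<open>x\<close> at time \<open>t\<close>.\<close>

lemma semigroup_shift_supersolution:
  assumes h: "h \<ge> 0"
  shows "step (semigroup f h) (\<lambda>t x. indicator {0..} t * semigroup f (t + h) x) t x \<le> indicator {0..} t * semigroup f (t + h) x"
proof (cases "t \<ge> 0")
  case False
  then show ?thesis by (subst step_neg) auto
next
  case t: True
  define H where "H s = (\<integral>\<^sup>+y. semigroup f s y \<partial>measure_pmf (J x))" for s
  have [measurable]: "H \<in> borel_measurable borel" unfolding H_def by measurable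
  \<comment> \<open>Lack of memory: the factor \<open>exp (- r x * t)\<close> translates the density
    by \<open>t\<close> and leaves the jumps later than \<open>t\<close>.\<close>
  have "ennreal (exp (- r x * t)) * (\<integral>\<^sup>+s. expd (r x) s * H (h - s) \<partial>lborel) =
      (\<integral>\<^sup>+s. ennreal (exp (- r x * t)) * (expd (r x) s * H (h - s)) \<partial>lborel)"
    by (rule nn_integral_cmult[symmetric]) measurable
  also have "\<dots> = (\<integral>\<^sup>+s. indicator {t..} (s + t) * expd (r x) (s + t) * H (t + h - (s + t)) \<partial>lborel)"
  proof (rule nn_integral_cong)
    fix s :: real
    show "ennreal (exp (- r x * t)) * (expd (r x) s * H (h - s)) =
        indicator {t..} (s + t) * expd (r x) (s + t) * H (t + h - (s + t))"
    proof (cases "s < 0")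
      case False
      then have "ennreal (exp (- r x * t)) * expd (r x) s = expd (r x) (s + t)"
        using t r_pos[of x] by (simp add: exponential_density_def ennreal_mult[symmetric] exp_add[symmetric] algebra_simps)
      with False show ?thesis by (simp add: mult.assoc[symmetric])
    qed (simp add: exponential_density_def)
  qed
  also have "\<dots> = (\<integral>\<^sup>+s. indicator {t..} s * expd (r x) s * H (t + h - s) \<partial>lborel)"
    by (rule nn_integral_lborel_shift[where h="\<lambda>s. indicator {t..} s * expd (r x) s * H (t + h - s)"]) measurable
  finally have 1: "ennreal (exp (- r x * t)) * (\<integral>\<^sup>+s. expd (r x) s * H (h - s) \<partial>lborel) =
      (\<integral>\<^sup>+s. indicator {t..} s * expd (r x) s * H (t + h - s) \<partial>lborel)" .
  have 2: "semigroup f h x = f x * ennreal (exp (- r x * h)) + (\<integral>\<^sup>+s. expd (r x) s * H (h - s) \<partial>lborel)"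
    by (subst semigroup_step) (simp add: step_def H_def h)
  have 3: "f x * ennreal (exp (- r x * h)) * ennreal (exp (- r x * t)) = f x * ennreal (exp (- r x * (t + h)))"
    by (simp add: mult.assoc ennreal_mult[symmetric] exp_add[symmetric] algebra_simps)
  have "step (semigroup f h) (\<lambda>t x. indicator {0..} t * semigroup f (t + h) x) t x =
      f x * ennreal (exp (- r x * (t + h))) +
      ((\<integral>\<^sup>+s. indicator {t..} s * expd (r x) s * H (t + h - s) \<partial>lborel) +
       (\<integral>\<^sup>+s. expd (r x) s * (indicator {0..} (t - s) * H (t + h - s)) \<partial>lborel))"
  proof -
    have 4: "(\<integral>\<^sup>+y. indicator {0..} (t - s) * semigroup f (t - s + h) y \<partial>measure_pmf (J x)) =
        indicator {0..} (t - s) * H (t + h - s)" for s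
      by (simp add: nn_integral_cmult H_def algebra_simps)
    have 5: "semigroup f h x * ennreal (exp (- r x * t)) = f x * ennreal (exp (- r x * (t + h))) +
        (\<integral>\<^sup>+s. indicator {t..} s * expd (r x) s * H (t + h - s) \<partial>lborel)"
      unfolding 2 distrib_right 3 1[symmetric] by (simp only: mult.commute)
    show ?thesis unfolding step_def 4 5 using t by (simp add: add.assoc)
  qed
  also have "\<dots> = f x * ennreal (exp (- r x * (t + h))) +
      (\<integral>\<^sup>+s. indicator {t..} s * expd (r x) s * H (t + h - s) +
         expd (r x) s * (indicator {0..} (t - s) * H (t + h - s)) \<partial>lborel)"
    by (subst nn_integral_add) simp_all
  \<comment> \<open>The two pieces overlap only at \<open>s = t\<close>, a null set.\<close>
  also have "\<dots> = f x * ennreal (exp (- r x * (t + h))) + (\<integral>\<^sup>+s. expd (r x) s * H (t + h - s) \<partial>lborel)"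
  proof (rule arg_cong2[where f="(+)", OF refl nn_integral_cong_AE])
    show "AE s in lborel. indicator {t..} s * expd (r x) s * H (t + h - s) +
        expd (r x) s * (indicator {0..} (t - s) * H (t + h - s)) = expd (r x) s * H (t + h - s)"
      using AE_lborel_singleton[of t] by eventually_elim (auto simp: indicator_def)
  qed
  also have "\<dots> = semigroup f (t + h) x"
    by (subst semigroup_step) (use t h in \<open>simp add: step_def H_def\<close>)
  finally show ?thesis using t by simp
qed

lemma semigroup_compose_le: "h \<ge> 0 \<Longrightarrow> t \<ge> 0 \<Longrightarrow> semigroup (semigroup f h) t x \<le> semigroup f (t + h) x"
  using semigroup_le_supersolution[OF semigroup_shift_supersolution, of h f t x] by simp

end

text \<open>The semigroup property holds with \<open>\<le>\<close> because \<open>semigroup\<close> is a minimal solution; conservativity turns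
  this into an equality, by applying it to \<open>f\<close> and \<open>1 - f\<close>.\<close>

locale conservative_jump_process = jump_process +
  assumes conservative: "\<And>t x. t \<ge> 0 \<Longrightarrow> semigroup (\<lambda>_. 1) t x = 1"
begin

lemma semigroup_compl:
  assumes "\<And>x. f x \<le> 1" "t \<ge> 0"
  shows "semigroup f t x + semigroup (\<lambda>x. 1 - f x) t x = 1"
proof -
  have eq: "(\<lambda>x. f x + (1 - f x)) = (\<lambda>_. 1)"
    using assms(1) by (intro ext add_diff_inverse_ennreal)
  show ?thesis using semigroup_add[of f "\<lambda>x. 1 - f x" t x] conservative[OF assms(2), of x] unfolding eq by simp
qed

lemma semigroup_le_1: "(\<And>x. f x \<le> 1) \<Longrightarrow> semigroup f t x \<le> 1"
  using semigroup_compl[of f t x] semigroup_neg[of t f x] by (cases "t \<ge> 0") (metis le_iff_add, simp)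

lemma semigroup_compose:
  assumes f: "\<And>x. f x \<le> 1" and "h \<ge> 0" "t \<ge> 0"
  shows "semigroup (semigroup f h) t x = semigroup f (t + h) x"
proof (rule antisym)
  let ?g = "\<lambda>x. 1 - f x"
  show "semigroup (semigroup f h) t x \<le> semigroup f (t + h) x" using assms(2,3) by (rule semigroup_compose_le)
  have 1: "semigroup (semigroup f h) t x + semigroup (semigroup ?g h) t x = 1"
    using semigroup_add[of "semigroup f h" "semigroup ?g h" t x] semigroup_compl[OF f \<open>h \<ge> 0\<close>] conservative[OF \<open>t \<ge> 0\<close>] by simp
  have 2: "semigroup f (t + h) x + semigroup ?g (t + h) x = 1"
    using assms by (intro semigroup_compl) simp_all
  have 3: "semigroup (semigroup ?g h) t x \<le> semigroup ?g (t + h) x" using assms(2,3) by (rule semigroup_compose_le)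
  have "semigroup (semigroup ?g h) t x \<noteq> \<infinity>" using 1 by (auto simp: top_unique)
  moreover have "semigroup f (t + h) x + semigroup (semigroup ?g h) t x \<le> semigroup (semigroup f h) t x + semigroup (semigroup ?g h) t x"
    unfolding 1 using add_left_mono[OF 3, of "semigroup f (t + h) x"] unfolding 2 .
  ultimately show "semigroup f (t + h) x \<le> semigroup (semigroup f h) t x"
    by (simp add: ennreal_add_left_cancel_le add.commute)
qed

end

section \<open>Lyapunov inequality\<close>

lemma nn_integral_exp_Icc:
  fixes t :: real
  assumes "l > 0" "t \<ge> 0"
  shows "(\<integral>\<^sup>+s. ennreal (exp (- l * s)) * indicator {0..t} s \<partial>lborel) = ennreal ((1 - exp (- l * t)) / l)"
proof -
  have "(\<integral>\<^sup>+s. ennreal (exp (- l * s)) * indicator {0..t} s \<partial>lborel) =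
      ennreal (- exp (- l * t) / l - (- exp (- l * 0) / l))"
    using assms by (intro nn_integral_FTC_Icc) (auto intro!: derivative_eq_intros)
  also have "- exp (- l * t) / l - (- exp (- l * 0) / l) = (1 - exp (- l * t)) / l"
    using assms by (simp add: field_simps)
  finally show ?thesis .
qed

text \<open>Mean of the inductive Lyapunov bound over the first holding time \<open>s\<close>, with
  \<open>M\<close> the mean of \<open>V\<close> after the jump and \<open>t - s\<close> the
  remaining time. For \<open>M = 1\<close> and \<open>b = 0\<close> it is the distribution function
  of the exponential law.\<close>

lemma nn_integral_expd_linear:
  fixes M b t :: real
  assumes "l > 0" "t \<ge> 0" "M \<ge> 0" "b \<ge> 0"
  shows "(\<integral>\<^sup>+s. expd l s * ennreal (M + b * (t - s)) * indicator {..t} s \<partial>lborel) =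
    ennreal (M * (1 - exp (- l * t)) + b * t - b * (1 - exp (- l * t)) / l)"
proof -
  have "(\<integral>\<^sup>+s. expd l s * ennreal (M + b * (t - s)) * indicator {..t} s \<partial>lborel) =
      (\<integral>\<^sup>+s. ennreal (l * exp (- l * s) * (M + b * (t - s))) * indicator {0..t} s \<partial>lborel)"
  proof (rule nn_integral_cong)
    fix s :: real
    show "expd l s * ennreal (M + b * (t - s)) * indicator {..t} s =
        ennreal (l * exp (- l * s) * (M + b * (t - s))) * indicator {0..t} s"
    proof (cases "0 \<le> s \<and> s \<le> t")
      case True
      then have "0 \<le> M + b * (t - s)" using assms by (intro add_nonneg_nonneg mult_nonneg_nonneg) simp_all
      then show ?thesis
        using True assms(1) by (simp add: exponential_density_def ennreal_mult mult.commute[of s l])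
    qed (auto simp: exponential_density_def indicator_def)
  qed
  also have "\<dots> = ennreal ((- exp (- l * t) * (M + b * (t - t)) + b / l * exp (- l * t)) -
      (- exp (- l * 0) * (M + b * (t - 0)) + b / l * exp (- l * 0)))"
  proof (rule nn_integral_FTC_Icc)
    show "((\<lambda>s. - exp (- l * s) * (M + b * (t - s)) + b / l * exp (- l * s)) has_real_derivative
        l * exp (- l * s) * (M + b * (t - s))) (at s)" for s
      using assms by (auto intro!: derivative_eq_intros simp: field_simps)
  qed (use assms in \<open>auto intro!: mult_nonneg_nonneg add_nonneg_nonneg\<close>)
  also have "(- exp (- l * t) * (M + b * (t - t)) + b / l * exp (- l * t)) -
      (- exp (- l * 0) * (M + b * (t - 0)) + b / l * exp (- l * 0)) =
      M * (1 - exp (- l * t)) + b * t - b * (1 - exp (- l * t)) / l"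
    using assms by (simp add: field_simps)
  finally show ?thesis .
qed

text \<open>The gap between the two sides is \<open>(1 - exp (- r * t)) / r\<close>, the mean of the
  minimum of the holding time and \<open>t\<close>, times the slack in \<open>le\<close>.\<close>

lemma Lyapunov_arith:
  fixes t :: real
  assumes r: "r > 0" and t: "t \<ge> 0" and le: "r * M + c * V \<le> r * V + b"
  shows "V * exp (- r * t) + c * (V * ((1 - exp (- r * t)) / r)) +
     (M * (1 - exp (- r * t)) + b * t - b * (1 - exp (- r * t)) / r) \<le> V + b * t"
proof -
  define e where "e = (1 - exp (- r * t)) / r"
  have e0: "e \<ge> 0" unfolding e_def using r t by simp
  have ex: "exp (- r * t) = 1 - r * e" unfolding e_def using r by simp
  have "0 \<le> e * (r * V + b - r * M - c * V)" using le by (intro mult_nonneg_nonneg e0) simp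
  then show ?thesis unfolding e_def[symmetric] unfolding ex using r by (simp add: algebra_simps)
qed

context jump_process
begin

text \<open>The integral runs over \<open>[0, t]\<close>; the lower limit is supplied by the
  vanishing of \<open>semigroup_upto\<close> at negative times.\<close>

definition semigroup_upto_int :: "nat \<Rightarrow> ('a \<Rightarrow> ennreal) \<Rightarrow> real \<Rightarrow> 'a \<Rightarrow> ennreal" where
  "semigroup_upto_int k f t x = (\<integral>\<^sup>+s. indicator {..t} s * semigroup_upto k f s x \<partial>lborel)"

lemma semigroup_upto_int_eq_shift: "semigroup_upto_int k f (t - s) x = (\<integral>\<^sup>+v. indicator {..t} v * semigroup_upto k f (v - s) x \<partial>lborel)"
proof -
  have "semigroup_upto_int k f (t - s) x = (\<integral>\<^sup>+v. indicator {..t} (v + s) * semigroup_upto k f (v + s - s) x \<partial>lborel)"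
    unfolding semigroup_upto_int_def by (intro nn_integral_cong) (auto simp: indicator_def)
  also have "\<dots> = (\<integral>\<^sup>+v. indicator {..t} v * semigroup_upto k f (v - s) x \<partial>lborel)"
    by (rule nn_integral_lborel_shift[where h="\<lambda>v. indicator {..t} v * semigroup_upto k f (v - s) x"]) measurable
  finally show ?thesis .
qed

lemma measurable_semigroup_upto_int [measurable]: "(\<lambda>t. semigroup_upto_int k f t x) \<in> borel_measurable borel"
proof -
  have eq: "(\<lambda>t. semigroup_upto_int k f t x) = (\<lambda>t. \<integral>\<^sup>+s. (if s \<le> t then semigroup_upto k f s x else 0) \<partial>lborel)"
    unfolding semigroup_upto_int_def by (intro ext nn_integral_cong) simp
  show ?thesis unfolding eq by measurable
qed

lemma semigroup_upto_int_neg: "t < 0 \<Longrightarrow> semigroup_upto_int k f t x = 0"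
proof -
  assume "t < 0"
  then have z: "indicator {..t} s * semigroup_upto k f s x = 0" for s by (cases "s < 0") (auto simp: semigroup_upto_neg)
  have "semigroup_upto_int k f t x = (\<integral>\<^sup>+s. 0 \<partial>(lborel :: real measure))"
    unfolding semigroup_upto_int_def by (rule nn_integral_cong) (rule z)
  then show ?thesis by simp
qed

text \<open>Time-integrated renewal equation, obtained by exchanging the integrals over the elapsed
  time and over the first holding time. The coefficient of \<open>f x\<close> is the mean time spent
  in \<open>x\<close> before the first jump or \<open>t\<close>, whichever is earlier.\<close>

lemma semigroup_upto_int_Suc:
  assumes "t \<ge> 0"
  shows "semigroup_upto_int (Suc k) f t x = f x * ennreal ((1 - exp (- r x * t)) / r x) +
    (\<integral>\<^sup>+s. expd (r x) s * (\<integral>\<^sup>+y. semigroup_upto_int k f (t - s) y \<partial>measure_pmf (J x)) \<partial>lborel)"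
proof -
  have "semigroup_upto_int (Suc k) f t x = (\<integral>\<^sup>+v. f x * (ennreal (exp (- r x * v)) * indicator {0..t} v) +
     (\<integral>\<^sup>+s. indicator {..t} v * (expd (r x) s * (\<integral>\<^sup>+y. semigroup_upto k f (v - s) y \<partial>measure_pmf (J x))) \<partial>lborel) \<partial>lborel)"
    unfolding semigroup_upto_int_def
    by (intro nn_integral_cong) (auto simp: step_def indicator_def)
  also have "\<dots> = f x * ennreal ((1 - exp (- r x * t)) / r x) +
     (\<integral>\<^sup>+v. \<integral>\<^sup>+s. indicator {..t} v * (expd (r x) s * (\<integral>\<^sup>+y. semigroup_upto k f (v - s) y \<partial>measure_pmf (J x))) \<partial>lborel \<partial>lborel)"
  proof -
    have "(\<integral>\<^sup>+v. f x * (ennreal (exp (- r x * v)) * indicator {0..t} v) \<partial>lborel) =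
        f x * (\<integral>\<^sup>+v. ennreal (exp (- r x * v)) * indicator {0..t} v \<partial>lborel)"
      by (rule nn_integral_cmult) measurable
    then have A: "(\<integral>\<^sup>+v. f x * (ennreal (exp (- r x * v)) * indicator {0..t} v) \<partial>lborel) =
        f x * ennreal ((1 - exp (- r x * t)) / r x)"
      unfolding nn_integral_exp_Icc[OF r_pos assms] .
    show ?thesis unfolding A[symmetric] by (rule nn_integral_add) measurable
  qed
  also have "(\<integral>\<^sup>+v. \<integral>\<^sup>+s. indicator {..t} v * (expd (r x) s * (\<integral>\<^sup>+y. semigroup_upto k f (v - s) y \<partial>measure_pmf (J x))) \<partial>lborel \<partial>lborel) =
     (\<integral>\<^sup>+s. \<integral>\<^sup>+v. indicator {..t} v * (expd (r x) s * (\<integral>\<^sup>+y. semigroup_upto k f (v - s) y \<partial>measure_pmf (J x))) \<partial>lborel \<partial>lborel)"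
    by (rule lborel_pair.Fubini') measurable
  also have "\<dots> = (\<integral>\<^sup>+s. expd (r x) s * (\<integral>\<^sup>+y. semigroup_upto_int k f (t - s) y \<partial>measure_pmf (J x)) \<partial>lborel)"
  proof (rule nn_integral_cong)
    fix s
    have "(\<integral>\<^sup>+v. indicator {..t} v * (expd (r x) s * (\<integral>\<^sup>+y. semigroup_upto k f (v - s) y \<partial>measure_pmf (J x))) \<partial>lborel) =
      expd (r x) s * (\<integral>\<^sup>+v. \<integral>\<^sup>+y. indicator {..t} v * semigroup_upto k f (v - s) y \<partial>measure_pmf (J x) \<partial>lborel)"
      by (simp add: nn_integral_cmult[symmetric] ac_simps)
    also have "\<dots> = expd (r x) s * (\<integral>\<^sup>+y. semigroup_upto_int k f (t - s) y \<partial>measure_pmf (J x))"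
      unfolding semigroup_upto_int_eq_shift by (subst nn_integral_pmf_swap) simp_all
    finally show "(\<integral>\<^sup>+v. indicator {..t} v * (expd (r x) s * (\<integral>\<^sup>+y. semigroup_upto k f (v - s) y \<partial>measure_pmf (J x))) \<partial>lborel) =
      expd (r x) s * (\<integral>\<^sup>+y. semigroup_upto_int k f (t - s) y \<partial>measure_pmf (J x))" .
  qed
  finally show ?thesis .
qed

text \<open>\<open>gen\<close> is the drift condition \<open>L V \<le> - c V + b\<close> with the
  subtracted terms moved across, since subtraction in \<open>ennreal\<close> is truncated at 0. In
  the inductive step the bound \<open>V y + b * (t - s)\<close> after the first jump is averaged
  over \<open>y\<close> and \<open>s\<close>; counting jumps takes the place of localisation by
  stopping times.\<close>

lemma semigroup_upto_Lyapunov: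
  fixes V :: "'a \<Rightarrow> real"
  assumes V: "\<And>x. x \<in> E \<Longrightarrow> V x \<ge> 0" and b: "b \<ge> 0" and c: "c \<ge> 0"
    and J: "\<And>x. x \<in> E \<Longrightarrow> set_pmf (J x) \<subseteq> E"
    and gen: "\<And>x. x \<in> E \<Longrightarrow> ennreal (r x) * (\<integral>\<^sup>+y. ennreal (V y) \<partial>measure_pmf (J x)) + ennreal (c * V x)
        \<le> ennreal (r x * V x + b)"
    and x: "x \<in> E" and t: "t \<ge> 0"
  shows "semigroup_upto k (\<lambda>x. ennreal (V x)) t x + ennreal c * semigroup_upto_int k (\<lambda>x. ennreal (V x)) t x \<le> ennreal (V x + b * t)"
  using x t
proof (induction k arbitrary: x t)
  case 0
  then show ?case by (simp add: semigroup_upto_int_def)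
next
  case (Suc k)
  let ?V = "\<lambda>x. ennreal (V x)" and ?e = "exp (- r x * t)"
  define M where "M = enn2real (\<integral>\<^sup>+y. ?V y \<partial>measure_pmf (J x))"
  have Vx: "V x \<ge> 0" using V Suc.prems by simp
  have rx: "r x > 0" by (rule r_pos)
  \<comment> \<open>The mean of \<open>V\<close> after one jump is finite because \<open>gen\<close>
    bounds it by a real number.\<close>
  have "ennreal (r x) * (\<integral>\<^sup>+y. ?V y \<partial>measure_pmf (J x)) < \<infinity>"
    using gen[OF Suc.prems(1)] by (metis add_lessD1 ennreal_less_top infinity_ennreal_def le_iff_add order_le_less_trans)
  then have Mfin: "(\<integral>\<^sup>+y. ?V y \<partial>measure_pmf (J x)) < top" using rx by (auto simp: ennreal_mult_less_top)
  then have M: "(\<integral>\<^sup>+y. ?V y \<partial>measure_pmf (J x)) = ennreal M" and M0: "M \<ge> 0"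
    unfolding M_def by auto
  have "ennreal (r x * M + c * V x) \<le> ennreal (r x * V x + b)"
    using gen[OF Suc.prems(1)] rx M0 Vx c unfolding M by (simp add: ennreal_mult[symmetric] ennreal_plus[symmetric] del: ennreal_plus)
  then have genM: "r x * M + c * V x \<le> r x * V x + b"
    using rx Vx b by (subst (asm) ennreal_le_iff) (auto intro!: add_nonneg_nonneg)
  have H: "(\<integral>\<^sup>+y. semigroup_upto k ?V (t - s) y + ennreal c * semigroup_upto_int k ?V (t - s) y \<partial>measure_pmf (J x))
      \<le> ennreal (M + b * (t - s)) * indicator {..t} s" for s
  proof (cases "s \<le> t")
    case True
    have "(\<integral>\<^sup>+y. semigroup_upto k ?V (t - s) y + ennreal c * semigroup_upto_int k ?V (t - s) y \<partial>measure_pmf (J x))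
        \<le> (\<integral>\<^sup>+y. ?V y + ennreal (b * (t - s)) \<partial>measure_pmf (J x))"
    proof (rule nn_integral_mono_AE, rule AE_pmfI)
      fix y assume "y \<in> set_pmf (J x)"
      then have y: "y \<in> E" using J Suc.prems(1) by blast
      show "semigroup_upto k ?V (t - s) y + ennreal c * semigroup_upto_int k ?V (t - s) y \<le> ?V y + ennreal (b * (t - s))"
        using Suc.IH[OF y, of "t - s"] True V[OF y] b by (simp add: ennreal_plus[symmetric] del: ennreal_plus)
    qed
    also have "\<dots> = ennreal (M + b * (t - s))"
      using True M M0 b by (simp add: nn_integral_add)
    finally show ?thesis using True by simp
  next
    case False
    then show ?thesis by (simp add: semigroup_upto_neg semigroup_upto_int_neg)
  qed
  have "semigroup_upto (Suc k) ?V t x + ennreal c * semigroup_upto_int (Suc k) ?V t x =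
     ?V x * ennreal ?e + ennreal c * (?V x * ennreal ((1 - ?e) / r x)) +
     ((\<integral>\<^sup>+s. expd (r x) s * (\<integral>\<^sup>+y. semigroup_upto k ?V (t - s) y \<partial>measure_pmf (J x)) \<partial>lborel) +
      ennreal c * (\<integral>\<^sup>+s. expd (r x) s * (\<integral>\<^sup>+y. semigroup_upto_int k ?V (t - s) y \<partial>measure_pmf (J x)) \<partial>lborel))"
    using Suc.prems(2) by (simp add: semigroup_upto_int_Suc step_def distrib_left ac_simps)
  also have "ennreal c * (\<integral>\<^sup>+s. expd (r x) s * (\<integral>\<^sup>+y. semigroup_upto_int k ?V (t - s) y \<partial>measure_pmf (J x)) \<partial>lborel) =
     (\<integral>\<^sup>+s. ennreal c * (expd (r x) s * (\<integral>\<^sup>+y. semigroup_upto_int k ?V (t - s) y \<partial>measure_pmf (J x))) \<partial>lborel)"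
    by (rule nn_integral_cmult[symmetric]) measurable
  also have "(\<integral>\<^sup>+s. expd (r x) s * (\<integral>\<^sup>+y. semigroup_upto k ?V (t - s) y \<partial>measure_pmf (J x)) \<partial>lborel) + \<dots> =
     (\<integral>\<^sup>+s. expd (r x) s * (\<integral>\<^sup>+y. semigroup_upto k ?V (t - s) y \<partial>measure_pmf (J x)) +
        ennreal c * (expd (r x) s * (\<integral>\<^sup>+y. semigroup_upto_int k ?V (t - s) y \<partial>measure_pmf (J x))) \<partial>lborel)"
    by (rule nn_integral_add[symmetric]) measurable
  also have "\<dots> = (\<integral>\<^sup>+s. expd (r x) s *
       (\<integral>\<^sup>+y. semigroup_upto k ?V (t - s) y + ennreal c * semigroup_upto_int k ?V (t - s) y \<partial>measure_pmf (J x)) \<partial>lborel)"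
    by (intro nn_integral_cong) (simp add: nn_integral_add nn_integral_cmult distrib_left ac_simps)
  also have "\<dots> \<le> (\<integral>\<^sup>+s. expd (r x) s * ennreal (M + b * (t - s)) * indicator {..t} s \<partial>lborel)"
    unfolding mult.assoc by (intro nn_integral_mono mult_left_mono H) simp
  also have "\<dots> = ennreal (M * (1 - ?e) + b * t - b * (1 - ?e) / r x)"
    using rx Suc.prems(2) M0 b by (rule nn_integral_expd_linear)
  finally have "semigroup_upto (Suc k) ?V t x + ennreal c * semigroup_upto_int (Suc k) ?V t x \<le>
     ?V x * ennreal ?e + ennreal c * (?V x * ennreal ((1 - ?e) / r x)) +
     ennreal (M * (1 - ?e) + b * t - b * (1 - ?e) / r x)"
    by (simp add: add_left_mono)
  also have "\<dots> = ennreal (V x * ?e + c * (V x * ((1 - ?e) / r x)) + (M * (1 - ?e) + b * t - b * (1 - ?e) / r x))"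
  proof -
    have e1: "?e \<le> 1" using rx Suc.prems(2) by simp
    \<comment> \<open>\<open>ennreal\<close> is additive on nonnegative reals; this estimate makes
      the last summand nonnegative.\<close>
    have "(1 - ?e) / r x \<le> t"
    proof -
      have "1 + - r x * t \<le> ?e" by (rule exp_ge_add_one_self)
      then show ?thesis using rx by (simp add: field_simps)
    qed
    from mult_left_mono[OF this b] have "M * (1 - ?e) + b * t - b * (1 - ?e) / r x \<ge> 0"
      using mult_nonneg_nonneg[OF M0, of "1 - ?e"] e1 by simp
    then show ?thesis using e1 Vx c rx
      by (simp add: ennreal_mult[symmetric] ennreal_plus[symmetric] del: ennreal_plus)
  qed
  also have "\<dots> \<le> ennreal (V x + b * t)"
    by (intro ennreal_leI Lyapunov_arith rx Suc.prems(2) genM)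
  finally show ?case .
qed

lemma semigroup_Lyapunov:
  fixes V :: "'a \<Rightarrow> real"
  assumes V: "\<And>x. x \<in> E \<Longrightarrow> V x \<ge> 0" and b: "b \<ge> 0" and c: "c \<ge> 0"
    and J: "\<And>x. x \<in> E \<Longrightarrow> set_pmf (J x) \<subseteq> E"
    and gen: "\<And>x. x \<in> E \<Longrightarrow> ennreal (r x) * (\<integral>\<^sup>+y. ennreal (V y) \<partial>measure_pmf (J x)) + ennreal (c * V x)
        \<le> ennreal (r x * V x + b)"
    and x: "x \<in> E" and t: "t \<ge> 0"
  shows "semigroup (\<lambda>x. ennreal (V x)) t x + ennreal c * (\<integral>\<^sup>+s. indicator {..t} s * semigroup (\<lambda>x. ennreal (V x)) s x \<partial>lborel)
    \<le> ennreal (V x + b * t)"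
proof -
  let ?V = "\<lambda>x. ennreal (V x)"
  have "(\<integral>\<^sup>+s. indicator {..t} s * semigroup ?V s x \<partial>lborel) = (SUP k. semigroup_upto_int k ?V t x)"
    unfolding semigroup_upto_int_def semigroup_def SUP_mult_left_ennreal
    by (rule nn_integral_monotone_convergence_SUP)
       (auto simp: incseq_def le_fun_def intro!: mult_left_mono incseq_semigroup_upto[THEN incseqD])
  moreover have "incseq (\<lambda>k. semigroup_upto_int k ?V t x)"
    unfolding semigroup_upto_int_def by (intro incseq_SucI nn_integral_mono mult_left_mono semigroup_upto_Suc_le) simp
  then have "incseq (\<lambda>k. ennreal c * semigroup_upto_int k ?V t x)"
    by (auto simp: incseq_def intro!: mult_left_mono)
  ultimately have "semigroup ?V t x + ennreal c * (\<integral>\<^sup>+s. indicator {..t} s * semigroup ?V s x \<partial>lborel) =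
      (SUP k. semigroup_upto k ?V t x + ennreal c * semigroup_upto_int k ?V t x)"
    by (simp add: semigroup_def SUP_mult_left_ennreal ennreal_SUP_add[OF incseq_semigroup_upto])
  also have "\<dots> \<le> ennreal (V x + b * t)"
    using semigroup_upto_Lyapunov[OF assms] by (intro SUP_least) simp
  finally show ?thesis .
qed

section \<open>Positivity of the semigroup\<close>

lemma semigroup_pos:
  assumes "t \<ge> 0" "f x > 0"
  shows "semigroup f t x > 0"
proof -
  have "0 < f x * ennreal (exp (- r x * t))"
    using assms(2) by (simp add: ennreal_zero_less_mult_iff)
  also have "\<dots> \<le> semigroup f t x"
    by (subst semigroup_step) (simp add: step_def assms(1))
  finally show ?thesis .
qed

text \<open>Only trajectories with a single jump up to time \<open>t\<close>, to the state
  \<open>y\<close>, are kept. The probability of staying in \<open>y\<close> for the remaining time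
  is at least \<open>exp (- r y * t)\<close>, uniformly in the time of the jump.\<close>

lemma semigroup_pos_jump:
  assumes t: "t > 0" and y: "y \<in> set_pmf (J x)" and f: "f y > 0"
  shows "semigroup f t x > 0"
proof -
  have p: "0 < pmf (J x) y" using y by (rule pmf_positive)
  have "0 < ennreal (1 - exp (- r x * t)) * (ennreal (exp (- r y * t)) * (ennreal (pmf (J x) y) * f y))"
    using p f t r_pos[of x] by (auto simp: ennreal_zero_less_mult_iff)
  also have "ennreal (1 - exp (- r x * t)) = (\<integral>\<^sup>+s. expd (r x) s * indicator {..t} s \<partial>lborel)"
    using nn_integral_expd_linear[of "r x" t 1 0] r_pos[of x] t by simp
  also have "\<dots> * (ennreal (exp (- r y * t)) * (ennreal (pmf (J x) y) * f y)) =
      (\<integral>\<^sup>+s. expd (r x) s * indicator {..t} s * (ennreal (exp (- r y * t)) * (ennreal (pmf (J x) y) * f y)) \<partial>lborel)"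
    by (rule nn_integral_multc[symmetric]) measurable
  also have "\<dots> \<le> (\<integral>\<^sup>+s. expd (r x) s * (\<integral>\<^sup>+y. semigroup f (t - s) y \<partial>measure_pmf (J x)) \<partial>lborel)"
    unfolding mult.assoc
  proof (rule nn_integral_mono)
    fix s :: real
    show "expd (r x) s * (indicator {..t} s * (ennreal (exp (- r y * t)) * (ennreal (pmf (J x) y) * f y)))
        \<le> expd (r x) s * (\<integral>\<^sup>+y. semigroup f (t - s) y \<partial>measure_pmf (J x))"
    proof (cases "0 \<le> s \<and> s \<le> t")
      case True
      have "exp (- r y * t) \<le> exp (- r y * (t - s))"
        using True r_pos[of y] by simp
      then have "f y * ennreal (exp (- r y * t)) \<le> f y * ennreal (exp (- r y * (t - s)))"
        by (intro mult_left_mono ennreal_leI) simp_all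
      also have "\<dots> \<le> semigroup f (t - s) y"
        by (subst semigroup_step) (use True in \<open>simp add: step_def\<close>)
      finally have "ennreal (pmf (J x) y) * (f y * ennreal (exp (- r y * t))) \<le> ennreal (pmf (J x) y) * semigroup f (t - s) y"
        by (rule mult_left_mono) simp
      also have "\<dots> = (\<integral>\<^sup>+z. semigroup f (t - s) z * indicator {y} z \<partial>measure_pmf (J x))"
        by (subst nn_integral_indicator_singleton) (simp_all add: emeasure_pmf_single mult.commute)
      also have "\<dots> \<le> (\<integral>\<^sup>+z. semigroup f (t - s) z \<partial>measure_pmf (J x))"
        by (intro nn_integral_mono) (simp add: indicator_def)
      finally show ?thesis using True by (intro mult_left_mono) (simp_all add: ac_simps)
    next
      case False
      then show ?thesis by (cases "s < 0") (simp_all add: exponential_density_def)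
    qed
  qed
  also have "\<dots> \<le> semigroup f t x"
    by (subst (2) semigroup_step) (simp add: step_def)
  finally show ?thesis .
qed

end

section \<open>Resolvents and the invariant distribution\<close>

context jump_process
begin

text \<open>Laplace transform at \<open>l\<close> of the exponential holding time in
  \<open>x\<close>: the mean discount factor at the next jump.\<close>

definition jump_discount :: "real \<Rightarrow> 'a \<Rightarrow> ennreal" where
  "jump_discount l x = ennreal (r x / (l + r x))"

text \<open>One-step equation for the expected discounted integral of \<open>f\<close> along the
  chain, killed on hitting \<open>B\<close>. The factor \<open>1 / (l + r x)\<close> is the mean
  discounted holding time. For \<open>l = 0\<close> this counts plain sojourn times; for
  \<open>B = {}\<close> and \<open>l > 0\<close> it leads to the Laplace transform of the
  semigroup.\<close>

definition resolvent_step :: "'a set \<Rightarrow> real \<Rightarrow> ('a \<Rightarrow> ennreal) \<Rightarrow> ('a \<Rightarrow> ennreal) \<Rightarrow> 'a \<Rightarrow> ennreal" where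
  "resolvent_step B l f w x = indicator (- B) x *
     (f x * ennreal (1 / (l + r x)) + jump_discount l x * (\<integral>\<^sup>+y. w y \<partial>measure_pmf (J x)))"

primrec resolvent_upto :: "'a set \<Rightarrow> real \<Rightarrow> nat \<Rightarrow> ('a \<Rightarrow> ennreal) \<Rightarrow> 'a \<Rightarrow> ennreal" where
  "resolvent_upto B l 0 f = (\<lambda>x. 0)"
| "resolvent_upto B l (Suc k) f = resolvent_step B l f (resolvent_upto B l k f)"

definition resolvent :: "'a set \<Rightarrow> real \<Rightarrow> ('a \<Rightarrow> ennreal) \<Rightarrow> 'a \<Rightarrow> ennreal" where
  "resolvent B l f x = (SUP k. resolvent_upto B l k f x)"

lemma resolvent_step_mono:
  assumes "\<And>x. f x \<le> f' x" "\<And>y. w y \<le> w' y" "0 \<le> l'" "l' \<le> l"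
  shows "resolvent_step B l f w x \<le> resolvent_step B l' f' w' x"
proof -
  have "1 / (l + r x) \<le> 1 / (l' + r x)" "r x / (l + r x) \<le> r x / (l' + r x)"
    using assms r_pos[of x] by (auto intro!: divide_left_mono mult_pos_pos add_nonneg_pos)
  then show ?thesis unfolding resolvent_step_def jump_discount_def
    by (intro mult_left_mono add_mono mult_mono nn_integral_mono assms ennreal_leI) simp_all
qed

lemma resolvent_upto_mono:
  assumes "\<And>x. f x \<le> f' x" "0 \<le> l'" "l' \<le> l"
  shows "resolvent_upto B l k f x \<le> resolvent_upto B l' k f' x"
  by (induction k arbitrary: x) (auto intro!: resolvent_step_mono assms)

lemma resolvent_upto_Suc_le:
  assumes "0 \<le> l"
  shows "resolvent_upto B l k f x \<le> resolvent_upto B l (Suc k) f x"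
proof (induction k arbitrary: x)
  case (Suc k)
  then show ?case
    unfolding resolvent_upto.simps(2)[of B l k] resolvent_upto.simps(2)[of B l "Suc k"] by (intro resolvent_step_mono assms order_refl)
qed simp

lemma incseq_resolvent_upto: "0 \<le> l \<Longrightarrow> incseq (\<lambda>k. resolvent_upto B l k f x)"
  using resolvent_upto_Suc_le by (rule incseq_SucI)

lemma resolvent_mono:
  assumes "\<And>x. f x \<le> f' x" "0 \<le> l'" "l' \<le> l"
  shows "resolvent B l f x \<le> resolvent B l' f' x"
  unfolding resolvent_def by (rule SUP_mono') (rule resolvent_upto_mono[OF assms])

lemma resolvent_fixpoint:
  assumes "0 \<le> l"
  shows "resolvent B l f x = resolvent_step B l f (resolvent B l f) x"
proof -
  have inc: "incseq (\<lambda>k. \<integral>\<^sup>+y. resolvent_upto B l k f y \<partial>measure_pmf p)" for p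
    by (intro incseq_SucI nn_integral_mono resolvent_upto_Suc_le assms)
  have "(SUP k. resolvent_upto B l k f x) = (SUP k. resolvent_upto B l (Suc k) f x)"
  proof (rule antisym)
    show "(SUP k. resolvent_upto B l k f x) \<le> (SUP k. resolvent_upto B l (Suc k) f x)"
      by (rule SUP_mono) (use resolvent_upto_Suc_le[OF assms] in blast)
  qed (rule SUP_mono, blast)
  also have "\<dots> = indicator (- B) x * (f x * ennreal (1 / (l + r x)) + jump_discount l x * (SUP k. \<integral>\<^sup>+y. resolvent_upto B l k f y \<partial>measure_pmf (J x)))"
    by (simp add: resolvent_step_def SUP_mult_left_ennreal ennreal_SUP_add_right)
  also have "(SUP k. \<integral>\<^sup>+y. resolvent_upto B l k f y \<partial>measure_pmf (J x)) = (\<integral>\<^sup>+y. resolvent B l f y \<partial>measure_pmf (J x))"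
    unfolding resolvent_def
    by (rule nn_integral_monotone_convergence_SUP[symmetric])
       (auto simp: incseq_def le_fun_def intro!: incseq_resolvent_upto[OF assms, THEN incseqD])
  finally show ?thesis unfolding resolvent_step_def resolvent_def .
qed

section \<open>Laplace transform of the renewal equation\<close>

lemma laplace_expd:
  assumes "l > 0"
  shows "ennreal (exp (- l * s)) * expd (r x) s = jump_discount l x * expd (l + r x) s"
proof (cases "s < 0")
  case False
  have "exp (- s * (l + r x)) = exp (- l * s) * exp (- s * r x)"
    by (simp add: exp_add[symmetric] algebra_simps)
  then have "exp (- l * s) * (r x * exp (- s * r x)) = r x / (l + r x) * ((l + r x) * exp (- s * (l + r x)))"
    using assms r_pos[of x] by simp
  then show ?thesis
    using False assms r_pos[of x] by (simp add: exponential_density_def jump_discount_def ennreal_mult[symmetric])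
qed (simp add: exponential_density_def)

text \<open>The renewal equation is a convolution in time, which the Laplace transform turns into a
  product: \<open>step\<close> becomes \<open>resolvent_step\<close> without killing.\<close>

lemma laplace_step:
  assumes l: "l > 0" and w [measurable]: "\<And>y. (\<lambda>t. w t y) \<in> borel_measurable borel"
  shows "(\<integral>\<^sup>+t. ennreal (exp (- l * t)) * step f w t x \<partial>lborel) =
    resolvent_step {} l f (\<lambda>y. \<integral>\<^sup>+t. ennreal (exp (- l * t)) * w t y \<partial>lborel) x"
proof -
  have lr: "l + r x > 0" using l r_pos[of x] by simp
  define h where "h t = (\<integral>\<^sup>+y. w t y \<partial>measure_pmf (J x))" for t
  have [measurable]: "h \<in> borel_measurable borel" unfolding h_def by measurable
  have 1: "(\<integral>\<^sup>+t. ennreal (exp (- l * t)) * (indicator {0..} t * (f x * ennreal (exp (- r x * t)))) \<partial>lborel) =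
      f x * ennreal (1 / (l + r x))"
  proof -
    have "ennreal (exp (- l * t)) * (indicator {0..} t * (f x * ennreal (exp (- r x * t)))) =
       f x * ennreal (1 / (l + r x)) * expd (l + r x) t" for t
    proof (cases "t < 0")
      case False
      have "exp (- l * t) * exp (- r x * t) = exp (- t * (l + r x))"
        by (simp add: exp_add[symmetric] algebra_simps)
      then have "exp (- l * t) * exp (- r x * t) = 1 / (l + r x) * ((l + r x) * exp (- t * (l + r x)))"
        using lr by simp
      then have "ennreal (exp (- l * t)) * ennreal (exp (- r x * t)) = ennreal (1 / (l + r x)) * expd (l + r x) t"
        using False lr by (simp add: exponential_density_def ennreal_mult[symmetric])
      with False show ?thesis by (simp add: mult.left_commute mult.assoc)
    qed (simp add: exponential_density_def)
    then have "(\<integral>\<^sup>+t. ennreal (exp (- l * t)) * (indicator {0..} t * (f x * ennreal (exp (- r x * t)))) \<partial>lborel) =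
      (\<integral>\<^sup>+t. f x * ennreal (1 / (l + r x)) * expd (l + r x) t \<partial>lborel)" by presburger
    also have "\<dots> = f x * ennreal (1 / (l + r x)) * (\<integral>\<^sup>+t. expd (l + r x) t \<partial>lborel)"
      by (rule nn_integral_cmult) measurable
    finally show ?thesis by (simp add: nn_integral_expd[OF lr])
  qed
  have 2: "(\<integral>\<^sup>+t. ennreal (exp (- l * t)) * (\<integral>\<^sup>+s. expd (r x) s * h (t - s) \<partial>lborel) \<partial>lborel) =
      jump_discount l x * (\<integral>\<^sup>+t. ennreal (exp (- l * t)) * h t \<partial>lborel)"
  proof -
    let ?I = "\<integral>\<^sup>+t. ennreal (exp (- l * t)) * h t \<partial>lborel"
    have "(\<integral>\<^sup>+t. ennreal (exp (- l * t)) * (\<integral>\<^sup>+s. expd (r x) s * h (t - s) \<partial>lborel) \<partial>lborel) =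
       (\<integral>\<^sup>+t. \<integral>\<^sup>+s. ennreal (exp (- l * t)) * (expd (r x) s * h (t - s)) \<partial>lborel \<partial>lborel)"
      by (intro nn_integral_cong nn_integral_cmult[symmetric]) measurable
    also have "\<dots> = (\<integral>\<^sup>+s. \<integral>\<^sup>+t. ennreal (exp (- l * t)) * (expd (r x) s * h (t - s)) \<partial>lborel \<partial>lborel)"
      by (rule lborel_pair.Fubini') measurable
    also have "\<dots> = (\<integral>\<^sup>+s. jump_discount l x * ?I * expd (l + r x) s \<partial>lborel)"
    proof (rule nn_integral_cong)
      fix s
      \<comment> \<open>The discount over \<open>t\<close> splits at the jump time \<open>s\<close>:
        the part up to \<open>s\<close> tilts the exponential density, the rest belongs to the
        restarted chain.\<close>
      have e: "ennreal (exp (- l * t)) * (expd (r x) s * h (t - s)) =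
          jump_discount l x * expd (l + r x) s * (ennreal (exp (- l * (t + - s))) * h (t + - s))" for t
      proof -
        have "ennreal (exp (- l * t)) = ennreal (exp (- l * (t + - s))) * ennreal (exp (- l * s))"
          by (simp add: ennreal_mult[symmetric] exp_add[symmetric] algebra_simps)
        then have "ennreal (exp (- l * t)) * (expd (r x) s * h (t - s)) =
            (ennreal (exp (- l * s)) * expd (r x) s) * (ennreal (exp (- l * (t + - s))) * h (t + - s))"
          by (simp only: ac_simps diff_conv_add_uminus)
        then show ?thesis unfolding laplace_expd[OF l] .
      qed
      have "(\<integral>\<^sup>+t. ennreal (exp (- l * t)) * (expd (r x) s * h (t - s)) \<partial>lborel) =
          jump_discount l x * expd (l + r x) s * (\<integral>\<^sup>+t. ennreal (exp (- l * (t + - s))) * h (t + - s) \<partial>lborel)"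
        unfolding e by (rule nn_integral_cmult) measurable
      also have "(\<integral>\<^sup>+t. ennreal (exp (- l * (t + - s))) * h (t + - s) \<partial>lborel) = ?I"
        by (rule nn_integral_lborel_shift[where h="\<lambda>t. ennreal (exp (- l * t)) * h t"]) measurable
      finally show "(\<integral>\<^sup>+t. ennreal (exp (- l * t)) * (expd (r x) s * h (t - s)) \<partial>lborel) =
          jump_discount l x * ?I * expd (l + r x) s" by (simp add: ac_simps)
    qed
    also have "\<dots> = jump_discount l x * ?I * (\<integral>\<^sup>+s. expd (l + r x) s \<partial>lborel)"
      by (rule nn_integral_cmult) measurable
    finally show ?thesis by (simp add: nn_integral_expd[OF lr])
  qed
  have 3: "(\<integral>\<^sup>+t. ennreal (exp (- l * t)) * h t \<partial>lborel) =
     (\<integral>\<^sup>+y. \<integral>\<^sup>+t. ennreal (exp (- l * t)) * w t y \<partial>lborel \<partial>measure_pmf (J x))"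
    unfolding h_def by (subst nn_integral_pmf_swap[symmetric]) (simp_all add: nn_integral_cmult)
  have "(\<integral>\<^sup>+t. ennreal (exp (- l * t)) * step f w t x \<partial>lborel) =
      (\<integral>\<^sup>+t. ennreal (exp (- l * t)) * (indicator {0..} t * (f x * ennreal (exp (- r x * t)))) +
         ennreal (exp (- l * t)) * (\<integral>\<^sup>+s. expd (r x) s * h (t - s) \<partial>lborel) \<partial>lborel)"
    unfolding step_def h_def by (simp only: distrib_left)
  also have "\<dots> = f x * ennreal (1 / (l + r x)) + jump_discount l x * (\<integral>\<^sup>+t. ennreal (exp (- l * t)) * h t \<partial>lborel)"
    unfolding 1[symmetric] 2[symmetric] by (rule nn_integral_add) measurable
  finally show ?thesis unfolding resolvent_step_def 3 by simp
qed

lemma laplace_semigroup_upto: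
  assumes l: "l > 0"
  shows "(\<integral>\<^sup>+t. ennreal (exp (- l * t)) * semigroup_upto k f t x \<partial>lborel) = resolvent_upto {} l k f x"
proof (induction k arbitrary: x)
  case (Suc k)
  have "(\<integral>\<^sup>+t. ennreal (exp (- l * t)) * semigroup_upto (Suc k) f t x \<partial>lborel) =
    resolvent_step {} l f (\<lambda>y. \<integral>\<^sup>+t. ennreal (exp (- l * t)) * semigroup_upto k f t y \<partial>lborel) x"
    unfolding semigroup_upto.simps(2) by (rule laplace_step[OF l]) measurable
  then show ?case unfolding Suc resolvent_upto.simps(2) .
qed simp

lemma laplace_semigroup:
  assumes l: "l > 0"
  shows "(\<integral>\<^sup>+t. ennreal (exp (- l * t)) * semigroup f t x \<partial>lborel) = resolvent {} l f x"
proof -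
  have "(\<integral>\<^sup>+t. ennreal (exp (- l * t)) * semigroup f t x \<partial>lborel) =
     (SUP k. \<integral>\<^sup>+t. ennreal (exp (- l * t)) * semigroup_upto k f t x \<partial>lborel)"
    unfolding semigroup_def SUP_mult_left_ennreal
    by (rule nn_integral_monotone_convergence_SUP)
       (auto simp: incseq_def le_fun_def intro!: mult_left_mono incseq_semigroup_upto[THEN incseqD])
  then show ?thesis unfolding laplace_semigroup_upto[OF l] resolvent_def .
qed

text \<open>The expectation of the sum of \<open>f\<close>, discounted at rate \<open>l\<close>, over the time up to the first return
  to \<open>x0\<close>, for a start in \<open>x0\<close>.\<close>

definition cycle_sum :: "'a \<Rightarrow> real \<Rightarrow> ('a \<Rightarrow> ennreal) \<Rightarrow> ennreal" where
  "cycle_sum x0 l f = resolvent_step {} l f (resolvent {x0} l f) x0"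

lemma resolvent_step_LIMSEQ:
  fixes l :: "nat \<Rightarrow> real"
  assumes l: "l \<longlonglongrightarrow> 0" and inc: "incseq w" and w: "\<And>y. (\<lambda>n. w n y) \<longlonglongrightarrow> w' y"
  shows "(\<lambda>n. resolvent_step B (l n) f (w n) x) \<longlonglongrightarrow> resolvent_step B 0 f w' x"
proof -
  have r: "r x \<noteq> 0" "0 < r x" using r_pos[of x] by auto
  have "(\<lambda>n. ennreal (1 / (l n + r x))) \<longlonglongrightarrow> ennreal (1 / (0 + r x))"
       "(\<lambda>n. jump_discount (l n) x) \<longlonglongrightarrow> jump_discount 0 x"
    unfolding jump_discount_def using r by (auto intro!: tendsto_intros l simp del: add_0)
  moreover have "(\<lambda>n. \<integral>\<^sup>+y. w n y \<partial>measure_pmf (J x)) \<longlonglongrightarrow> (\<integral>\<^sup>+y. w' y \<partial>measure_pmf (J x))"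
    by (rule nn_integral_LIMSEQ[OF inc]) (simp_all add: w)
  ultimately have "(\<lambda>n. f x * ennreal (1 / (l n + r x)) + jump_discount (l n) x * (\<integral>\<^sup>+y. w n y \<partial>measure_pmf (J x)))
     \<longlonglongrightarrow> f x * ennreal (1 / (0 + r x)) + jump_discount 0 x * (\<integral>\<^sup>+y. w' y \<partial>measure_pmf (J x))"
    using r by (intro tendsto_add tendsto_mult_ennreal tendsto_const) (auto simp: jump_discount_def)
  then show ?thesis unfolding resolvent_step_def by (cases "x \<in> B") simp_all
qed

lemma incseq_resolvent_upto_discount:
  assumes "\<And>n. 0 \<le> l n" "decseq l"
  shows "incseq (\<lambda>n. resolvent_upto B (l n) k f)"
  using assms by (auto simp: incseq_def le_fun_def intro!: resolvent_upto_mono decseqD[OF assms(2)])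

text \<open>Lowering the discount increases every iterate, so the limit in \<open>n\<close> is a
  supremum, which commutes with the supremum over \<open>k\<close>. For fixed \<open>k\<close> the
  limit is computed step by step.\<close>

lemma resolvent_LIMSEQ:
  assumes l: "l \<longlonglongrightarrow> 0" "\<And>n. 0 \<le> l n" "decseq l"
  shows "(\<lambda>n. resolvent B (l n) f x) \<longlonglongrightarrow> resolvent B 0 f x"
proof -
  have lim: "(\<lambda>n. resolvent_upto B (l n) k f x) \<longlonglongrightarrow> resolvent_upto B 0 k f x" for k x
    by (induction k arbitrary: x) (auto intro!: resolvent_step_LIMSEQ l incseq_resolvent_upto_discount)
  have "(\<lambda>n. resolvent_upto B (l n) k f x) \<longlonglongrightarrow> (SUP n. resolvent_upto B (l n) k f x)" for k
    using incseq_resolvent_upto_discount[OF l(2,3), of B k f] by (intro LIMSEQ_SUP) (auto simp: incseq_def le_fun_def)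
  from LIMSEQ_unique[OF this lim] have eq: "(SUP n. resolvent_upto B (l n) k f x) = resolvent_upto B 0 k f x" for k .
  have "(\<lambda>n. resolvent B (l n) f x) \<longlonglongrightarrow> (SUP n. resolvent B (l n) f x)"
    using l by (intro LIMSEQ_SUP) (auto simp: incseq_def intro!: resolvent_mono decseqD[OF l(3)])
  also have "(SUP n. resolvent B (l n) f x) = (SUP k. SUP n. resolvent_upto B (l n) k f x)"
    unfolding resolvent_def by (rule SUP_commute)
  finally show ?thesis unfolding eq resolvent_def .
qed

lemma cycle_sum_LIMSEQ:
  assumes l: "l \<longlonglongrightarrow> 0" "\<And>n. 0 \<le> l n" "decseq l"
  shows "(\<lambda>n. cycle_sum x0 (l n) f) \<longlonglongrightarrow> cycle_sum x0 0 f"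
  unfolding cycle_sum_def using l
  by (intro resolvent_step_LIMSEQ resolvent_LIMSEQ) (auto simp: incseq_def le_fun_def intro!: resolvent_mono decseqD[OF l(3)])

section \<open>Additivity and kernel representation of resolvents and cycle sums\<close>

lemma resolvent_step_add:
  "resolvent_step B l (\<lambda>x. f x + g x) (\<lambda>x. w x + v x) x = resolvent_step B l f w x + resolvent_step B l g v x"
  by (simp add: resolvent_step_def nn_integral_add distrib_left distrib_right ac_simps)

lemma resolvent_add:
  assumes "0 \<le> l"
  shows "resolvent B l (\<lambda>x. f x + g x) x = resolvent B l f x + resolvent B l g x"
proof -
  have "resolvent_upto B l k (\<lambda>x. f x + g x) = (\<lambda>x. resolvent_upto B l k f x + resolvent_upto B l k g x)" for k
  proof (induction k)
    case (Suc k)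
    show ?case by (intro ext) (simp add: Suc resolvent_step_add)
  qed (simp add: fun_eq_iff)
  then show ?thesis unfolding resolvent_def by (simp add: ennreal_SUP_add incseq_resolvent_upto[OF assms])
qed

lemma cycle_sum_add: "0 \<le> l \<Longrightarrow> cycle_sum x0 l (\<lambda>x. f x + g x) = cycle_sum x0 l f + cycle_sum x0 l g"
proof -
  assume l: "0 \<le> l"
  have eq: "resolvent {x0} l (\<lambda>x. f x + g x) = (\<lambda>x. resolvent {x0} l f x + resolvent {x0} l g x)"
    by (intro ext resolvent_add l)
  show ?thesis unfolding cycle_sum_def eq by (rule resolvent_step_add)
qed

lemma cycle_sum_mono: "(\<And>x. f x \<le> g x) \<Longrightarrow> 0 \<le> l \<Longrightarrow> cycle_sum x0 l f \<le> cycle_sum x0 l g"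
  unfolding cycle_sum_def by (intro resolvent_step_mono resolvent_mono) simp_all

lemma nn_integral_count_space_indicator_point:
  assumes "x \<in> E"
  shows "(\<integral>\<^sup>+z. f z * indicator {z} x \<partial>count_space E) = (f x :: ennreal)"
proof -
  have "(\<integral>\<^sup>+z. f z * indicator {z} x \<partial>count_space E) = (\<integral>\<^sup>+z. f z * indicator {x} z \<partial>count_space E)"
    by (intro nn_integral_cong) (simp add: indicator_def)
  also have "\<dots> = f x" using assms by (subst nn_integral_indicator_singleton) simp_all
  finally show ?thesis .
qed

text \<open>\<open>w\<close> stands for a functional of \<open>f\<close> that already is an integral
  against its values on singletons; one more step preserves this form. Consequently
  \<open>cycle_sum x0 l\<close> is integration against a measure on \<open>E\<close>.\<close>

lemma resolvent_step_kernel: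
  assumes E: "countable E" "x \<in> E" "set_pmf (J x) \<subseteq> E"
    and w: "\<And>y. y \<in> E \<Longrightarrow> w f y = (\<integral>\<^sup>+z. f z * w (indicator {z}) y \<partial>count_space E)"
  shows "resolvent_step B l f (w f) x = (\<integral>\<^sup>+z. f z * resolvent_step B l (indicator {z}) (w (indicator {z})) x \<partial>count_space E)"
proof -
  have "(\<integral>\<^sup>+y. w f y \<partial>measure_pmf (J x)) = (\<integral>\<^sup>+y. \<integral>\<^sup>+z. f z * w (indicator {z}) y \<partial>count_space E \<partial>measure_pmf (J x))"
    using E(3) by (intro nn_integral_cong_AE AE_pmfI) (auto intro: w)
  also have "\<dots> = (\<integral>\<^sup>+z. \<integral>\<^sup>+y. f z * w (indicator {z}) y \<partial>measure_pmf (J x) \<partial>count_space E)"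
    by (rule nn_integral_count_space_nn_integral) (simp_all add: E)
  also have "\<dots> = (\<integral>\<^sup>+z. f z * (\<integral>\<^sup>+y. w (indicator {z}) y \<partial>measure_pmf (J x)) \<partial>count_space E)"
    by (simp add: nn_integral_cmult)
  finally have 1: "(\<integral>\<^sup>+y. w f y \<partial>measure_pmf (J x)) = \<dots>" .
  have "resolvent_step B l f (w f) x = indicator (- B) x * ((\<integral>\<^sup>+z. f z * indicator {z} x \<partial>count_space E) * ennreal (1 / (l + r x)) +
      jump_discount l x * (\<integral>\<^sup>+z. f z * (\<integral>\<^sup>+y. w (indicator {z}) y \<partial>measure_pmf (J x)) \<partial>count_space E))"
    unfolding resolvent_step_def 1 nn_integral_count_space_indicator_point[OF E(2)] ..
  also have "\<dots> = (\<integral>\<^sup>+z. indicator (- B) x * (f z * indicator {z} x * ennreal (1 / (l + r x)) +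
      jump_discount l x * (f z * (\<integral>\<^sup>+y. w (indicator {z}) y \<partial>measure_pmf (J x)))) \<partial>count_space E)"
    by (simp add: nn_integral_cmult nn_integral_multc nn_integral_add)
  also have "\<dots> = (\<integral>\<^sup>+z. f z * resolvent_step B l (indicator {z}) (w (indicator {z})) x \<partial>count_space E)"
    by (intro nn_integral_cong) (simp add: resolvent_step_def distrib_left ac_simps)
  finally show ?thesis .
qed

lemma resolvent_kernel:
  assumes E: "countable E" "\<And>x. x \<in> E \<Longrightarrow> set_pmf (J x) \<subseteq> E" and l: "0 \<le> l" and x: "x \<in> E"
  shows "resolvent B l f x = (\<integral>\<^sup>+z. f z * resolvent B l (indicator {z}) x \<partial>count_space E)"
proof -
  have k: "resolvent_upto B l k f x = (\<integral>\<^sup>+z. f z * resolvent_upto B l k (indicator {z}) x \<partial>count_space E)" if "x \<in> E" for k x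
    using that
  proof (induction k arbitrary: x)
    case (Suc k)
    then show ?case using resolvent_step_kernel[OF E(1) _ E(2), of x "resolvent_upto B l k" f B l] by simp
  qed simp
  show ?thesis unfolding resolvent_def k[OF x] SUP_mult_left_ennreal
    by (rule nn_integral_monotone_convergence_SUP[symmetric])
       (auto simp: incseq_def le_fun_def intro!: mult_left_mono incseq_resolvent_upto[OF l, THEN incseqD])
qed

lemma cycle_sum_kernel:
  assumes E: "countable E" "\<And>x. x \<in> E \<Longrightarrow> set_pmf (J x) \<subseteq> E" and l: "0 \<le> l" and x: "x0 \<in> E"
  shows "cycle_sum x0 l f = (\<integral>\<^sup>+z. f z * cycle_sum x0 l (indicator {z}) \<partial>count_space E)"
  unfolding cycle_sum_def
  by (rule resolvent_step_kernel[OF E(1) x E(2)[OF x]]) (rule resolvent_kernel[OF E l])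

end

context conservative_jump_process
begin

section \<open>Renewal at a fixed state and the invariant law\<close>

lemma resolvent_1: "l > 0 \<Longrightarrow> resolvent {} l (\<lambda>_. 1) x = ennreal (1 / l)"
proof -
  assume l: "l > 0"
  have "resolvent {} l (\<lambda>_. 1) x = (\<integral>\<^sup>+t. ennreal (exp (- l * t)) * semigroup (\<lambda>_. 1) t x \<partial>lborel)"
    by (rule laplace_semigroup[OF l, symmetric])
  also have "\<dots> = (\<integral>\<^sup>+t. ennreal (1 / l) * expd l t \<partial>lborel)"
  proof (rule nn_integral_cong)
    fix t :: real
    show "ennreal (exp (- l * t)) * semigroup (\<lambda>_. 1) t x = ennreal (1 / l) * expd l t"
      using l by (cases "t < 0") (simp_all add: semigroup_neg conservative exponential_density_def ennreal_mult[symmetric] mult.commute)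
  qed
  also have "\<dots> = ennreal (1 / l) * (\<integral>\<^sup>+t. expd l t \<partial>lborel)"
    by (rule nn_integral_cmult) (simp add: borel_measurable_expd)
  finally show ?thesis by (simp add: nn_integral_expd[OF l])
qed

text \<open>Comparison principle, hence uniqueness of bounded solutions, for the discounted
  equation; \<open>\<phi>\<close> is a common source term. Initially the gap is at most
  \<open>B\<close>, and every step multiplies it by the discount. After \<open>n\<close> steps it is
  at most \<open>B\<close> times \<open>1 - l * resolvent_upto {} l n (\<lambda>_. 1) y\<close>,
  which tends to 0 because the chain is conservative.\<close>

lemma bounded_comparison:
  assumes l: "l > 0" and B: "B \<noteq> \<infinity>" "\<And>y. \<alpha> y \<le> B"
    and step: "\<And>y. \<alpha> y \<le> \<beta> y \<or> (\<exists>\<phi>. \<alpha> y \<le> \<phi> + jump_discount l y * (\<integral>\<^sup>+z. \<alpha> z \<partial>measure_pmf (J y)) \<and>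
        \<phi> + jump_discount l y * (\<integral>\<^sup>+z. \<beta> z \<partial>measure_pmf (J y)) \<le> \<beta> y)"
  shows "\<alpha> y \<le> \<beta> y"
proof -
  \<comment> \<open>An independent exponential clock of rate \<open>l\<close> rings before the next
    jump with probability \<open>l / (l + r y)\<close>, otherwise the jump comes first; the two
    cases exhaust all possibilities.\<close>
  have kap1: "ennreal l * ennreal (1 / (l + r y)) + jump_discount l y = 1" for y
    using l r_pos[of y] by (simp add: jump_discount_def ennreal_mult[symmetric] ennreal_plus[symmetric] add_divide_distrib[symmetric] del: ennreal_plus)
  \<comment> \<open>The correction is added on the left, so that no difference is formed in
    \<open>ennreal\<close>.\<close>
  have main: "\<alpha> y + B * (ennreal l * resolvent_upto {} l n (\<lambda>_. 1) y) \<le> \<beta> y + B" for n y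
  proof (induction n arbitrary: y)
    case 0
    show ?case using B(2)[of y] by (simp add: add_increasing)
  next
    case (Suc n)
    let ?g = "\<lambda>n y. ennreal l * resolvent_upto {} l n (\<lambda>_. 1) y"
    have le1: "?g k y \<le> 1" for k y
    proof -
      have "?g k y \<le> ennreal l * resolvent {} l (\<lambda>_. 1) y"
        unfolding resolvent_def by (intro mult_left_mono SUP_upper) simp_all
      also have "\<dots> = 1" using l by (simp add: resolvent_1 ennreal_mult[symmetric])
      finally show ?thesis .
    qed
    from step[of y] show ?case
    proof (elim disjE exE conjE)
      assume "\<alpha> y \<le> \<beta> y"
      then show ?thesis using le1[of "Suc n" y] by (metis add_mono mult.right_neutral mult_left_mono zero_le)
    next
      fix \<phi> assume 1: "\<alpha> y \<le> \<phi> + jump_discount l y * (\<integral>\<^sup>+z. \<alpha> z \<partial>measure_pmf (J y))"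
        and 2: "\<phi> + jump_discount l y * (\<integral>\<^sup>+z. \<beta> z \<partial>measure_pmf (J y)) \<le> \<beta> y"
      have g: "?g (Suc n) y = ennreal l * ennreal (1 / (l + r y)) + jump_discount l y * (\<integral>\<^sup>+z. ?g n z \<partial>measure_pmf (J y))"
        by (simp add: resolvent_step_def distrib_left nn_integral_cmult ac_simps)
      have "\<alpha> y + B * ?g (Suc n) y \<le> \<phi> + B * (ennreal l * ennreal (1 / (l + r y))) +
         jump_discount l y * ((\<integral>\<^sup>+z. \<alpha> z \<partial>measure_pmf (J y)) + B * (\<integral>\<^sup>+z. ?g n z \<partial>measure_pmf (J y)))"
        unfolding g using 1 by (simp add: distrib_left ac_simps add_mono)
      also have "(\<integral>\<^sup>+z. \<alpha> z \<partial>measure_pmf (J y)) + B * (\<integral>\<^sup>+z. ?g n z \<partial>measure_pmf (J y)) =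
          (\<integral>\<^sup>+z. \<alpha> z + B * ?g n z \<partial>measure_pmf (J y))"
        by (simp add: nn_integral_add nn_integral_cmult)
      also have "\<dots> \<le> (\<integral>\<^sup>+z. \<beta> z + B \<partial>measure_pmf (J y))"
        by (intro nn_integral_mono Suc)
      also have "\<dots> = (\<integral>\<^sup>+z. \<beta> z \<partial>measure_pmf (J y)) + B"
        by (simp add: nn_integral_add)
      also have "\<phi> + B * (ennreal l * ennreal (1 / (l + r y))) + jump_discount l y * ((\<integral>\<^sup>+z. \<beta> z \<partial>measure_pmf (J y)) + B) =
          (\<phi> + jump_discount l y * (\<integral>\<^sup>+z. \<beta> z \<partial>measure_pmf (J y))) + B * (ennreal l * ennreal (1 / (l + r y)) + jump_discount l y)"
        by (simp add: distrib_left ac_simps)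
      also have "\<dots> \<le> \<beta> y + B" unfolding kap1 using 2 by (simp add: add_mono)
      finally show ?thesis by (simp add: add_left_mono mult_left_mono)
    qed
  qed
  have "\<alpha> y + B = (SUP n. \<alpha> y + B * (ennreal l * resolvent_upto {} l n (\<lambda>_. 1) y))"
  proof -
    have "B = B * (ennreal l * resolvent {} l (\<lambda>_. 1) y)"
      using l by (simp add: resolvent_1 ennreal_mult[symmetric])
    also have "\<dots> = (SUP n. B * (ennreal l * resolvent_upto {} l n (\<lambda>_. 1) y))"
      unfolding resolvent_def SUP_mult_left_ennreal ..
    finally have "\<alpha> y + B = \<alpha> y + (SUP n. B * (ennreal l * resolvent_upto {} l n (\<lambda>_. 1) y))"
      by (rule arg_cong)
    also have "\<dots> = (SUP n. \<alpha> y + B * (ennreal l * resolvent_upto {} l n (\<lambda>_. 1) y))"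
      by (simp add: ennreal_SUP_add_right)
    finally show ?thesis .
  qed
  also have "\<dots> \<le> \<beta> y + B" by (rule SUP_least) (rule main)
  finally show ?thesis using B(1) by (simp add: ennreal_add_left_cancel_le add.commute[of _ B])
qed

text \<open>Renewal at \<open>x0\<close>. With \<open>c = l * resolvent {} l f x0\<close>, both sides of the identity for \<open>\<alpha>\<close> and \<open>\<beta>\<close> below
  agree at \<open>x0\<close> and solve the same linear equation elsewhere.\<close>

lemma cycle_sum_renewal:
  assumes l: "l > 0" and f: "\<And>x. f x \<le> 1"
  shows "ennreal l * resolvent {} l f x0 * cycle_sum x0 l (\<lambda>_. 1) = cycle_sum x0 l f"
proof -
  define c where "c = ennreal l * resolvent {} l f x0"
  let ?H1 = "resolvent {x0} l (\<lambda>_. 1)" and ?Hf = "resolvent {x0} l f" and ?R = "resolvent {} l f"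
  define \<alpha> where "\<alpha> y = ?R y + c * ?H1 y" for y
  define \<beta> where "\<beta> y = ?Hf y + c * ennreal (1 / l)" for y
  have l0: "0 \<le> l" using l by simp
  have resolvent_le: "resolvent B l g y \<le> ennreal (1 / l)" if "\<And>x. g x \<le> 1" for B g y
  proof -
    have "resolvent_upto B l k g y \<le> resolvent_upto {} l k (\<lambda>_. 1) y" for k y
    proof (induction k arbitrary: y)
      case (Suc k)
      then have "resolvent_step B l g (resolvent_upto B l k g) y \<le> resolvent_step B l (\<lambda>_. 1) (resolvent_upto {} l k (\<lambda>_. 1)) y"
        by (intro resolvent_step_mono that) (simp_all add: l0)
      also have "\<dots> \<le> resolvent_step {} l (\<lambda>_. 1) (resolvent_upto {} l k (\<lambda>_. 1)) y"
        by (simp add: resolvent_step_def indicator_def)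
      finally show ?case by simp
    qed simp
    then have "resolvent B l g y \<le> resolvent {} l (\<lambda>_. 1) y" unfolding resolvent_def by (rule SUP_mono')
    then show ?thesis by (simp add: resolvent_1[OF l])
  qed
  have c1: "c \<le> 1"
  proof -
    have "?R x0 \<le> ennreal (1 / l)" by (rule resolvent_le[OF f])
    from mult_left_mono[OF this, of "ennreal l"] show ?thesis
      unfolding c_def using l by (simp add: ennreal_mult[symmetric])
  qed
  have cl: "c * ennreal (1 / l) = ?R x0"
    unfolding c_def using l by (simp add: ac_simps ennreal_mult[symmetric] mult.assoc[symmetric])
  have unfold1: "ennreal (1 / l) = ennreal (1 / (l + r y)) + jump_discount l y * ennreal (1 / l)" for y
  proof -
    have "1 / l = 1 / (l + r y) * ((l + r y) / l)" using l r_pos[of y] by simp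
    also have "(l + r y) / l = 1 + r y / l" using l by (simp add: add_divide_distrib)
    also have "1 / (l + r y) * (1 + r y / l) = 1 / (l + r y) + r y / (l + r y) * (1 / l)"
      by (simp add: distrib_left)
    finally have "ennreal (1 / l) = ennreal (1 / (l + r y) + r y / (l + r y) * (1 / l))"
      by (rule arg_cong)
    also have "\<dots> = ennreal (1 / (l + r y)) + ennreal (r y / (l + r y)) * ennreal (1 / l)"
    proof -
      have "ennreal (a + b * c) = ennreal a + ennreal b * ennreal c" if "0 \<le> a" "0 \<le> b" "0 \<le> c" for a b c
        using that by (simp add: ennreal_mult)
      then show ?thesis using l r_pos[of y] by (metis add_nonneg_nonneg divide_nonneg_nonneg less_imp_le zero_le_one)
    qed
    finally show ?thesis unfolding jump_discount_def .
  qed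
  \<comment> \<open>At \<open>x0\<close> the killed resolvents are 0, and both sides reduce to
    \<open>?R x0\<close> by the choice of \<open>c\<close>.\<close>
  have at: "\<alpha> x0 = \<beta> x0"
    unfolding \<alpha>_def \<beta>_def cl using resolvent_fixpoint[OF l0, of "{x0}" _ x0] by (simp add: resolvent_step_def)
  have eqs: "\<exists>\<phi>. \<alpha> y = \<phi> + jump_discount l y * (\<integral>\<^sup>+z. \<alpha> z \<partial>measure_pmf (J y)) \<and>
      \<phi> + jump_discount l y * (\<integral>\<^sup>+z. \<beta> z \<partial>measure_pmf (J y)) = \<beta> y" if y: "y \<noteq> x0" for y
  proof (intro exI conjI)
    let ?\<phi> = "f y * ennreal (1 / (l + r y)) + c * ennreal (1 / (l + r y))"
    have "\<alpha> y = resolvent_step {} l f ?R y + c * resolvent_step {x0} l (\<lambda>_. 1) ?H1 y"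
      unfolding \<alpha>_def
      by (rule arg_cong2[where f="(+)", OF resolvent_fixpoint[OF l0] arg_cong[where f="(*) c", OF resolvent_fixpoint[OF l0]]])
    then show "\<alpha> y = ?\<phi> + jump_discount l y * (\<integral>\<^sup>+z. \<alpha> z \<partial>measure_pmf (J y))"
      using y by (simp add: resolvent_step_def \<alpha>_def nn_integral_add nn_integral_cmult distrib_left ac_simps)
    have "\<beta> y = resolvent_step {x0} l f ?Hf y + c * (ennreal (1 / (l + r y)) + jump_discount l y * ennreal (1 / l))"
      unfolding \<beta>_def unfold1[of y, symmetric] by (subst resolvent_fixpoint[OF l0]) (rule refl)
    then show "?\<phi> + jump_discount l y * (\<integral>\<^sup>+z. \<beta> z \<partial>measure_pmf (J y)) = \<beta> y"
      using y by (simp add: resolvent_step_def \<beta>_def nn_integral_add nn_integral_cmult distrib_left ac_simps)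
  qed
  have bnd: "\<alpha> y \<le> ennreal (1 / l) + ennreal (1 / l)" "\<beta> y \<le> ennreal (1 / l) + ennreal (1 / l)" for y
  proof -
    have "c * ?H1 y \<le> 1 * ennreal (1 / l)" by (intro mult_mono c1 resolvent_le) simp_all
    then show "\<alpha> y \<le> ennreal (1 / l) + ennreal (1 / l)"
      unfolding \<alpha>_def by (intro add_mono resolvent_le f) simp
    have "c * ennreal (1 / l) \<le> 1 * ennreal (1 / l)" by (intro mult_mono c1) simp_all
    then show "\<beta> y \<le> ennreal (1 / l) + ennreal (1 / l)"
      unfolding \<beta>_def by (intro add_mono resolvent_le f) simp
  qed
  have fin: "ennreal (1 / l) + ennreal (1 / l) \<noteq> \<infinity>" by simp
  have "\<alpha> y = \<beta> y" for y
  proof (rule antisym)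
    show "\<alpha> y \<le> \<beta> y"
    proof (rule bounded_comparison[OF l fin bnd(1)])
      fix y
      show "\<alpha> y \<le> \<beta> y \<or> (\<exists>\<phi>. \<alpha> y \<le> \<phi> + jump_discount l y * (\<integral>\<^sup>+z. \<alpha> z \<partial>measure_pmf (J y)) \<and>
        \<phi> + jump_discount l y * (\<integral>\<^sup>+z. \<beta> z \<partial>measure_pmf (J y)) \<le> \<beta> y)"
        using at eqs[of y] by (cases "y = x0") (simp, metis order_refl)
    qed
    show "\<beta> y \<le> \<alpha> y"
    proof (rule bounded_comparison[OF l fin bnd(2)])
      fix y
      show "\<beta> y \<le> \<alpha> y \<or> (\<exists>\<phi>. \<beta> y \<le> \<phi> + jump_discount l y * (\<integral>\<^sup>+z. \<beta> z \<partial>measure_pmf (J y)) \<and>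
        \<phi> + jump_discount l y * (\<integral>\<^sup>+z. \<alpha> z \<partial>measure_pmf (J y)) \<le> \<alpha> y)"
        using at eqs[of y] by (cases "y = x0") (simp, metis order_refl)
    qed
  qed
  then have int: "(\<integral>\<^sup>+z. ?R z \<partial>measure_pmf (J x0)) + c * (\<integral>\<^sup>+z. ?H1 z \<partial>measure_pmf (J x0)) =
      (\<integral>\<^sup>+z. ?Hf z \<partial>measure_pmf (J x0)) + c * ennreal (1 / l)"
  proof -
    assume "\<And>y. \<alpha> y = \<beta> y"
    then have "(\<integral>\<^sup>+z. \<alpha> z \<partial>measure_pmf (J x0)) = (\<integral>\<^sup>+z. \<beta> z \<partial>measure_pmf (J x0))" by simp
    then show ?thesis unfolding \<alpha>_def \<beta>_def by (simp add: nn_integral_add nn_integral_cmult)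
  qed
  \<comment> \<open>One more step from \<open>x0\<close> completes the cycles. The amount
    \<open>jump_discount l x0 * (c * ennreal (1 / l))\<close> is carried on both sides to avoid a
    subtraction; being finite, it can be cancelled at the end.\<close>
  have "jump_discount l x0 * (c * ennreal (1 / l)) + c * cycle_sum x0 l (\<lambda>_. 1) =
      c * (ennreal (1 / (l + r x0)) + jump_discount l x0 * ennreal (1 / l)) + jump_discount l x0 * (c * (\<integral>\<^sup>+z. ?H1 z \<partial>measure_pmf (J x0)))"
    by (simp add: cycle_sum_def resolvent_step_def distrib_left ac_simps)
  also have "\<dots> = ?R x0 + jump_discount l x0 * (c * (\<integral>\<^sup>+z. ?H1 z \<partial>measure_pmf (J x0)))"
    unfolding unfold1[symmetric] cl ..
  also have "\<dots> = f x0 * ennreal (1 / (l + r x0)) +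
      jump_discount l x0 * ((\<integral>\<^sup>+z. ?R z \<partial>measure_pmf (J x0)) + c * (\<integral>\<^sup>+z. ?H1 z \<partial>measure_pmf (J x0)))"
    by (subst resolvent_fixpoint[OF l0]) (simp add: resolvent_step_def distrib_left ac_simps)
  also have "\<dots> = jump_discount l x0 * (c * ennreal (1 / l)) + cycle_sum x0 l f"
    unfolding int by (simp add: cycle_sum_def resolvent_step_def distrib_left ac_simps)
  finally have "jump_discount l x0 * (c * ennreal (1 / l)) + c * cycle_sum x0 l (\<lambda>_. 1) = jump_discount l x0 * (c * ennreal (1 / l)) + cycle_sum x0 l f" .
  moreover have "jump_discount l x0 * (c * ennreal (1 / l)) \<noteq> \<infinity>"
    using c1 by (auto simp: jump_discount_def ennreal_mult_eq_top_iff top_unique)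
  ultimately show ?thesis unfolding c_def[symmetric] by (simp add: ennreal_add_left_cancel)
qed

text \<open>Translation of time by \<open>h\<close> costs the factor \<open>exp (l * h)\<close> in
  the Laplace transform. The renewal identity carries this from the resolvent to the cycle sum,
  because \<open>cycle_sum x0 l (\<lambda>_. 1)\<close> is the same for \<open>f\<close> and for
  \<open>semigroup f h\<close>. The cost disappears as \<open>l\<close> tends to 0.\<close>

lemma cycle_sum_semigroup_le_discount:
  assumes l: "l > 0" and f: "\<And>x. f x \<le> 1" and h: "h \<ge> 0"
  shows "cycle_sum x0 l (semigroup f h) \<le> ennreal (exp (l * h)) * cycle_sum x0 l f"
proof -
  have "resolvent {} l (semigroup f h) x0 = (\<integral>\<^sup>+t. ennreal (exp (- l * t)) * semigroup (semigroup f h) t x0 \<partial>lborel)"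
    by (rule laplace_semigroup[OF l, symmetric])
  also have "\<dots> \<le> (\<integral>\<^sup>+t. ennreal (exp (l * h)) * (ennreal (exp (- l * (t + h))) * semigroup f (t + h) x0) \<partial>lborel)"
  proof (rule nn_integral_mono)
    fix t :: real
    have e: "ennreal (exp (- l * t)) = ennreal (exp (l * h)) * ennreal (exp (- l * (t + h)))"
      by (simp add: ennreal_mult[symmetric] exp_add[symmetric] algebra_simps)
    show "ennreal (exp (- l * t)) * semigroup (semigroup f h) t x0 \<le>
        ennreal (exp (l * h)) * (ennreal (exp (- l * (t + h))) * semigroup f (t + h) x0)"
      unfolding e mult.assoc using semigroup_compose_le[OF h, of t f x0]
      by (cases "t < 0") (auto simp: semigroup_neg intro!: mult_left_mono)
  qed
  also have "\<dots> = ennreal (exp (l * h)) * (\<integral>\<^sup>+t. ennreal (exp (- l * (t + h))) * semigroup f (t + h) x0 \<partial>lborel)"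
    by (rule nn_integral_cmult) measurable
  also have "(\<integral>\<^sup>+t. ennreal (exp (- l * (t + h))) * semigroup f (t + h) x0 \<partial>lborel) = resolvent {} l f x0"
    unfolding laplace_semigroup[OF l, symmetric]
    by (rule nn_integral_lborel_shift[where h="\<lambda>t. ennreal (exp (- l * t)) * semigroup f t x0"]) measurable
  finally have "resolvent {} l (semigroup f h) x0 \<le> ennreal (exp (l * h)) * resolvent {} l f x0" .
  then have "ennreal l * resolvent {} l (semigroup f h) x0 * cycle_sum x0 l (\<lambda>_. 1) \<le>
      ennreal l * (ennreal (exp (l * h)) * resolvent {} l f x0) * cycle_sum x0 l (\<lambda>_. 1)"
    by (intro mult_right_mono mult_left_mono) simp_all
  also have "\<dots> = ennreal (exp (l * h)) * (ennreal l * resolvent {} l f x0 * cycle_sum x0 l (\<lambda>_. 1))"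
    by (simp add: ac_simps)
  finally show ?thesis
    unfolding cycle_sum_renewal[OF l f] cycle_sum_renewal[OF l semigroup_le_1[OF f]] .
qed

lemma cycle_sum_semigroup_le:
  assumes f: "\<And>x. f x \<le> 1" and h: "h \<ge> 0"
  shows "cycle_sum x0 0 (semigroup f h) \<le> cycle_sum x0 0 f"
proof (rule LIMSEQ_le)
  let ?l = "\<lambda>n. inverse (real (Suc n))"
  have l: "?l \<longlonglongrightarrow> 0" "\<And>n. 0 \<le> ?l n" "decseq ?l"
    by (rule LIMSEQ_inverse_real_of_nat) (auto simp: decseq_def)
  show "(\<lambda>n. cycle_sum x0 (?l n) (semigroup f h)) \<longlonglongrightarrow> cycle_sum x0 0 (semigroup f h)" by (rule cycle_sum_LIMSEQ[OF l])
  have "(\<lambda>n. ennreal (exp (?l n * h))) \<longlonglongrightarrow> ennreal (exp (0 * h))"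
    by (intro tendsto_intros l)
  then show "(\<lambda>n. ennreal (exp (?l n * h)) * cycle_sum x0 (?l n) f) \<longlonglongrightarrow> cycle_sum x0 0 f"
    using tendsto_mult_ennreal[OF _ cycle_sum_LIMSEQ[OF l, of x0 f], of "\<lambda>n. ennreal (exp (?l n * h))" 1] by simp
  show "\<exists>N. \<forall>n\<ge>N. cycle_sum x0 (?l n) (semigroup f h) \<le> ennreal (exp (?l n * h)) * cycle_sum x0 (?l n) f"
    by (intro exI allI impI cycle_sum_semigroup_le_discount f h) simp
qed

text \<open>The inequalities for \<open>f\<close> and for \<open>1 - f\<close> add up to the mean
  cycle length on both sides. As this is finite, neither inequality can be strict.\<close>

lemma cycle_sum_semigroup:
  assumes fin: "cycle_sum x0 0 (\<lambda>_. 1) < \<infinity>" and f: "\<And>x. f x \<le> 1" and h: "h \<ge> 0"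
  shows "cycle_sum x0 0 (semigroup f h) = cycle_sum x0 0 f"
proof (rule antisym)
  let ?g = "\<lambda>x. 1 - f x"
  show "cycle_sum x0 0 (semigroup f h) \<le> cycle_sum x0 0 f" by (rule cycle_sum_semigroup_le[OF f h])
  have "(\<lambda>x. f x + ?g x) = (\<lambda>_. 1)" "(\<lambda>x. semigroup f h x + semigroup ?g h x) = (\<lambda>_. 1)"
    using semigroup_compl[of f h] f h by (simp_all add: fun_eq_iff add_diff_inverse_ennreal)
  then have eq: "cycle_sum x0 0 f + cycle_sum x0 0 ?g = cycle_sum x0 0 (\<lambda>_. 1)"
      "cycle_sum x0 0 (semigroup f h) + cycle_sum x0 0 (semigroup ?g h) = cycle_sum x0 0 (\<lambda>_. 1)"
    using cycle_sum_add[of 0 x0 f ?g] cycle_sum_add[of 0 x0 "semigroup f h" "semigroup ?g h"] by simp_all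
  have "cycle_sum x0 0 (semigroup ?g h) \<le> cycle_sum x0 0 ?g" by (rule cycle_sum_semigroup_le[OF _ h]) (simp add: diff_le_self_ennreal)
  from add_left_mono[OF this, of "cycle_sum x0 0 f"]
  have "cycle_sum x0 0 f + cycle_sum x0 0 (semigroup ?g h) \<le> cycle_sum x0 0 (semigroup f h) + cycle_sum x0 0 (semigroup ?g h)" unfolding eq .
  moreover have "cycle_sum x0 0 (semigroup ?g h) \<noteq> \<infinity>" using eq(2) fin by (auto simp: top_unique)
  ultimately show "cycle_sum x0 0 f \<le> cycle_sum x0 0 (semigroup f h)"
    by (simp add: ennreal_add_left_cancel_le add.commute)
qed

text \<open>The mass of \<open>z\<close> is the mean time spent in \<open>z\<close> during one
  cycle, divided by the mean length of a cycle.\<close>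

lemma ex_invariant_pmf:
  assumes E: "countable E" "\<And>x. x \<in> E \<Longrightarrow> set_pmf (J x) \<subseteq> E" and x0: "x0 \<in> E"
    and fin: "cycle_sum x0 0 (\<lambda>_. 1) < \<infinity>"
  shows "\<exists>\<pi>. set_pmf \<pi> \<subseteq> E \<and>
    (\<forall>h\<ge>0. \<forall>f. (\<forall>x. f x \<le> 1) \<longrightarrow> (\<integral>\<^sup>+x. semigroup f h x \<partial>measure_pmf \<pi>) = (\<integral>\<^sup>+x. f x \<partial>measure_pmf \<pi>))"
proof -
  define m where "m = enn2real (cycle_sum x0 0 (\<lambda>_. 1))"
  have m: "cycle_sum x0 0 (\<lambda>_. 1) = ennreal m" unfolding m_def using fin by simp
  \<comment> \<open>A cycle contains the holding time in \<open>x0\<close>, so its mean length is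
    positive and may be divided by.\<close>
  have "0 < ennreal (1 / (0 + r x0))" using r_pos[of x0] by simp
  also have "\<dots> \<le> cycle_sum x0 0 (\<lambda>_. 1)" by (simp add: cycle_sum_def resolvent_step_def)
  finally have m0: "m > 0" unfolding m by simp
  define g where "g z = (if z \<in> E then enn2real (cycle_sum x0 0 (indicator {z})) / m else 0)" for z
  have fin': "cycle_sum x0 0 (indicator {z}) < \<infinity>" for z
  proof -
    have "cycle_sum x0 0 (indicator {z}) \<le> cycle_sum x0 0 (\<lambda>_. 1)" by (rule cycle_sum_mono) (simp_all add: indicator_def)
    then show ?thesis using fin by (rule order_le_less_trans)
  qed
  have ker: "cycle_sum x0 0 f = (\<integral>\<^sup>+z. f z * cycle_sum x0 0 (indicator {z}) \<partial>count_space E)" for f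
    by (rule cycle_sum_kernel[OF E _ x0]) simp_all
  have g: "ennreal (g z) = (cycle_sum x0 0 (indicator {z}) / ennreal m) * indicator E z" for z
    using fin'[of z] m0 by (cases "cycle_sum x0 0 (indicator {z})") (auto simp: g_def divide_ennreal)
  have int: "(\<integral>\<^sup>+z. ennreal (g z) * f z \<partial>count_space UNIV) = cycle_sum x0 0 f / ennreal m" for f
  proof -
    have "(\<integral>\<^sup>+z. ennreal (g z) * f z \<partial>count_space UNIV) =
        (\<integral>\<^sup>+z. (f z * cycle_sum x0 0 (indicator {z}) / ennreal m) * indicator E z \<partial>count_space UNIV)"
      unfolding g by (simp add: divide_ennreal_def ac_simps)
    also have "\<dots> = (\<integral>\<^sup>+z. f z * cycle_sum x0 0 (indicator {z}) / ennreal m \<partial>count_space E)"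
      by (simp add: nn_integral_count_space_indicator)
    also have "\<dots> = cycle_sum x0 0 f / ennreal m"
      unfolding ker[of f] by (simp add: nn_integral_divide)
    finally show ?thesis .
  qed
  have g0: "0 \<le> g z" for z unfolding g_def using m0 by simp
  have "(\<integral>\<^sup>+z. ennreal (g z) \<partial>count_space UNIV) = 1"
    using int[of "\<lambda>_. 1"] m0 by (simp add: m divide_ennreal)
  then have pmf: "pmf (embed_pmf g) z = g z" for z using g0 by (intro pmf_embed_pmf) simp_all
  have int': "(\<integral>\<^sup>+z. f z \<partial>measure_pmf (embed_pmf g)) = cycle_sum x0 0 f / ennreal m" for f
    unfolding nn_integral_measure_pmf pmf by (rule int)
  show ?thesis
  proof (intro exI[of _ "embed_pmf g"] conjI allI impI)
    show "set_pmf (embed_pmf g) \<subseteq> E" by (auto simp: set_pmf_eq pmf g_def split: if_splits)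
  qed (simp add: int' cycle_sum_semigroup[OF fin])
qed

end

section \<open>First-step analysis for a chain given by jumps and holding times\<close>

lemma nn_integral_conv_infsum:
  fixes f :: "'a \<Rightarrow> real"
  assumes "f summable_on A" "\<And>x. x \<in> A \<Longrightarrow> 0 \<le> f x"
  shows "(\<integral>\<^sup>+x. ennreal (f x) \<partial>count_space A) = ennreal (infsum f A)"
proof -
  have "Infinite_Set_Sum.abs_summable_on f A"
    using assms(1) summable_on_iff_abs_summable_on_real abs_summable_equivalent by blast
  then show ?thesis using assms(2) by (simp add: nn_integral_conv_infsetsum infsetsum_infsum)
qed

lemma in_scylinder_iff:
  "\<omega> \<in> scylinder \<Omega> xs \<longleftrightarrow> \<omega> \<in> streams \<Omega> \<and> (\<forall>i<length xs. \<omega> !! i \<in> xs ! i)"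
proof (induction xs arbitrary: \<omega>)
  case (Cons A xs)
  have "(\<forall>i<Suc (length xs). \<omega> !! i \<in> (A # xs) ! i) \<longleftrightarrow> shd \<omega> \<in> A \<and> (\<forall>i<length xs. stl \<omega> !! i \<in> xs ! i)"
    by (auto simp: less_Suc_eq_0_disj)
  then show ?case by (auto simp: Cons dest: streams_stl)
qed simp

lemma snth_to_stream [simp]: "to_stream X !! n = X n"
  by (simp add: to_stream_def)

lemma nn_integral_expd_greaterThan:
  assumes "l > 0" "c \<ge> 0"
  shows "(\<integral>\<^sup>+s. expd l s * indicator {c<..} s \<partial>lborel) = ennreal (exp (- l * c))"
proof -
  have "(\<integral>\<^sup>+s. expd l s * indicator {..c} s \<partial>lborel) = ennreal (1 - exp (- l * c))"
    using nn_integral_expd_linear[of l c 1 0] assms by simp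
  moreover have "(\<integral>\<^sup>+s. expd l s * indicator {c<..} s \<partial>lborel) + (\<integral>\<^sup>+s. expd l s * indicator {..c} s \<partial>lborel) = 1"
  proof -
    have "(\<integral>\<^sup>+s. expd l s * indicator {c<..} s \<partial>lborel) + (\<integral>\<^sup>+s. expd l s * indicator {..c} s \<partial>lborel)
      = (\<integral>\<^sup>+s. expd l s * indicator {c<..} s + expd l s * indicator {..c} s \<partial>lborel)"
      using borel_measurable_expd[of l] by (intro nn_integral_add[symmetric]) simp_all
    also have "\<dots> = (\<integral>\<^sup>+s. expd l s \<partial>lborel)"
      by (intro nn_integral_cong) (simp add: indicator_def)
    finally show ?thesis by (simp add: nn_integral_expd assms)
  qed
  moreover have "ennreal (exp (- l * c)) + ennreal (1 - exp (- l * c)) = 1"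
    using assms by (simp add: ennreal_plus[symmetric] del: ennreal_plus)
  ultimately show ?thesis
    by (metis add.commute ennreal_add_left_cancel ennreal_neq_top infinity_ennreal_def)
qed

text \<open>Positive exit rates exclude absorbing states, so every holding time is exponential and
  \<open>jump_prob\<close> is given by the normalised rates.\<close>

locale ctmc_process =
  fixes E :: "'a set" and q :: "'a \<Rightarrow> 'a \<Rightarrow> real" and P :: "'a \<Rightarrow> 'w measure"
    and Y :: "nat \<Rightarrow> 'w \<Rightarrow> 'a" and S :: "nat \<Rightarrow> 'w \<Rightarrow> ennreal"
  assumes ctmc: "ctmc E q P Y S" and exit_pos: "\<And>x. x \<in> E \<Longrightarrow> 0 < exit_rate E q x"
begin

text \<open>States outside \<open>E\<close> are given the rates of an arbitrary state of \<open>E\<close>, so that the results on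
  total rate functions apply.\<close>

definition proj :: "'a \<Rightarrow> 'a" where
  "proj x = (if x \<in> E then x else (SOME e. e \<in> E))"

definition hold_rate :: "'a \<Rightarrow> real" where
  "hold_rate x = exit_rate E q (proj x)"

definition jump_pmf :: "'a \<Rightarrow> 'a pmf" where
  "jump_pmf x = embed_pmf (\<lambda>y. if y \<in> E then jump_prob E q (proj x) y else 0)"

abbreviation St :: "('a \<times> ennreal) measure" where
  "St \<equiv> count_space E \<Otimes>\<^sub>M borel"

text \<open>With the chain coded as a stream of pairs, restarting after the first jump is the
  removal of the head, and laws are determined by cylinder sets.\<close>

definition Z :: "'w \<Rightarrow> ('a \<times> ennreal) stream" where
  "Z \<omega> = to_stream (\<lambda>k. (Y k \<omega>, S k \<omega>))"

definition law :: "'a \<Rightarrow> ('a \<times> ennreal) stream measure" where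
  "law x = distr (P (proj x)) (stream_space St) Z"

lemma countable_E: "countable E" and E_ne: "E \<noteq> {}"
  and rates_nonneg: "x \<in> E \<Longrightarrow> y \<in> E - {x} \<Longrightarrow> 0 \<le> q x y"
  and rates_summable: "x \<in> E \<Longrightarrow> (\<lambda>y. q x y) summable_on (E - {x})"
  using ctmc unfolding ctmc_def transition_rates_def by auto

lemma prob_P: "x \<in> E \<Longrightarrow> prob_space (P x)"
  using ctmc unfolding ctmc_def by auto

lemma measurable_Y: "x \<in> E \<Longrightarrow> Y k \<in> measurable (P x) (count_space E)"
  and measurable_S: "x \<in> E \<Longrightarrow> S k \<in> borel_measurable (P x)"
  using ctmc unfolding ctmc_def by auto

lemma ctmc_law:
  assumes "x \<in> E" "\<And>i. i \<le> k \<Longrightarrow> ys i \<in> E \<and> ss i \<ge> 0"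
  shows "measure (P x) {\<omega> \<in> space (P x). \<forall>i\<le>k. Y i \<omega> = ys i \<and> S i \<omega> > ennreal (ss i)} =
     (if ys 0 = x then 1 else 0) * (\<Prod>i<k. jump_prob E q (ys i) (ys (Suc i))) *
     (\<Prod>i\<le>k. exp (- exit_rate E q (ys i) * ss i))"
  using ctmc assms unfolding ctmc_def by auto

lemma proj_E: "proj x \<in> E"
  using E_ne some_in_eq[of E] by (auto simp: proj_def)

lemma proj_id: "x \<in> E \<Longrightarrow> proj x = x"
  by (simp add: proj_def)

lemma hold_rate_pos: "0 < hold_rate x"
  unfolding hold_rate_def by (rule exit_pos[OF proj_E])

lemma hold_rate_E: "x \<in> E \<Longrightarrow> hold_rate x = exit_rate E q x"
  by (simp add: hold_rate_def proj_id)

lemma nn_integral_rates: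
  assumes x: "x \<in> E"
  shows "(\<integral>\<^sup>+y. ennreal (if y \<in> E then jump_prob E q x y else 0) \<partial>count_space UNIV) = 1"
proof -
  have e: "0 < exit_rate E q x" by (rule exit_pos[OF x])
  have "(\<integral>\<^sup>+y. ennreal (if y \<in> E then jump_prob E q x y else 0) \<partial>count_space UNIV) =
     (\<integral>\<^sup>+y. ennreal (q x y) / ennreal (exit_rate E q x) * indicator (E - {x}) y \<partial>count_space UNIV)"
    using e rates_nonneg[OF x]
    by (intro nn_integral_cong) (auto simp: jump_prob_def indicator_def divide_ennreal)
  also have "\<dots> = (\<integral>\<^sup>+y. ennreal (q x y) / ennreal (exit_rate E q x) \<partial>count_space (E - {x}))"
    by (simp add: nn_integral_count_space_indicator)
  also have "\<dots> = ennreal (exit_rate E q x) / ennreal (exit_rate E q x)"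
    using nn_integral_conv_infsum[OF rates_summable[OF x] rates_nonneg[OF x]]
    by (simp add: nn_integral_divide exit_rate_def)
  finally show ?thesis using e by (simp add: divide_ennreal)
qed

lemma jump_prob_nonneg:
  assumes "x \<in> E" "y \<in> E"
  shows "0 \<le> jump_prob E q x y"
  using exit_pos[OF assms(1)] rates_nonneg[OF assms(1), of y] assms by (auto simp: jump_prob_def)

lemma pmf_jump_pmf: "pmf (jump_pmf x) y = (if y \<in> E then jump_prob E q (proj x) y else 0)"
  unfolding jump_pmf_def
  by (rule pmf_embed_pmf) (auto intro: jump_prob_nonneg proj_E nn_integral_rates)

lemma set_jump_pmf: "set_pmf (jump_pmf x) \<subseteq> E"
  by (auto simp: set_pmf_eq pmf_jump_pmf)

sublocale jump_process hold_rate jump_pmf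
  by unfold_locales (rule hold_rate_pos)

lemma measurable_Z: "x \<in> E \<Longrightarrow> Z \<in> measurable (P x) (stream_space St)"
  using measurable_Y measurable_S unfolding Z_def[abs_def] by (intro measurable_stream_space2) simp

lemma prob_law: "prob_space (law x)"
  unfolding law_def by (intro prob_space.prob_space_distr prob_P measurable_Z proj_E)

lemma sets_law [simp]: "sets (law x) = sets (stream_space St)"
  by (simp add: law_def)

text \<open>Recursive form of the product in \<open>ctmc\<close>: an entry \<open>(y, s)\<close>
  prescribes the state \<open>y\<close> and a holding time above \<open>s\<close>. Recursion from
  the front matches the decomposition at the first jump.\<close>

primrec cyl :: "('a \<times> real) list \<Rightarrow> 'a \<Rightarrow> ennreal" where
  "cyl [] x = 1"
| "cyl (p # l) x = indicator {fst p} x * (ennreal (exp (- hold_rate x * snd p)) * (\<integral>\<^sup>+z. cyl l z \<partial>measure_pmf (jump_pmf x)))"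

lemma cyl_eq_prod:
  assumes "\<And>i. i \<le> k \<Longrightarrow> ys i \<in> E \<and> (0::real) \<le> ss i"
  shows "cyl (map (\<lambda>i. (ys i, ss i)) [0..<Suc k]) x =
    indicator {ys 0} x * ennreal ((\<Prod>i<k. jump_prob E q (ys i) (ys (Suc i))) * (\<Prod>i\<le>k. exp (- exit_rate E q (ys i) * ss i)))"
  using assms
proof (induction k arbitrary: ys ss x)
  case 0
  then show ?case by (auto simp: indicator_def hold_rate_E)
next
  case (Suc k)
  let ?R = "(\<Prod>i<k. jump_prob E q (ys (Suc i)) (ys (Suc (Suc i)))) * (\<Prod>i\<le>k. exp (- exit_rate E q (ys (Suc i)) * ss (Suc i)))"
  have yE: "ys i \<in> E" if "i \<le> Suc k" for i using Suc.prems that by blast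
  have R0: "0 \<le> ?R" by (intro mult_nonneg_nonneg prod_nonneg) (auto intro!: jump_prob_nonneg yE)
  have "map (\<lambda>i. (ys i, ss i)) [0..<Suc (Suc k)] = (ys 0, ss 0) # map (\<lambda>i. (ys (Suc i), ss (Suc i))) [0..<Suc k]"
    by (simp only: upt_conv_Cons[of 0 "Suc (Suc k)"] map_Suc_upt[symmetric] list.map map_map) (simp add: o_def)
  then have "cyl (map (\<lambda>i. (ys i, ss i)) [0..<Suc (Suc k)]) x = indicator {ys 0} x * (ennreal (exp (- hold_rate x * ss 0)) *
      (\<integral>\<^sup>+z. indicator {ys 1} z * ennreal ?R \<partial>measure_pmf (jump_pmf x)))"
  proof -
    assume eq: "map (\<lambda>i. (ys i, ss i)) [0..<Suc (Suc k)] = (ys 0, ss 0) # map (\<lambda>i. (ys (Suc i), ss (Suc i))) [0..<Suc k]"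
    have IH: "cyl (map (\<lambda>i. (ys (Suc i), ss (Suc i))) [0..<Suc k]) z = indicator {ys 1} z * ennreal ?R" for z
      using Suc.IH[of "\<lambda>i. ys (Suc i)" "\<lambda>i. ss (Suc i)"] Suc.prems by (simp del: upt_Suc)
    show ?thesis unfolding eq cyl.simps fst_conv snd_conv IH ..
  qed
  also have "(\<integral>\<^sup>+z. indicator {ys 1} z * ennreal ?R \<partial>measure_pmf (jump_pmf x)) = ennreal (pmf (jump_pmf x) (ys 1)) * ennreal ?R"
    by (simp add: nn_integral_multc emeasure_pmf_single)
  also have "indicator {ys 0} x * (ennreal (exp (- hold_rate x * ss 0)) * (ennreal (pmf (jump_pmf x) (ys 1)) * ennreal ?R)) =
     indicator {ys 0} x * ennreal (exp (- exit_rate E q (ys 0) * ss 0) * (jump_prob E q (ys 0) (ys 1) * ?R))"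
    using yE[of 0] yE[of 1] R0 jump_prob_nonneg[of "ys 0" "ys 1"]
    by (cases "x = ys 0") (simp_all add: hold_rate_E pmf_jump_pmf proj_id ennreal_mult[symmetric] del: One_nat_def)
  also have "exp (- exit_rate E q (ys 0) * ss 0) * (jump_prob E q (ys 0) (ys 1) * ?R) =
     (\<Prod>i<Suc k. jump_prob E q (ys i) (ys (Suc i))) * (\<Prod>i\<le>Suc k. exp (- exit_rate E q (ys i) * ss i))"
    unfolding prod.lessThan_Suc_shift prod.atMost_Suc_shift by simp
  finally show ?case .
qed

lemma emeasure_cyl:
  assumes x: "x \<in> E" and l: "\<And>p. p \<in> set l \<Longrightarrow> fst p \<in> E \<and> 0 \<le> snd p"
  shows "emeasure (P x) {\<omega> \<in> space (P x). \<forall>i<length l. Y i \<omega> = fst (l ! i) \<and> S i \<omega> > ennreal (snd (l ! i))} = cyl l x"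
proof (cases l)
  case Nil
  interpret prob_space "P x" by (rule prob_P[OF x])
  show ?thesis using Nil emeasure_space_1 by simp
next
  case (Cons p l')
  interpret prob_space "P x" by (rule prob_P[OF x])
  define k where "k = length l'"
  have len: "length l = Suc k" using Cons by (simp add: k_def)
  define ys where "ys i = fst (l ! i)" for i
  define ss where "ss i = snd (l ! i)" for i
  have ok: "ys i \<in> E \<and> 0 \<le> ss i" if "i \<le> k" for i
    using l[of "l ! i"] that len by (simp add: ys_def ss_def)
  have l_eq: "l = map (\<lambda>i. (ys i, ss i)) [0..<Suc k]"
    unfolding ys_def ss_def using len by (simp add: map_nth flip: len)
  have "emeasure (P x) {\<omega> \<in> space (P x). \<forall>i<length l. Y i \<omega> = fst (l ! i) \<and> S i \<omega> > ennreal (snd (l ! i))} =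
     ennreal (measure (P x) {\<omega> \<in> space (P x). \<forall>i\<le>k. Y i \<omega> = ys i \<and> S i \<omega> > ennreal (ss i)})"
    unfolding emeasure_eq_measure by (simp add: len less_Suc_eq_le ys_def ss_def)
  also have "\<dots> = cyl l x"
  proof -
    have "cyl l x = cyl (map (\<lambda>i. (ys i, ss i)) [0..<Suc k]) x" by (rule arg_cong[where f="\<lambda>l. cyl l x", OF l_eq])
    also have "\<dots> = indicator {ys 0} x * ennreal ((\<Prod>i<k. jump_prob E q (ys i) (ys (Suc i))) * (\<Prod>i\<le>k. exp (- exit_rate E q (ys i) * ss i)))"
      by (rule cyl_eq_prod) (rule ok)
    finally have 1: "cyl l x = \<dots>" .
    have 2: "measure (P x) {\<omega> \<in> space (P x). \<forall>i\<le>k. Y i \<omega> = ys i \<and> S i \<omega> > ennreal (ss i)} =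
     (if ys 0 = x then 1 else 0) * (\<Prod>i<k. jump_prob E q (ys i) (ys (Suc i))) *
     (\<Prod>i\<le>k. exp (- exit_rate E q (ys i) * ss i))"
      by (rule ctmc_law[OF x]) (rule ok)
    show ?thesis unfolding 1 2 by (auto simp: indicator_def)
  qed
  finally show ?thesis .
qed

text \<open>The prescriptions in \<open>ctmc\<close> bound holding times strictly from below, so a
  holding time 0 is seen by none of them. It is excluded by counting mass: extending a cylinder by a
  further state with holding time above 0, and summing over that state, recovers the full
  probability of the cylinder.\<close>

lemma AE_S_pos:
  assumes x: "x \<in> E"
  shows "AE \<omega> in P x. \<forall>i. 0 < S i \<omega>"
proof -
  interpret prob_space "P x" by (rule prob_P[OF x])
  note [measurable] = measurable_Y[OF x] measurable_S[OF x]
  have sum_cyl: "(\<integral>\<^sup>+y. cyl (l @ [(y, 0)]) z \<partial>count_space E) = cyl l z" if z: "z \<in> E" for l z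
    using z
  proof (induction l arbitrary: z)
    case Nil
    then show ?case
      using nn_integral_count_space_indicator_point[OF Nil, of "\<lambda>_. 1"] by simp
  next
    case (Cons p l)
    have "(\<integral>\<^sup>+y. cyl ((p # l) @ [(y, 0)]) z \<partial>count_space E) =
       indicator {fst p} z * (ennreal (exp (- hold_rate z * snd p)) * (\<integral>\<^sup>+y. \<integral>\<^sup>+v. cyl (l @ [(y, 0)]) v \<partial>measure_pmf (jump_pmf z) \<partial>count_space E))"
      by (simp add: nn_integral_cmult)
    also have "(\<integral>\<^sup>+y. \<integral>\<^sup>+v. cyl (l @ [(y, 0)]) v \<partial>measure_pmf (jump_pmf z) \<partial>count_space E) =
        (\<integral>\<^sup>+v. \<integral>\<^sup>+y. cyl (l @ [(y, 0)]) v \<partial>count_space E \<partial>measure_pmf (jump_pmf z))"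
      by (rule nn_integral_count_space_nn_integral[symmetric]) (simp_all add: countable_E)
    also have "\<dots> = (\<integral>\<^sup>+v. cyl l v \<partial>measure_pmf (jump_pmf z))"
      using set_jump_pmf[of z] by (intro nn_integral_cong_AE AE_pmfI Cons.IH) blast
    finally show ?case by simp
  qed
  let ?C = "\<lambda>l. {\<omega> \<in> space (P x). \<forall>i<length l. Y i \<omega> = fst (l ! i) \<and> S i \<omega> > ennreal (snd (l ! i))}"
  have mem: "\<omega> \<in> ?C (l @ [(y, 0)]) \<longleftrightarrow> \<omega> \<in> ?C l \<and> Y (length l) \<omega> = y \<and> 0 < S (length l) \<omega>" for \<omega> l y
    by (simp add: All_less_Suc nth_append conj_ac cong: imp_cong)
  have step: "AE \<omega> in P x. \<omega> \<in> ?C l \<longrightarrow> 0 < S (length l) \<omega>" if l: "\<And>p. p \<in> set l \<Longrightarrow> fst p \<in> E \<and> 0 \<le> snd p" for l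
  proof -
    have "emeasure (P x) (\<Union>y\<in>E. ?C (l @ [(y, 0)])) = (\<integral>\<^sup>+y. emeasure (P x) (?C (l @ [(y, 0)])) \<partial>count_space E)"
    proof (rule emeasure_UN_countable)
      show "?C (l @ [(y, 0)]) \<in> sets (P x)" for y by measurable
      show "disjoint_family_on (\<lambda>y. ?C (l @ [(y, 0)])) E"
      unfolding disjoint_family_on_def
      proof (intro ballI impI equals0I)
        fix y y' \<omega> assume "y \<noteq> y'" "\<omega> \<in> ?C (l @ [(y, 0)]) \<inter> ?C (l @ [(y', 0)])"
        then show False using mem[of \<omega> l y] mem[of \<omega> l y'] by blast
      qed
    qed (rule countable_E)
    also have "\<dots> = (\<integral>\<^sup>+y. cyl (l @ [(y, 0)]) x \<partial>count_space E)"
      by (intro nn_integral_cong emeasure_cyl x) (use l in auto)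
    also have "\<dots> = emeasure (P x) (?C l)" by (simp add: sum_cyl x emeasure_cyl l)
    finally have eq: "emeasure (P x) (\<Union>y\<in>E. ?C (l @ [(y, 0)])) = emeasure (P x) (?C l)" .
    have sub: "(\<Union>y\<in>E. ?C (l @ [(y, 0)])) = {\<omega> \<in> ?C l. 0 < S (length l) \<omega>}"
    proof (intro set_eqI iffI)
      fix \<omega> assume "\<omega> \<in> {\<omega> \<in> ?C l. 0 < S (length l) \<omega>}"
      then have "\<omega> \<in> ?C (l @ [(Y (length l) \<omega>, 0)])" "Y (length l) \<omega> \<in> E"
        using measurable_space[OF measurable_Y[OF x], of \<omega> "length l"] unfolding mem by auto
      then show "\<omega> \<in> (\<Union>y\<in>E. ?C (l @ [(y, 0)]))" by blast
    qed (unfold UN_iff mem, blast)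
    have m: "?C l \<in> sets (P x)" "{\<omega> \<in> ?C l. 0 < S (length l) \<omega>} \<in> sets (P x)" by measurable
    have "emeasure (P x) (?C l - {\<omega> \<in> ?C l. 0 < S (length l) \<omega>}) = 0"
      using eq m unfolding sub by (subst emeasure_Diff) auto
    then show ?thesis
      using m by (intro AE_I[where N="?C l - {\<omega> \<in> ?C l. 0 < S (length l) \<omega>}"]) auto
  qed
  \<comment> \<open>A trajectory with positive holding times before \<open>n\<close> follows one of
    countably many state sequences, each of which gives a cylinder with all bounds 0.\<close>
  have "AE \<omega> in P x. \<forall>i<n. 0 < S i \<omega>" for n
  proof (induction n)
    case (Suc n)
    have "AE \<omega> in P x. \<forall>ys\<in>{ys. length ys = n \<and> set ys \<subseteq> E}. \<omega> \<in> ?C (map (\<lambda>y. (y, 0)) ys) \<longrightarrow> 0 < S n \<omega>"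
    proof (subst AE_ball_countable)
      show "countable {ys. length ys = n \<and> set ys \<subseteq> E}"
        by (rule countable_subset[OF _ countable_lists[OF countable_E]]) auto
      show "\<forall>ys\<in>{ys. length ys = n \<and> set ys \<subseteq> E}. AE \<omega> in P x. \<omega> \<in> ?C (map (\<lambda>y. (y, 0)) ys) \<longrightarrow> 0 < S n \<omega>"
      proof
        fix ys assume ys: "ys \<in> {ys. length ys = n \<and> set ys \<subseteq> E}"
        then show "AE \<omega> in P x. \<omega> \<in> ?C (map (\<lambda>y. (y, 0)) ys) \<longrightarrow> 0 < S n \<omega>"
        proof -
          have "fst p \<in> E \<and> 0 \<le> snd p" if "p \<in> set (map (\<lambda>y. (y, 0::real)) ys)" for p
            using that ys by auto
          then have "AE \<omega> in P x. \<omega> \<in> ?C (map (\<lambda>y. (y, 0)) ys) \<longrightarrow> 0 < S (length (map (\<lambda>y. (y, 0::real)) ys)) \<omega>"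
            by (rule step)
          then show ?thesis using ys by simp
        qed
      qed
    qed
    with Suc show ?case using AE_space
    proof eventually_elim
      case (elim \<omega>)
      have "\<omega> \<in> ?C (map (\<lambda>y. (y, 0)) (map (\<lambda>i. Y i \<omega>) [0..<n]))"
        using elim by simp
      moreover have "map (\<lambda>i. Y i \<omega>) [0..<n] \<in> {ys. length ys = n \<and> set ys \<subseteq> E}"
        using measurable_space[OF measurable_Y[OF x] elim(3)] by auto
      ultimately have "0 < S n \<omega>" using elim(2) by blast
      with elim(1) show ?case by (auto simp: less_Suc_eq)
    qed
  qed simp
  then have "AE \<omega> in P x. \<forall>n. \<forall>i<n. 0 < S i \<omega>" by (simp add: AE_all_countable)
  then show ?thesis by eventually_elim blast
qed

text \<open>The law of the states and holding times from \<open>x\<close>, built from the first holding time and a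
  restart after the first jump.\<close>

definition fs :: "'a \<Rightarrow> ('a \<times> ennreal) stream measure" where
  "fs x = distr (density lborel (expd (hold_rate x)) \<Otimes>\<^sub>M (measure_pmf (jump_pmf x) \<bind> law)) (stream_space St)
     (\<lambda>(s, \<omega>). (x, ennreal s) ## \<omega>)"

lemma law_in_subprob: "law \<in> measurable (measure_pmf p) (subprob_algebra (stream_space St))"
proof -
  have "law y \<in> space (subprob_algebra (stream_space St))" for y
    using prob_law[of y] by (auto simp: space_subprob_algebra intro: prob_space_imp_subprob_space)
  then show ?thesis by simp
qed

lemma prob_mix: "prob_space (measure_pmf (jump_pmf x) \<bind> law)"
proof -
  have "subprob_space (measure_pmf (jump_pmf x) \<bind> law)"
    by (rule subprob_space_bind[OF _ law_in_subprob]) (rule subprob_space_measure_pmf)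
  moreover have "emeasure (measure_pmf (jump_pmf x) \<bind> law) (space (stream_space St)) = 1"
  proof -
    have "emeasure (law y) (space (stream_space St)) = 1" for y
      using prob_space.emeasure_space_1[OF prob_law[of y]] by (simp add: law_def)
    then show ?thesis by (subst emeasure_bind[OF _ law_in_subprob]) simp_all
  qed
  moreover have "space (measure_pmf (jump_pmf x) \<bind> law) = space (stream_space St)"
    by (intro sets_eq_imp_space_eq sets_bind) simp_all
  ultimately show ?thesis by (intro prob_spaceI) simp
qed

lemma sets_mix [measurable_cong]: "sets (measure_pmf (jump_pmf x) \<bind> law) = sets (stream_space St)"
  by (intro sets_bind) simp_all

lemma prob_expd: "prob_space (density lborel (expd (hold_rate x)))"
  by (rule prob_space_exponential_density[OF hold_rate_pos])

lemma measurable_cons [measurable]: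
  assumes "x \<in> E"
  shows "(\<lambda>(s, \<omega>). (x, ennreal s) ## \<omega>) \<in> measurable (borel \<Otimes>\<^sub>M stream_space St) (stream_space St)"
proof -
  have [measurable]: "(\<lambda>_. x) \<in> measurable N (count_space E)" for N :: "'b measure"
    using assms by simp
  show ?thesis by measurable
qed

lemma measurable_cons_fs:
  assumes x: "x \<in> E"
  shows "(\<lambda>(s, \<omega>). (x, ennreal s) ## \<omega>) \<in> measurable
      (density lborel (expd (hold_rate x)) \<Otimes>\<^sub>M (measure_pmf (jump_pmf x) \<bind> law)) (stream_space St)"
  using measurable_cons[OF x] by (simp cong: measurable_cong_sets add: sets_mix cong: sets_pair_measure_cong)

lemma prob_fs:
  assumes x: "x \<in> E"
  shows "prob_space (fs x)"
proof -
  interpret mix: prob_space "measure_pmf (jump_pmf x) \<bind> law" by (rule prob_mix)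
  interpret d: prob_space "density lborel (expd (hold_rate x))" by (rule prob_expd)
  interpret pair_prob_space "density lborel (expd (hold_rate x))" "measure_pmf (jump_pmf x) \<bind> law" ..
  show ?thesis unfolding fs_def by (rule prob_space_distr[OF measurable_cons_fs[OF x]])
qed

lemma nn_integral_fs:
  assumes x: "x \<in> E" and [measurable]: "\<phi> \<in> borel_measurable (stream_space St)"
  shows "(\<integral>\<^sup>+\<omega>. \<phi> \<omega> \<partial>fs x) =
    (\<integral>\<^sup>+s. expd (hold_rate x) s * (\<integral>\<^sup>+y. \<integral>\<^sup>+\<omega>. \<phi> ((x, ennreal s) ## \<omega>) \<partial>law y \<partial>measure_pmf (jump_pmf x)) \<partial>lborel)"
proof -
  note [measurable] = measurable_cons[OF x] borel_measurable_expd
  interpret mix: prob_space "measure_pmf (jump_pmf x) \<bind> law" by (rule prob_mix)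
  note m1 = measurable_cons_fs[OF x]
  have m2: "(\<lambda>(s, \<omega>). \<phi> ((x, ennreal s) ## \<omega>)) \<in> borel_measurable (borel \<Otimes>\<^sub>M stream_space St)"
    using measurable_compose[OF measurable_cons[OF x] assms(2)] by (simp add: case_prod_beta')
  have m3: "(\<lambda>\<omega>. \<phi> ((x, ennreal s) ## \<omega>)) \<in> borel_measurable (stream_space St)" for s
    using measurable_compose[OF measurable_Pair1'[of s borel "stream_space St"] m2] by simp
  have "(\<integral>\<^sup>+\<omega>. \<phi> \<omega> \<partial>fs x) =
     (\<integral>\<^sup>+p. \<phi> ((x, ennreal (fst p)) ## snd p) \<partial>(density lborel (expd (hold_rate x)) \<Otimes>\<^sub>M (measure_pmf (jump_pmf x) \<bind> law)))"
    unfolding fs_def by (subst nn_integral_distr[OF m1]) (simp_all add: case_prod_beta')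
  also have "\<dots> = (\<integral>\<^sup>+s. \<integral>\<^sup>+\<omega>. \<phi> ((x, ennreal s) ## \<omega>) \<partial>(measure_pmf (jump_pmf x) \<bind> law) \<partial>density lborel (expd (hold_rate x)))"
    using m2 by (subst mix.nn_integral_fst[symmetric])
      (simp_all add: case_prod_beta' sets_mix cong: measurable_cong_sets sets_pair_measure_cong)
  also have "\<dots> = (\<integral>\<^sup>+s. \<integral>\<^sup>+y. \<integral>\<^sup>+\<omega>. \<phi> ((x, ennreal s) ## \<omega>) \<partial>law y \<partial>measure_pmf (jump_pmf x) \<partial>density lborel (expd (hold_rate x)))"
    by (subst nn_integral_bind[OF m3 law_in_subprob]) (rule refl)
  also have "\<dots> = (\<integral>\<^sup>+s. expd (hold_rate x) s * (\<integral>\<^sup>+y. \<integral>\<^sup>+\<omega>. \<phi> ((x, ennreal s) ## \<omega>) \<partial>law y \<partial>measure_pmf (jump_pmf x)) \<partial>lborel)"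
  proof (rule nn_integral_density)
    show "(\<lambda>s. \<integral>\<^sup>+y. \<integral>\<^sup>+\<omega>. \<phi> ((x, ennreal s) ## \<omega>) \<partial>law y \<partial>measure_pmf (jump_pmf x)) \<in> borel_measurable lborel"
    proof (rule borel_measurable_nn_integral_pmf)
      fix y
      interpret l: prob_space "law y" by (rule prob_law)
      show "(\<lambda>s. \<integral>\<^sup>+\<omega>. \<phi> ((x, ennreal s) ## \<omega>) \<partial>law y) \<in> borel_measurable lborel"
        using m2 by (intro l.borel_measurable_nn_integral)
          (simp cong: measurable_cong_sets sets_pair_measure_cong)
    qed
  qed (simp add: borel_measurable_expd)
  finally show ?thesis .
qed

text \<open>\<open>{}\<close> makes the family stable under intersections; \<open>UNIV\<close> lets
  countably many members cover the space, as the rays all miss the holding time 0.\<close>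

definition Gen :: "('a \<times> ennreal) set set" where
  "Gen = {A \<times> B | A B. A \<in> insert {} ((\<lambda>y. {y}) ` E) \<and> B \<in> insert UNIV (range greaterThan)}"

lemma Gen_props:
  "Int_stable Gen" "sets St = sets (sigma (space St) Gen)" "Gen \<subseteq> Pow (space St)"
proof -
  have A: "A \<inter> A' \<in> insert {} ((\<lambda>y. {y}) ` E)" if "A \<in> insert {} ((\<lambda>y. {y}) ` E)" "A' \<in> insert {} ((\<lambda>y. {y}) ` E)" for A A'
    using that by auto
  have B: "B \<inter> B' \<in> insert UNIV (range greaterThan)" if "B \<in> insert UNIV (range greaterThan)" "B' \<in> insert UNIV (range greaterThan)" for B B' :: "ennreal set"
  proof -
    have "{c<..} \<inter> {d<..} = {max c d<..}" for c d :: ennreal by auto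
    then show ?thesis using that by auto
  qed
  show "Int_stable Gen"
  proof (rule Int_stableI)
    fix a b assume "a \<in> Gen" "b \<in> Gen"
    then obtain A B A' B' where *: "a = A \<times> B" "b = A' \<times> B'"
      "A \<in> insert {} ((\<lambda>y. {y}) ` E)" "A' \<in> insert {} ((\<lambda>y. {y}) ` E)"
      "B \<in> insert UNIV (range greaterThan)" "B' \<in> insert UNIV (range greaterThan)"
      unfolding Gen_def by blast
    then have "a \<inter> b = (A \<inter> A') \<times> (B \<inter> B')" by auto
    then show "a \<inter> b \<in> Gen" unfolding Gen_def using A[OF *(3,4)] B[OF *(5,6)] by blast
  qed
  show "Gen \<subseteq> Pow (space St)" unfolding Gen_def by (auto simp: space_pair_measure)
  have "sets St = sets (sigma (space (count_space E) \<times> space (borel :: ennreal measure))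
     {a \<times> b | a b. a \<in> insert {} ((\<lambda>y. {y}) ` E) \<and> b \<in> insert UNIV (range greaterThan)})"
  proof (rule sets_pair_eq)
    show "sets (count_space E) = sigma_sets (space (count_space E)) (insert {} ((\<lambda>y. {y}) ` E))"
    proof (intro equalityI subsetI)
      fix A assume "A \<in> sets (count_space E)"
      then have A: "A \<subseteq> E" by simp
      then have "(\<Union>y\<in>A. {y}) \<in> sigma_sets E (insert {} ((\<lambda>y. {y}) ` E))"
        by (intro sigma_sets_UNION) (auto intro: countable_subset[OF A countable_E] sigma_sets.Basic)
      then show "A \<in> sigma_sets (space (count_space E)) (insert {} ((\<lambda>y. {y}) ` E))" by simp
    next
      fix A assume "A \<in> sigma_sets (space (count_space E)) (insert {} ((\<lambda>y. {y}) ` E))"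
      then show "A \<in> sets (count_space E)"
        using sigma_sets_into_sp[of "insert {} ((\<lambda>y. {y}) ` E)" E A] by auto
    qed
    show "sets (borel :: ennreal measure) = sigma_sets (space borel) (insert UNIV (range greaterThan))"
    proof -
      have "sets (borel :: ennreal measure) = sigma_sets UNIV (range greaterThan)"
        by (subst borel_Ioi) simp
      also have "\<dots> = sigma_sets UNIV (insert UNIV (range greaterThan))"
        by (intro sigma_sets_eqI) (auto intro: sigma_sets.Basic sigma_sets_top)
      finally show ?thesis by simp
    qed
    show "countable ((\<lambda>y. {y}) ` E)" using countable_E by simp
    show "countable {UNIV :: ennreal set}" by simp
  qed auto
  then show "sets St = sets (sigma (space St) Gen)"
    unfolding Gen_def by (simp add: space_pair_measure)
qed

definition hits :: "('a \<times> ennreal) set \<Rightarrow> 'a \<Rightarrow> ennreal" where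
  "hits A x = (\<integral>\<^sup>+s. expd (hold_rate x) s * indicator A (x, ennreal s) \<partial>lborel)"

lemma hits_point:
  assumes "c \<ge> 0"
  shows "hits ({y} \<times> {ennreal c<..}) x = indicator {y} x * ennreal (exp (- hold_rate x * c))"
proof -
  have "hits ({y} \<times> {ennreal c<..}) x = (\<integral>\<^sup>+s. indicator {y} x * (expd (hold_rate x) s * indicator {c<..} s) \<partial>lborel)"
    unfolding hits_def
  proof (rule nn_integral_cong)
    fix s show "expd (hold_rate x) s * indicator ({y} \<times> {ennreal c<..}) (x, ennreal s) =
      indicator {y} x * (expd (hold_rate x) s * indicator {c<..} s)"
      using assms by (cases "s < 0") (auto simp: exponential_density_def indicator_def ennreal_less_iff)
  qed
  also have "\<dots> = indicator {y} x * (\<integral>\<^sup>+s. expd (hold_rate x) s * indicator {c<..} s \<partial>lborel)"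
    using borel_measurable_expd[of "hold_rate x"] by (intro nn_integral_cmult) simp
  finally show ?thesis by (simp add: nn_integral_expd_greaterThan[OF hold_rate_pos assms])
qed

lemma hits_UNIV: "hits ({y} \<times> UNIV) x = indicator {y} x"
proof -
  have "hits ({y} \<times> UNIV) x = (\<integral>\<^sup>+s. indicator {y} x * expd (hold_rate x) s \<partial>lborel)"
    unfolding hits_def by (intro nn_integral_cong) (simp add: indicator_def)
  also have "\<dots> = indicator {y} x * (\<integral>\<^sup>+s. expd (hold_rate x) s \<partial>lborel)"
    by (rule nn_integral_cmult) (simp add: borel_measurable_expd)
  finally show ?thesis by (simp add: nn_integral_expd hold_rate_pos)
qed

primrec cylG :: "('a \<times> ennreal) set list \<Rightarrow> 'a \<Rightarrow> ennreal" where
  "cylG [] x = 1"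
| "cylG (A # l) x = hits A x * (\<integral>\<^sup>+z. cylG l z \<partial>measure_pmf (jump_pmf x))"

text \<open>Among positive holding times a nonempty member of \<open>Gen\<close> is a prescription
  as used in \<open>cyl\<close>: \<open>UNIV\<close> counts as the bound 0, and the ray above
  \<open>\<infinity>\<close> is empty.\<close>

lemma Gen_cases:
  assumes "A \<in> Gen"
  obtains "A = {}" | p where "fst p \<in> E" "0 \<le> snd p" "\<And>y s. 0 < s \<Longrightarrow> (y, s) \<in> A \<longleftrightarrow> y = fst p \<and> ennreal (snd p) < s"
    "\<And>x. hits A x = indicator {fst p} x * ennreal (exp (- hold_rate x * snd p))"
proof -
  obtain A' B where *: "A = A' \<times> B" "A' \<in> insert {} ((\<lambda>y. {y}) ` E)" "B \<in> insert UNIV (range greaterThan)"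
    using assms unfolding Gen_def by blast
  show ?thesis
  proof (cases "A = {}")
    case False
    then obtain y where y: "y \<in> E" "A' = {y}" using * by auto
    from *(3) consider "B = UNIV" | c where "B = {c<..}" by auto
    then show ?thesis
    proof cases
      case 1
      show ?thesis by (rule that(2)[of "(y, 0)"]) (auto simp: 1 * y hits_UNIV)
    next
      case (2 c)
      have "c \<noteq> \<infinity>" using False * 2 by auto
      then obtain c' where c: "c = ennreal c'" "0 \<le> c'" by (cases c) auto
      show ?thesis by (rule that(2)[of "(y, c')"]) (auto simp: 2 * y c hits_point)
    qed
  qed (rule that(1))
qed

lemma cylG_empty: "{} \<in> set xs \<Longrightarrow> cylG xs x = 0"
proof (induction xs arbitrary: x)
  case (Cons A xs)
  show ?case
  proof (cases "A = {}")
    case False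
    then have "cylG xs = (\<lambda>_. 0)" using Cons by auto
    then show ?thesis by simp
  qed (simp add: hits_def)
qed simp

text \<open>Off the null event of a vanishing holding time the sets in \<open>xs\<close> can be
  replaced by prescriptions, whose probability is known. An empty member makes both sides 0.\<close>

lemma law_scylinder:
  assumes xs: "xs \<in> lists Gen" and x: "x \<in> E"
  shows "emeasure (law x) (scylinder (space St) xs) = cylG xs x"
proof (cases "{} \<in> set xs")
  case True
  then obtain i where "i < length xs" "xs ! i = {}" by (auto simp: in_set_conv_nth)
  then have "scylinder (space St) xs = {}" unfolding set_eq_iff in_scylinder_iff by blast
  then show ?thesis using cylG_empty[OF True] by simp
next
  case False
  interpret prob_space "P x" by (rule prob_P[OF x])
  note [measurable] = measurable_Y[OF x] measurable_S[OF x]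
  have "\<exists>l. length l = length xs \<and> (\<forall>p\<in>set l. fst p \<in> E \<and> 0 \<le> snd p) \<and>
      (\<forall>i<length xs. \<forall>y s. 0 < s \<longrightarrow> ((y, s) \<in> xs ! i \<longleftrightarrow> y = fst (l ! i) \<and> ennreal (snd (l ! i)) < s)) \<and>
      (\<forall>x. cylG xs x = cyl l x)"
    using xs False
  proof (induction xs)
    case (Cons A xs)
    then obtain l where l: "length l = length xs" "\<forall>p\<in>set l. fst p \<in> E \<and> 0 \<le> snd p"
      "\<forall>i<length xs. \<forall>y s. 0 < s \<longrightarrow> ((y, s) \<in> xs ! i \<longleftrightarrow> y = fst (l ! i) \<and> ennreal (snd (l ! i)) < s)"
      "\<forall>x. cylG xs x = cyl l x" by auto
    from Cons(1) show ?case
    proof (cases rule: Gen_cases)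
      case (2 p)
      show ?thesis
      proof (intro exI[of _ "p # l"] conjI allI impI)
        fix i y s assume "i < length (A # xs)" "(0::ennreal) < s"
        then show "((y, s) \<in> (A # xs) ! i) = (y = fst ((p # l) ! i) \<and> ennreal (snd ((p # l) ! i)) < s)"
          using l(3) 2(3)[of s y] by (cases i) auto
      qed (use 2 l in \<open>auto simp: mult.assoc\<close>)
    qed (use Cons.prems in auto)
  qed simp
  then obtain l where l: "length l = length xs" "\<And>p. p \<in> set l \<Longrightarrow> fst p \<in> E \<and> 0 \<le> snd p"
      "\<And>i y s. i < length xs \<Longrightarrow> 0 < s \<Longrightarrow> ((y, s) \<in> xs ! i \<longleftrightarrow> y = fst (l ! i) \<and> ennreal (snd (l ! i)) < s)"
      "\<And>x. cylG xs x = cyl l x" by blast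
  have Gs: "xs ! i \<in> sets St" if "i < length xs" for i
    using xs that Gen_props(2,3) by (auto simp: in_lists_conv_set)
  have "emeasure (law x) (scylinder (space St) xs) = emeasure (P x) (Z -` scylinder (space St) xs \<inter> space (P x))"
    unfolding law_def proj_id[OF x]
    by (intro emeasure_distr measurable_Z x sets_scylinder) (auto simp: in_set_conv_nth Gs)
  also have Zeq: "Z -` scylinder (space St) xs \<inter> space (P x) = {\<omega> \<in> space (P x). \<forall>i<length xs. (Y i \<omega>, S i \<omega>) \<in> xs ! i}"
    using measurable_space[OF measurable_Y[OF x]]
    by (auto simp: in_scylinder_iff Z_def to_stream_in_streams space_pair_measure)
  also have "emeasure (P x) \<dots> =
      emeasure (P x) {\<omega> \<in> space (P x). \<forall>i<length l. Y i \<omega> = fst (l ! i) \<and> S i \<omega> > ennreal (snd (l ! i))}"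
  proof (rule emeasure_eq_AE)
    show "AE \<omega> in P x. (\<omega> \<in> {\<omega> \<in> space (P x). \<forall>i<length xs. (Y i \<omega>, S i \<omega>) \<in> xs ! i}) =
      (\<omega> \<in> {\<omega> \<in> space (P x). \<forall>i<length l. Y i \<omega> = fst (l ! i) \<and> S i \<omega> > ennreal (snd (l ! i))})"
      using AE_S_pos[OF x] by eventually_elim (simp add: l(1,3))
    show "{\<omega> \<in> space (P x). \<forall>i<length xs. (Y i \<omega>, S i \<omega>) \<in> xs ! i} \<in> sets (P x)"
      unfolding Zeq[symmetric]
      by (intro measurable_sets[OF measurable_Z[OF x]] sets_scylinder) (auto simp: in_set_conv_nth Gs)
    show "{\<omega> \<in> space (P x). \<forall>i<length l. Y i \<omega> = fst (l ! i) \<and> S i \<omega> > ennreal (snd (l ! i))} \<in> sets (P x)"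
      by measurable
  qed
  also have "\<dots> = cyl l x" by (rule emeasure_cyl[OF x]) (rule l(2))
  finally show ?thesis by (simp add: l(4))
qed


text \<open>Both measures give a cylinder over \<open>Gen\<close> the value of the recursion
  \<open>cylG\<close>: \<open>law\<close> by the formula in \<open>ctmc\<close>, \<open>fs\<close>
  because its first holding time is independent of the restarted stream. Stability of
  \<open>Gen\<close> under intersections then yields equality.\<close>

lemma law_eq_fs:
  assumes x: "x \<in> E"
  shows "law x = fs x"
proof (rule stream_space_eq_scylinder[where S=St and G=Gen and C="(\<lambda>y. {y} \<times> UNIV) ` E"])
  show "(\<lambda>y. {y} \<times> UNIV) ` E \<subseteq> Gen" unfolding Gen_def by auto
  show "\<Union> ((\<lambda>y. {y} \<times> UNIV) ` E) = space St" by (auto simp: space_pair_measure)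
  show "sets (fs x) = sets (stream_space St)" by (simp add: fs_def)
  fix xs assume xs: "xs \<noteq> []" "xs \<in> lists Gen"
  then obtain A l where Al: "xs = A # l" "A \<in> Gen" "l \<in> lists Gen" by (cases xs) auto
  have Gs: "B \<in> sets St" if "B \<in> Gen" for B
    using that Gen_props(2,3) by auto
  have m: "scylinder (space St) l \<in> sets (stream_space St)" if "l \<in> lists Gen" for l
    using that by (intro sets_scylinder) (auto intro: Gs)
  have "emeasure (fs x) (scylinder (space St) xs) = (\<integral>\<^sup>+\<omega>. indicator (scylinder (space St) xs) \<omega> \<partial>fs x)"
    using m[OF xs(2)] by (subst nn_integral_indicator) (simp_all add: fs_def)
  also have "\<dots> = (\<integral>\<^sup>+s. expd (hold_rate x) s *
     (\<integral>\<^sup>+y. \<integral>\<^sup>+\<omega>. indicator (scylinder (space St) xs) ((x, ennreal s) ## \<omega>) \<partial>law y \<partial>measure_pmf (jump_pmf x)) \<partial>lborel)"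
    using m[OF xs(2)] by (intro nn_integral_fs x) simp
  also have "\<dots> = (\<integral>\<^sup>+s. expd (hold_rate x) s * indicator A (x, ennreal s) * (\<integral>\<^sup>+y. cylG l y \<partial>measure_pmf (jump_pmf x)) \<partial>lborel)"
  proof (rule nn_integral_cong)
    fix s
    have "(\<integral>\<^sup>+\<omega>. indicator (scylinder (space St) xs) ((x, ennreal s) ## \<omega>) \<partial>law y) =
        indicator A (x, ennreal s) * emeasure (law y) (scylinder (space St) l)" for y
    proof -
      have "(\<integral>\<^sup>+\<omega>. indicator (scylinder (space St) xs) ((x, ennreal s) ## \<omega>) \<partial>law y) =
         (\<integral>\<^sup>+\<omega>. indicator A (x, ennreal s) * indicator (scylinder (space St) l) \<omega> \<partial>law y)"
        using x scylinder_streams[of "space St" l]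
        by (intro nn_integral_cong) (auto simp: Al indicator_def streams_Stream space_pair_measure)
      also have "\<dots> = indicator A (x, ennreal s) * emeasure (law y) (scylinder (space St) l)"
        using m[OF Al(3)] by (subst nn_integral_cmult) (auto intro!: borel_measurable_indicator)
      finally show ?thesis .
    qed
    then have "(\<integral>\<^sup>+y. \<integral>\<^sup>+\<omega>. indicator (scylinder (space St) xs) ((x, ennreal s) ## \<omega>) \<partial>law y \<partial>measure_pmf (jump_pmf x)) =
        indicator A (x, ennreal s) * (\<integral>\<^sup>+y. emeasure (law y) (scylinder (space St) l) \<partial>measure_pmf (jump_pmf x))"
      by (simp add: nn_integral_cmult)
    also have "(\<integral>\<^sup>+y. emeasure (law y) (scylinder (space St) l) \<partial>measure_pmf (jump_pmf x)) = (\<integral>\<^sup>+y. cylG l y \<partial>measure_pmf (jump_pmf x))"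
      using set_jump_pmf[of x] by (intro nn_integral_cong_AE AE_pmfI law_scylinder Al) blast
    finally show "expd (hold_rate x) s * (\<integral>\<^sup>+y. \<integral>\<^sup>+\<omega>. indicator (scylinder (space St) xs) ((x, ennreal s) ## \<omega>) \<partial>law y \<partial>measure_pmf (jump_pmf x)) =
        expd (hold_rate x) s * indicator A (x, ennreal s) * (\<integral>\<^sup>+y. cylG l y \<partial>measure_pmf (jump_pmf x))"
      by (simp add: mult.assoc)
  qed
  also have "\<dots> = cylG xs x"
  proof -
    have [measurable]: "A \<in> sets St" by (rule Gs[OF Al(2)])
    have [measurable]: "(\<lambda>_::real. x) \<in> measurable borel (count_space E)" using x by simp
    have "(\<lambda>s. (x, ennreal s)) \<in> measurable borel St" by measurable
    then have "(\<lambda>s. indicator A (x, ennreal s) :: ennreal) \<in> borel_measurable borel"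
      by (rule measurable_compose) simp
    then show ?thesis
      unfolding Al cylG.simps hits_def using borel_measurable_expd[of "hold_rate x"] by (intro nn_integral_multc) simp
  qed
  finally show "emeasure (law x) (scylinder (space St) xs) = emeasure (fs x) (scylinder (space St) xs)"
    using law_scylinder[OF xs(2) x] by simp
qed (simp_all add: prob_law prob_fs x Gen_props countable_E)

lemma nn_integral_law:
  assumes "x \<in> E" "\<phi> \<in> borel_measurable (stream_space St)"
  shows "(\<integral>\<^sup>+\<omega>. \<phi> \<omega> \<partial>law x) = (\<integral>\<^sup>+\<omega>. \<phi> (Z \<omega>) \<partial>P x)"
  unfolding law_def proj_id[OF assms(1)] using assms by (intro nn_integral_distr measurable_Z) simp_all

lemma first_step:
  assumes x: "x \<in> E" and "\<phi> \<in> borel_measurable (stream_space St)"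
  shows "(\<integral>\<^sup>+\<omega>. \<phi> \<omega> \<partial>law x) =
    (\<integral>\<^sup>+s. expd (hold_rate x) s * (\<integral>\<^sup>+y. \<integral>\<^sup>+\<omega>. \<phi> ((x, ennreal s) ## \<omega>) \<partial>law y \<partial>measure_pmf (jump_pmf x)) \<partial>lborel)"
  unfolding law_eq_fs[OF x] by (rule nn_integral_fs[OF assms])

end

lemma prob_space_countable_pmf:
  assumes "prob_space M" "sets M = Pow E" "countable E"
  shows "\<exists>p. set_pmf p \<subseteq> E \<and> (\<forall>f. (\<integral>\<^sup>+x. f x \<partial>measure_pmf p) = (\<integral>\<^sup>+x. f x \<partial>M))"
proof -
  interpret prob_space M by fact
  have sp: "space M = E" using assms(2) by (metis Pow_top Pow_iff sets.sets_into_space sets.top subset_antisym)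
  define g where "g x = measure M {x} * indicator E x" for x
  have int: "(\<integral>\<^sup>+x. ennreal (g x) * f x \<partial>count_space UNIV) = (\<integral>\<^sup>+x. f x \<partial>M)" for f
  proof -
    have M: "M = density (count_space E) (\<lambda>x. emeasure M {x})"
    proof (rule measure_eqI_countable[of _ E])
      fix a assume "a \<in> E"
      then show "emeasure M {a} = emeasure (density (count_space E) (\<lambda>x. emeasure M {x})) {a}"
        by (subst emeasure_density) (simp_all add: nn_integral_indicator_singleton[of a])
    qed (simp_all add: assms)
    have "(\<integral>\<^sup>+x. f x \<partial>M) = (\<integral>\<^sup>+x. emeasure M {x} * f x \<partial>count_space E)"
      by (subst M, subst nn_integral_density) simp_all
    also have "\<dots> = (\<integral>\<^sup>+x. emeasure M {x} * f x * indicator E x \<partial>count_space UNIV)"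
      by (simp add: nn_integral_count_space_indicator)
    also have "\<dots> = (\<integral>\<^sup>+x. ennreal (g x) * f x \<partial>count_space UNIV)"
      by (intro nn_integral_cong) (simp add: g_def emeasure_eq_measure indicator_def)
    finally show ?thesis by simp
  qed
  have g0: "0 \<le> g x" for x by (simp add: g_def)
  have "(\<integral>\<^sup>+x. ennreal (g x) \<partial>count_space UNIV) = 1"
    using int[of "\<lambda>_. 1"] emeasure_space_1 by simp
  then have pmf: "pmf (embed_pmf g) x = g x" for x by (intro pmf_embed_pmf g0)
  show ?thesis
  proof (intro exI[of _ "embed_pmf g"] conjI allI)
    show "set_pmf (embed_pmf g) \<subseteq> E" by (auto simp: set_pmf_eq pmf g_def indicator_def split: if_splits)
    show "(\<integral>\<^sup>+x. f x \<partial>measure_pmf (embed_pmf g)) = (\<integral>\<^sup>+x. f x \<partial>M)" for f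
      unfolding nn_integral_measure_pmf pmf by (rule int)
  qed
qed

lemma nn_integral_expd_id:
  assumes "l > 0"
  shows "(\<integral>\<^sup>+s. expd l s * ennreal s \<partial>lborel) = ennreal (1 / l)"
proof -
  have "(\<integral>\<^sup>+s. expd l s * ennreal s \<partial>lborel) = (\<integral>\<^sup>+s. ennreal (erlang_density 0 l s * s ^ 1) \<partial>lborel)"
  proof (rule nn_integral_cong)
    fix s show "expd l s * ennreal s = ennreal (erlang_density 0 l s * s ^ 1)"
      using assms by (cases "s < 0") (simp_all add: exponential_density_def ennreal_mult[symmetric])
  qed
  also have "\<dots> = ennreal (1 / l)"
    using nn_integral_erlang_ith_moment[OF assms, of 0 1] by simp
  finally show ?thesis .
qed

section \<open>Trajectories and hitting times as functions of the stream\<close>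

definition pathS :: "('a \<times> ennreal) stream \<Rightarrow> real \<Rightarrow> 'a" where
  "pathS \<omega> t = fst (\<omega> !! (LEAST k. ennreal t < (\<Sum>i\<le>k. snd (\<omega> !! i))))"

text \<open>The restriction to fewer than \<open>k\<close> jumps by time \<open>t\<close> and the
  value 0 at negative \<open>t\<close> match the conventions of
  \<open>semigroup_upto\<close>.\<close>

definition pathf :: "('a \<Rightarrow> ennreal) \<Rightarrow> nat \<Rightarrow> real \<Rightarrow> ('a \<times> ennreal) stream \<Rightarrow> ennreal" where
  "pathf f k t \<omega> = (if 0 \<le> t \<and> ennreal t < (\<Sum>i<k. snd (\<omega> !! i)) then f (pathS \<omega> t) else 0)"

text \<open>If the first holding time outlasts \<open>t\<close>, the second summand is taken at a
  negative time and vanishes. Otherwise the first jump uses up \<open>s\<close> units of time and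
  one unit of the count.\<close>

lemma pathf_Cons:
  assumes s: "0 \<le> s"
  shows "pathf f (Suc k) t ((x, ennreal s) ## \<omega>) = (if 0 \<le> t \<and> t < s then f x else 0) + pathf f k (t - s) \<omega>"
proof -
  let ?\<omega> = "(x, ennreal s) ## \<omega>"
  have sum1: "(\<Sum>i<Suc j. snd (?\<omega> !! i)) = ennreal s + (\<Sum>i<j. snd (\<omega> !! i))" for j
    by (subst sum.lessThan_Suc_shift) simp
  have sum2: "(\<Sum>i\<le>Suc j. snd (?\<omega> !! i)) = ennreal s + (\<Sum>i\<le>j. snd (\<omega> !! i))" for j
    by (subst sum.atMost_Suc_shift) simp
  consider "t < 0" | "0 \<le> t" "t < s" | "s \<le> t" using s by linarith
  then show ?thesis
  proof cases
    case 1
    then show ?thesis using s by (simp add: pathf_def)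
  next
    case 2
    then have "ennreal t < ennreal s" by (simp add: ennreal_less_iff)
    moreover from this have "(LEAST k. ennreal t < (\<Sum>i\<le>k. snd (?\<omega> !! i))) = 0"
      by (intro Least_eq_0) simp
    moreover have "ennreal t < ennreal s + (\<Sum>i<k. snd (\<omega> !! i))"
      using \<open>ennreal t < ennreal s\<close> by (rule order_less_le_trans) simp
    ultimately show ?thesis using 2 unfolding pathf_def sum1 by (simp add: pathS_def)
  next
    case 3
    have t: "ennreal t = ennreal s + ennreal (t - s)"
      using 3 s by (simp add: ennreal_plus[symmetric] del: ennreal_plus)
    have less: "ennreal t < ennreal s + a \<longleftrightarrow> ennreal (t - s) < a" for a
      unfolding t by (simp add: ennreal_add_left_cancel_less)
    show ?thesis
    proof (cases "ennreal (t - s) < (\<Sum>i<k. snd (\<omega> !! i))")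
      case True
      then obtain j where k: "k = Suc j" by (cases k) auto
      \<comment> \<open>The index found on the whole stream is one more than on its tail, since the
        first holding time does not reach past \<open>t\<close>.\<close>
      have "(LEAST k. ennreal t < (\<Sum>i\<le>k. snd (?\<omega> !! i))) =
          Suc (LEAST k. ennreal t < (\<Sum>i\<le>Suc k. snd (?\<omega> !! i)))"
      proof (rule Least_Suc[where n="Suc j"])
        show "ennreal t < (\<Sum>i\<le>Suc j. snd (?\<omega> !! i))"
          unfolding sum2 less using True unfolding k lessThan_Suc_atMost .
        show "\<not> ennreal t < (\<Sum>i\<le>0. snd (?\<omega> !! i))"
          using 3 s by (simp add: ennreal_leI not_less)
      qed
      also have "\<dots> = Suc (LEAST k. ennreal (t - s) < (\<Sum>i\<le>k. snd (\<omega> !! i)))"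
        unfolding sum2 less ..
      finally have "pathS ?\<omega> t = pathS \<omega> (t - s)" unfolding pathS_def by simp
      then show ?thesis using 3 s True unfolding pathf_def sum1 less by simp
    next
      case False
      then show ?thesis using 3 s unfolding pathf_def sum1 less by simp
    qed
  qed
qed

lemma pathf_Suc_le: "pathf f k t \<omega> \<le> pathf f (Suc k) t \<omega>"
proof -
  have "(\<Sum>i<k. snd (\<omega> !! i)) \<le> (\<Sum>i<Suc k. snd (\<omega> !! i))" by simp
  from order_less_le_trans[OF _ this, of "ennreal t"] show ?thesis unfolding pathf_def by auto
qed

lemma SUP_pathf:
  assumes "(\<Sum>k. snd (\<omega> !! k)) = \<infinity>" "0 \<le> t"
  shows "(SUP k. pathf f k t \<omega>) = f (pathS \<omega> t)"
proof (rule antisym)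
  show "(SUP k. pathf f k t \<omega>) \<le> f (pathS \<omega> t)" by (rule SUP_least) (simp add: pathf_def)
  have "ennreal t < (SUP k. \<Sum>i<k. snd (\<omega> !! i))"
    unfolding suminf_eq_SUP[symmetric] assms(1) by simp
  then obtain k where "ennreal t < (\<Sum>i<k. snd (\<omega> !! i))" by (auto simp: less_SUP_iff)
  then have "f (pathS \<omega> t) = pathf f k t \<omega>" using assms(2) by (simp add: pathf_def)
  also have "\<dots> \<le> (SUP k. pathf f k t \<omega>)" by (rule SUP_upper) simp
  finally show "f (pathS \<omega> t) \<le> (SUP k. pathf f k t \<omega>)" .
qed

text \<open>Time before the first visit to \<open>x0\<close>, counted along the first
  \<open>k\<close> holding times; a stream that starts in \<open>x0\<close> has value 0.\<close>

definition taboo_time :: "'a \<Rightarrow> nat \<Rightarrow> ('a \<times> ennreal) stream \<Rightarrow> ennreal" where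
  "taboo_time x0 k \<omega> = (\<Sum>j<k. if \<forall>i<Suc j. fst (\<omega> !! i) \<noteq> x0 then snd (\<omega> !! j) else 0)"

lemma taboo_time_Cons:
  "taboo_time x0 (Suc k) ((x, s) ## \<omega>) = (if x = x0 then 0 else s + taboo_time x0 k \<omega>)"
proof -
  have "(\<forall>i<Suc (Suc j). fst (((x, s) ## \<omega>) !! i) \<noteq> x0) \<longleftrightarrow> x \<noteq> x0 \<and> (\<forall>i<Suc j. fst (\<omega> !! i) \<noteq> x0)" for j
    by (subst All_less_Suc2) simp
  moreover have "(\<forall>i<Suc 0. fst (((x, s) ## \<omega>) !! i) \<noteq> x0) \<longleftrightarrow> x \<noteq> x0"
    unfolding less_Suc0 by simp
  moreover have "snd (((x, s) ## \<omega>) !! 0) = s" "snd (((x, s) ## \<omega>) !! Suc j) = snd (\<omega> !! j)" for j by simp_all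
  ultimately show ?thesis unfolding taboo_time_def sum.lessThan_Suc_shift by (simp only:) simp
qed

context ctmc_process
begin

lemma path_Z: "path Y S t \<omega> = pathS (Z \<omega>) t"
  by (simp add: path_def pathS_def Z_def)

lemma measurable_fst_snth [measurable]: "(\<lambda>\<omega>. fst (\<omega> !! i)) \<in> measurable (stream_space St) (count_space E)"
  and measurable_snd_snth [measurable]: "(\<lambda>\<omega>. snd (\<omega> !! i)) \<in> borel_measurable (stream_space St)"
  by measurable

lemma measurable_pathS:
  "(\<lambda>p. pathS (snd p) (fst p)) \<in> measurable (borel \<Otimes>\<^sub>M stream_space St) (count_space E)"
  unfolding pathS_def
proof (rule measurable_compose_countable)
  show "(\<lambda>p. fst (snd p !! i)) \<in> measurable (borel \<Otimes>\<^sub>M stream_space St) (count_space E)" for i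
    by measurable
  show "(\<lambda>p. LEAST k. ennreal (fst p) < (\<Sum>i\<le>k. snd (snd p !! i))) \<in> borel \<Otimes>\<^sub>M stream_space St \<rightarrow>\<^sub>M count_space UNIV"
    by measurable
qed

lemma measurable_pathS_at: "(\<lambda>\<omega>. pathS \<omega> t) \<in> measurable (stream_space St) (count_space E)"
  using measurable_compose[OF measurable_Pair1'[of t borel "stream_space St"] measurable_pathS] by simp

lemma measurable_path_joint:
  assumes x: "x \<in> E"
  shows "(\<lambda>p. path Y S (fst p) (snd p)) \<in> measurable (borel \<Otimes>\<^sub>M P x) (count_space E)"
proof -
  note [measurable] = measurable_Z[OF x]
  have "(\<lambda>p. (fst p, Z (snd p))) \<in> measurable (borel \<Otimes>\<^sub>M P x) (borel \<Otimes>\<^sub>M stream_space St)" by measurable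
  from measurable_compose[OF this measurable_pathS] show ?thesis by (simp add: path_Z)
qed

lemma measurable_path:
  assumes x: "x \<in> E"
  shows "(\<lambda>\<omega>. path Y S t \<omega>) \<in> measurable (P x) (count_space E)"
  using measurable_compose[OF measurable_Z[OF x] measurable_pathS_at[of t]] by (simp add: path_Z)

lemma measurable_pathf: "pathf f k t \<in> borel_measurable (stream_space St)"
proof -
  have [measurable]: "(\<lambda>\<omega>. f (pathS \<omega> t)) \<in> borel_measurable (stream_space St)"
    by (rule measurable_compose[OF measurable_pathS_at]) simp
  show ?thesis unfolding pathf_def[abs_def] by measurable
qed

text \<open>Decomposition at the first jump turns the recursion of \<open>pathf\<close> on streams
  into \<open>step\<close>, so the two agree by induction on the number of jumps. The term with
  \<open>indicator {t<..}\<close> is the event that the first jump comes after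
  \<open>t\<close>.\<close>

lemma nn_integral_pathf: "x \<in> E \<Longrightarrow> (\<integral>\<^sup>+\<omega>. pathf f k t \<omega> \<partial>law x) = semigroup_upto k f t x"
proof (induction k arbitrary: t x)
  case 0
  then show ?case by (simp add: pathf_def)
next
  case (Suc k)
  let ?c = "\<lambda>s. if 0 \<le> t \<and> t < s then f x else 0"
  have "(\<integral>\<^sup>+\<omega>. pathf f (Suc k) t \<omega> \<partial>law x) =
    (\<integral>\<^sup>+s. expd (hold_rate x) s * (\<integral>\<^sup>+y. \<integral>\<^sup>+\<omega>. pathf f (Suc k) t ((x, ennreal s) ## \<omega>) \<partial>law y \<partial>measure_pmf (jump_pmf x)) \<partial>lborel)"
    by (rule first_step[OF Suc.prems measurable_pathf])
  also have "\<dots> = (\<integral>\<^sup>+s. indicator {0..} t * (f x * (expd (hold_rate x) s * indicator {t<..} s)) +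
      expd (hold_rate x) s * (\<integral>\<^sup>+y. semigroup_upto k f (t - s) y \<partial>measure_pmf (jump_pmf x)) \<partial>lborel)"
  proof (rule nn_integral_cong)
    fix s :: real
    show "expd (hold_rate x) s * (\<integral>\<^sup>+y. \<integral>\<^sup>+\<omega>. pathf f (Suc k) t ((x, ennreal s) ## \<omega>) \<partial>law y \<partial>measure_pmf (jump_pmf x)) =
      indicator {0..} t * (f x * (expd (hold_rate x) s * indicator {t<..} s)) +
      expd (hold_rate x) s * (\<integral>\<^sup>+y. semigroup_upto k f (t - s) y \<partial>measure_pmf (jump_pmf x))"
    proof (cases "s < 0")
      case False
      have "(\<integral>\<^sup>+\<omega>. pathf f (Suc k) t ((x, ennreal s) ## \<omega>) \<partial>law y) = ?c s + semigroup_upto k f (t - s) y" if "y \<in> E" for y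
      proof -
        interpret l: prob_space "law y" by (rule prob_law)
        have "(\<integral>\<^sup>+\<omega>. pathf f (Suc k) t ((x, ennreal s) ## \<omega>) \<partial>law y) = (\<integral>\<^sup>+\<omega>. ?c s + pathf f k (t - s) \<omega> \<partial>law y)"
          using False by (simp add: pathf_Cons)
        also have "\<dots> = ?c s + semigroup_upto k f (t - s) y"
          using measurable_pathf[of f k "t - s"] l.emeasure_space_1
          by (subst nn_integral_add) (simp_all add: Suc.IH[OF that] cong: measurable_cong_sets)
        finally show ?thesis .
      qed
      then have "(\<integral>\<^sup>+y. \<integral>\<^sup>+\<omega>. pathf f (Suc k) t ((x, ennreal s) ## \<omega>) \<partial>law y \<partial>measure_pmf (jump_pmf x)) =
          (\<integral>\<^sup>+y. ?c s + semigroup_upto k f (t - s) y \<partial>measure_pmf (jump_pmf x))"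
        using set_jump_pmf[of x] by (intro nn_integral_cong_AE AE_pmfI) blast
      also have "\<dots> = ?c s + (\<integral>\<^sup>+y. semigroup_upto k f (t - s) y \<partial>measure_pmf (jump_pmf x))"
        by (subst nn_integral_add) simp_all
      finally show ?thesis
        by (cases "0 \<le> t"; cases "t < s") (simp_all add: distrib_left mult.commute)
    qed (simp add: exponential_density_def)
  qed
  also have "\<dots> = (\<integral>\<^sup>+s. indicator {0..} t * (f x * (expd (hold_rate x) s * indicator {t<..} s)) \<partial>lborel) +
      (\<integral>\<^sup>+s. expd (hold_rate x) s * (\<integral>\<^sup>+y. semigroup_upto k f (t - s) y \<partial>measure_pmf (jump_pmf x)) \<partial>lborel)"
    using borel_measurable_expd[of "hold_rate x"] by (intro nn_integral_add) measurable
  also have "(\<integral>\<^sup>+s. indicator {0..} t * (f x * (expd (hold_rate x) s * indicator {t<..} s)) \<partial>lborel) =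
      indicator {0..} t * (f x * (\<integral>\<^sup>+s. expd (hold_rate x) s * indicator {t<..} s \<partial>lborel))"
    using borel_measurable_expd[of "hold_rate x"] by (simp add: nn_integral_cmult)
  also have "\<dots> = indicator {0..} t * (f x * ennreal (exp (- hold_rate x * t)))"
    using nn_integral_expd_greaterThan[OF hold_rate_pos[of x], of t] by (cases "t \<ge> 0") simp_all
  finally show ?case by (simp add: step_def)
qed

lemma measurable_taboo_time [measurable]: "taboo_time x0 k \<in> borel_measurable (stream_space St)"
  unfolding taboo_time_def[abs_def] by measurable

lemma jump_discount_0: "jump_discount 0 x = 1"
  using hold_rate_pos[of x] by (simp add: jump_discount_def)

text \<open>For the constant function 1 and \<open>l = 0\<close> the resolvent killed in
  \<open>x0\<close> is the mean hitting time of \<open>x0\<close>; the first step contributes the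
  mean holding time \<open>1 / hold_rate x\<close>.\<close>

lemma nn_integral_taboo_time: "x \<in> E \<Longrightarrow> (\<integral>\<^sup>+\<omega>. taboo_time x0 k \<omega> \<partial>law x) = resolvent_upto {x0} 0 k (\<lambda>_. 1) x"
proof (induction k arbitrary: x)
  case 0
  then show ?case by (simp add: taboo_time_def)
next
  case (Suc k)
  let ?I = "\<integral>\<^sup>+y. resolvent_upto {x0} 0 k (\<lambda>_. 1) y \<partial>measure_pmf (jump_pmf x)"
  have inner: "(\<integral>\<^sup>+y. \<integral>\<^sup>+\<omega>. taboo_time x0 (Suc k) ((x, ennreal s) ## \<omega>) \<partial>law y \<partial>measure_pmf (jump_pmf x)) =
     indicator (- {x0}) x * (ennreal s + ?I)" for s
  proof -
    have "(\<integral>\<^sup>+\<omega>. taboo_time x0 (Suc k) ((x, ennreal s) ## \<omega>) \<partial>law y) =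
        indicator (- {x0}) x * (ennreal s + resolvent_upto {x0} 0 k (\<lambda>_. 1) y)" if "y \<in> E" for y
    proof -
      interpret l: prob_space "law y" by (rule prob_law)
      have "(\<integral>\<^sup>+\<omega>. ennreal s + taboo_time x0 k \<omega> \<partial>law y) = ennreal s + resolvent_upto {x0} 0 k (\<lambda>_. 1) y"
        using measurable_taboo_time[of x0 k] l.emeasure_space_1
        by (subst nn_integral_add) (simp_all add: Suc.IH[OF that] cong: measurable_cong_sets)
      then show ?thesis by (cases "x = x0") (simp_all add: taboo_time_Cons)
    qed
    then have "(\<integral>\<^sup>+y. \<integral>\<^sup>+\<omega>. taboo_time x0 (Suc k) ((x, ennreal s) ## \<omega>) \<partial>law y \<partial>measure_pmf (jump_pmf x)) =
       (\<integral>\<^sup>+y. indicator (- {x0}) x * (ennreal s + resolvent_upto {x0} 0 k (\<lambda>_. 1) y) \<partial>measure_pmf (jump_pmf x))"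
      using set_jump_pmf[of x] by (intro nn_integral_cong_AE AE_pmfI) blast
    then show ?thesis by (simp add: nn_integral_cmult nn_integral_add)
  qed
  have "(\<integral>\<^sup>+\<omega>. taboo_time x0 (Suc k) \<omega> \<partial>law x) =
    (\<integral>\<^sup>+s. expd (hold_rate x) s * (indicator (- {x0}) x * (ennreal s + ?I)) \<partial>lborel)"
    by (subst first_step[OF Suc.prems measurable_taboo_time]) (simp only: inner)
  also have "\<dots> = (\<integral>\<^sup>+s. indicator (- {x0}) x * (expd (hold_rate x) s * ennreal s + ?I * expd (hold_rate x) s) \<partial>lborel)"
    by (intro nn_integral_cong) (simp add: distrib_left ac_simps)
  also have "\<dots> = indicator (- {x0}) x * (ennreal (1 / hold_rate x) + ?I)"
    using borel_measurable_expd[of "hold_rate x"]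
    by (simp add: nn_integral_cmult nn_integral_add nn_integral_expd_id nn_integral_expd hold_rate_pos)
  finally show ?case by (simp add: resolvent_step_def jump_discount_0)
qed

lemma cycle_sum_eq_taboo_time:
  assumes x0: "x0 \<in> E"
  shows "cycle_sum x0 0 (\<lambda>_. 1) = (\<integral>\<^sup>+\<omega>. S 0 \<omega> + (SUP k. taboo_time x0 k (stl (Z \<omega>))) \<partial>P x0)"
proof -
  have m: "(\<lambda>\<omega>. snd (\<omega> !! 0) + (SUP k. taboo_time x0 k (stl \<omega>))) \<in> borel_measurable (stream_space St)"
    using measurable_compose[OF measurable_stl measurable_taboo_time] by measurable
  have SUP: "(\<integral>\<^sup>+\<omega>. (SUP k. taboo_time x0 k \<omega>) \<partial>law y) = resolvent {x0} 0 (\<lambda>_. 1) y" if "y \<in> E" for y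
  proof -
    have inc: "incseq (taboo_time x0)"
      by (rule incseq_SucI) (simp add: le_fun_def taboo_time_def)
    show ?thesis
      unfolding resolvent_def nn_integral_taboo_time[OF that, symmetric]
      using measurable_taboo_time[of x0]
      by (intro nn_integral_monotone_convergence_SUP inc) (simp cong: measurable_cong_sets)
  qed
  let ?I = "\<integral>\<^sup>+y. resolvent {x0} 0 (\<lambda>_. 1) y \<partial>measure_pmf (jump_pmf x0)"
  have inner: "(\<integral>\<^sup>+y. \<integral>\<^sup>+\<omega>. snd (((x0, ennreal s) ## \<omega>) !! 0) + (SUP k. taboo_time x0 k (stl ((x0, ennreal s) ## \<omega>))) \<partial>law y \<partial>measure_pmf (jump_pmf x0)) =
     ennreal s + ?I" for s
  proof -
    have "(\<integral>\<^sup>+\<omega>. ennreal s + (SUP k. taboo_time x0 k \<omega>) \<partial>law y) = ennreal s + resolvent {x0} 0 (\<lambda>_. 1) y" if "y \<in> E" for y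
    proof -
      interpret l: prob_space "law y" by (rule prob_law)
      have [measurable]: "taboo_time x0 k \<in> borel_measurable (law y)" for k
        using measurable_taboo_time[of x0 k] by (simp cong: measurable_cong_sets)
      show ?thesis
        using l.emeasure_space_1 by (subst nn_integral_add) (simp_all add: SUP[OF that])
    qed
    then have "(\<integral>\<^sup>+y. \<integral>\<^sup>+\<omega>. ennreal s + (SUP k. taboo_time x0 k \<omega>) \<partial>law y \<partial>measure_pmf (jump_pmf x0)) =
       (\<integral>\<^sup>+y. ennreal s + resolvent {x0} 0 (\<lambda>_. 1) y \<partial>measure_pmf (jump_pmf x0))"
      using set_jump_pmf[of x0] by (intro nn_integral_cong_AE AE_pmfI) blast
    then show ?thesis by (simp add: nn_integral_add)
  qed
  have "(\<integral>\<^sup>+\<omega>. S 0 \<omega> + (SUP k. taboo_time x0 k (stl (Z \<omega>))) \<partial>P x0) =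
      (\<integral>\<^sup>+\<omega>. snd (\<omega> !! 0) + (SUP k. taboo_time x0 k (stl \<omega>)) \<partial>law x0)"
    by (subst nn_integral_law[OF x0 m]) (simp add: Z_def del: snth.simps)
  also have "\<dots> = (\<integral>\<^sup>+s. expd (hold_rate x0) s * (ennreal s + ?I) \<partial>lborel)"
    by (subst first_step[OF x0 m]) (simp only: inner)
  also have "\<dots> = (\<integral>\<^sup>+s. expd (hold_rate x0) s * ennreal s + ?I * expd (hold_rate x0) s \<partial>lborel)"
    by (intro nn_integral_cong) (simp add: distrib_left ac_simps)
  also have "\<dots> = ennreal (1 / hold_rate x0) + ?I"
    using borel_measurable_expd[of "hold_rate x0"]
    by (simp add: nn_integral_cmult nn_integral_add nn_integral_expd_id nn_integral_expd hold_rate_pos)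
  finally show ?thesis by (simp add: cycle_sum_def resolvent_step_def jump_discount_0)
qed

end

locale ctmc_nonexplosive = ctmc_process +
  assumes nonexplosive: "nonexplosive E P S"
begin

section \<open>Transition laws and return times of a nonexplosive chain\<close>

lemma AE_nonexplosive: "x \<in> E \<Longrightarrow> AE \<omega> in P x. (\<Sum>k. S k \<omega>) = \<infinity>"
  using nonexplosive unfolding nonexplosive_def by simp

text \<open>Nonexplosion means that almost surely finitely many holding times suffice to pass
  \<open>t\<close>, so the restriction on the number of jumps disappears in the supremum.\<close>

lemma semigroup_eq_expectation:
  assumes x: "x \<in> E" and t: "0 \<le> t"
  shows "semigroup f t x = (\<integral>\<^sup>+\<omega>. f (path Y S t \<omega>) \<partial>P x)"
proof -
  have mp: "(\<lambda>\<omega>. pathf f k t (Z \<omega>)) \<in> borel_measurable (P x)" for k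
    by (rule measurable_compose[OF measurable_Z[OF x] measurable_pathf])
  have "semigroup f t x = (SUP k. \<integral>\<^sup>+\<omega>. pathf f k t (Z \<omega>) \<partial>P x)"
    unfolding semigroup_def nn_integral_pathf[OF x, symmetric] nn_integral_law[OF x measurable_pathf] ..
  also have "\<dots> = (\<integral>\<^sup>+\<omega>. (SUP k. pathf f k t (Z \<omega>)) \<partial>P x)"
    by (rule nn_integral_monotone_convergence_SUP[symmetric])
       (auto intro!: incseq_SucI pathf_Suc_le mp simp: le_fun_def)
  also have "\<dots> = (\<integral>\<^sup>+\<omega>. f (path Y S t \<omega>) \<partial>P x)"
  proof (rule nn_integral_cong_AE)
    show "AE \<omega> in P x. (SUP k. pathf f k t (Z \<omega>)) = f (path Y S t \<omega>)"
      using AE_nonexplosive[OF x]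
    proof eventually_elim
      case (elim \<omega>)
      then show ?case unfolding path_Z by (intro SUP_pathf t) (simp add: Z_def)
    qed
  qed
  finally show ?thesis .
qed

text \<open>States outside \<open>E\<close> have the rates of their projection, which extends
  conservativity to the whole type. The statement is confined to the constant function because
  \<open>f x\<close> itself is not projected.\<close>

lemma semigroup_proj_1: "semigroup_upto k (\<lambda>_. 1) t x = semigroup_upto k (\<lambda>_. 1) t (proj x)"
proof -
  have "hold_rate (proj x) = hold_rate x" "jump_pmf (proj x) = jump_pmf x"
    unfolding hold_rate_def jump_pmf_def proj_id[OF proj_E] by (rule refl)+
  then show ?thesis by (cases k) (simp_all add: step_def)
qed

sublocale conservative_jump_process hold_rate jump_pmf
proof
  fix t :: real and x assume t: "0 \<le> t"
  interpret p: prob_space "P (proj x)" by (rule prob_P[OF proj_E])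
  have "semigroup (\<lambda>_. 1) t x = semigroup (\<lambda>_. 1) t (proj x)" unfolding semigroup_def by (subst semigroup_proj_1) (rule refl)
  also have "\<dots> = 1" by (simp add: semigroup_eq_expectation[OF proj_E t] p.emeasure_space_1)
  finally show "semigroup (\<lambda>_. 1) t x = 1" .
qed

text \<open>If the chain is in \<open>x0\<close> at a time \<open>t\<close> at or after the first
  jump, its state at \<open>t\<close> has an index \<open>K > 0\<close>. The taboo sum stops before
  \<open>K\<close>, and the holding times before \<open>K\<close> add up to at most
  \<open>t\<close>.\<close>

lemma taboo_time_le_return_time:
  assumes inf: "(\<Sum>k. S k \<omega>) = \<infinity>"
  shows "S 0 \<omega> + (SUP k. taboo_time x0 k (stl (Z \<omega>))) \<le> return_time Y S x0 \<omega>"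
  unfolding return_time_def
proof (rule Inf_greatest, safe)
  fix t :: real assume t: "0 \<le> t" "S 0 \<omega> \<le> ennreal t" "x0 = path Y S t \<omega>"
  define K where "K = (LEAST k. ennreal t < (\<Sum>i\<le>k. S i \<omega>))"
  have "ennreal t < (SUP k. \<Sum>i<k. S i \<omega>)" unfolding suminf_eq_SUP[symmetric] inf by simp
  then obtain k where k: "ennreal t < (\<Sum>i<k. S i \<omega>)" by (auto simp: less_SUP_iff)
  have "K \<noteq> 0"
  proof
    assume "K = 0"
    have "ennreal t < (\<Sum>i\<le>k. S i \<omega>)"
      using k by (rule order_less_le_trans) (intro sum_mono2, auto)
    then have "ennreal t < (\<Sum>i\<le>K. S i \<omega>)" unfolding K_def by (rule LeastI)
    then show False using t(2) \<open>K = 0\<close> by simp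
  qed
  then obtain j where K: "K = Suc j" by (cases K) auto
  have YK: "Y K \<omega> = x0" using t(3) by (simp add: path_def K_def)
  have "\<not> ennreal t < (\<Sum>i\<le>j. S i \<omega>)"
    using not_less_Least[of j "\<lambda>k. ennreal t < (\<Sum>i\<le>k. S i \<omega>)"] K unfolding K_def[symmetric] by simp
  then have le: "(\<Sum>i\<le>j. S i \<omega>) \<le> ennreal t" by simp
  have "taboo_time x0 n (stl (Z \<omega>)) \<le> (\<Sum>i<j. S (Suc i) \<omega>)" for n
  proof -
    have Z: "stl (Z \<omega>) !! i = (Y (Suc i) \<omega>, S (Suc i) \<omega>)" for i
      unfolding snth.simps(2)[symmetric] by (simp add: Z_def del: snth.simps)
    have "taboo_time x0 n (stl (Z \<omega>)) \<le> (\<Sum>i<n. if i < j then S (Suc i) \<omega> else 0)"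
      unfolding taboo_time_def Z
    proof (rule sum_mono)
      fix i
      show "(if \<forall>i'<Suc i. fst (Y (Suc i') \<omega>, S (Suc i') \<omega>) \<noteq> x0 then snd (Y (Suc i) \<omega>, S (Suc i) \<omega>) else 0)
        \<le> (if i < j then S (Suc i) \<omega> else 0)"
        using YK K by (auto dest: spec[of _ j])
    qed
    also have "\<dots> = (\<Sum>i\<in>{..<n} \<inter> {..<j}. S (Suc i) \<omega>)"
      by (subst sum.inter_restrict) (simp_all add: lessThan_def)
    also have "\<dots> \<le> (\<Sum>i<j. S (Suc i) \<omega>)"
      by (intro sum_mono2) auto
    finally show ?thesis .
  qed
  then have "S 0 \<omega> + (SUP k. taboo_time x0 k (stl (Z \<omega>))) \<le> S 0 \<omega> + (\<Sum>i<j. S (Suc i) \<omega>)"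
    by (intro add_left_mono SUP_least)
  also have "\<dots> = (\<Sum>i\<le>j. S i \<omega>)"
    unfolding lessThan_Suc_atMost[symmetric] by (subst sum.lessThan_Suc_shift) simp
  also note le
  finally show "S 0 \<omega> + (SUP k. taboo_time (path Y S t \<omega>) k (stl (Z \<omega>))) \<le> ennreal t" using t(3) by simp
qed

lemma cycle_sum_finite:
  assumes "positive_recurrent E q P Y S" and x0: "x0 \<in> E"
  shows "cycle_sum x0 0 (\<lambda>_. 1) < \<infinity>"
proof -
  have "cycle_sum x0 0 (\<lambda>_. 1) \<le> (\<integral>\<^sup>+\<omega>. return_time Y S x0 \<omega> \<partial>P x0)"
    unfolding cycle_sum_eq_taboo_time[OF x0]
  proof (rule nn_integral_mono_AE)
    show "AE \<omega> in P x0. S 0 \<omega> + (SUP k. taboo_time x0 k (stl (Z \<omega>))) \<le> return_time Y S x0 \<omega>"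
      using AE_nonexplosive[OF x0] by eventually_elim (rule taboo_time_le_return_time)
  qed
  also have "\<dots> < \<infinity>"
    using assms exit_pos[OF x0] unfolding positive_recurrent_def by auto
  finally show ?thesis .
qed

text \<open>Induction along a sequence of positive rates: half of the time is given to the last jump
  and half to the sequence before it, and the semigroup property joins the two.\<close>

lemma semigroup_pos_irreducible:
  assumes irr: "irreducible_rates E q" and x: "x \<in> E" and y: "y \<in> E" and t: "t > 0"
  shows "0 < semigroup (indicator {y}) t x"
proof -
  have "(x, y) \<in> {(u, v). u \<in> E \<and> v \<in> E \<and> u \<noteq> v \<and> q u v > 0}\<^sup>*"
    using irr x y unfolding irreducible_rates_def by blast
  then show ?thesis using t
  proof (induction arbitrary: t rule: rtrancl_induct)
    case base
    then show ?case by (intro semigroup_pos) simp_all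
  next
    case (step y z)
    then have yz: "y \<in> E" "z \<in> E" "y \<noteq> z" "q y z > 0" by auto
    have t2: "t / 2 > 0" using step.prems by simp
    have "z \<in> set_pmf (jump_pmf y)"
      using yz exit_pos[OF yz(1)] by (simp add: set_pmf_iff pmf_jump_pmf proj_id jump_prob_def)
    then have c: "0 < semigroup (indicator {z}) (t / 2) y" by (rule semigroup_pos_jump[OF t2]) (simp add: indicator_def)
    have "0 < semigroup (indicator {z}) (t / 2) y * semigroup (indicator {y}) (t / 2) x"
      using c step.IH[OF t2] by (simp add: ennreal_zero_less_mult_iff)
    also have "\<dots> = semigroup (\<lambda>u. semigroup (indicator {z}) (t / 2) y * indicator {y} u) (t / 2) x"
      by (rule semigroup_cmult[symmetric])
    also have "\<dots> \<le> semigroup (semigroup (indicator {z}) (t / 2)) (t / 2) x"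
      by (rule semigroup_mono) (simp add: indicator_def)
    also have "\<dots> = semigroup (indicator {z}) (t / 2 + t / 2) x"
      using t2 by (intro semigroup_compose) (simp_all add: indicator_def)
    finally show ?case by simp
  qed
qed

text \<open>Transition laws and invariant law as pmfs, the form in which the total variation
  argument takes them. \<open>p t x\<close> is the law of the path at time \<open>t\<close>; its
  identification with the minimal semigroup on \<open>E\<close> supplies Chapman-Kolmogorov,
  positivity and invariance.\<close>

lemma ex_semigroup_pmf:
  assumes irr: "irreducible_rates E q" and rec: "positive_recurrent E q P Y S"
  shows "\<exists>p \<pi>. (\<forall>t\<ge>0. \<forall>x\<in>E. set_pmf (p t x) \<subseteq> E \<and>
      (\<forall>f. (\<integral>\<^sup>+y. f y \<partial>measure_pmf (p t x)) = (\<integral>\<^sup>+\<omega>. f (path Y S t \<omega>) \<partial>P x))) \<and>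
    (\<forall>s\<ge>0. \<forall>t\<ge>0. \<forall>x\<in>E. p (s + t) x = bind_pmf (p s x) (p t)) \<and>
    (\<forall>t>0. \<forall>x\<in>E. set_pmf (p t x) = E) \<and>
    set_pmf \<pi> \<subseteq> E \<and> (\<forall>t\<ge>0. bind_pmf \<pi> (p t) = \<pi>)"
proof -
  have "\<exists>p. set_pmf p \<subseteq> E \<and> (\<forall>f. (\<integral>\<^sup>+y. f y \<partial>measure_pmf p) = (\<integral>\<^sup>+\<omega>. f (path Y S t \<omega>) \<partial>P x))" if x: "x \<in> E" for t x
  proof -
    have "prob_space (distr (P x) (count_space E) (path Y S t))"
      by (rule prob_space.prob_space_distr[OF prob_P[OF x] measurable_path[OF x]])
    from prob_space_countable_pmf[OF this _ countable_E] obtain p where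
      "set_pmf p \<subseteq> E" "\<And>f. (\<integral>\<^sup>+y. f y \<partial>measure_pmf p) = (\<integral>\<^sup>+y. f y \<partial>distr (P x) (count_space E) (path Y S t))"
      by auto
    then show ?thesis by (intro exI[of _ p]) (simp add: nn_integral_distr[OF measurable_path[OF x]])
  qed
  note ex = this
  define p where "p t x = (SOME p. set_pmf p \<subseteq> E \<and> (\<forall>f. (\<integral>\<^sup>+y. f y \<partial>measure_pmf p) = (\<integral>\<^sup>+\<omega>. f (path Y S t \<omega>) \<partial>P x)))" for t x
  have p: "set_pmf (p t x) \<subseteq> E" "(\<integral>\<^sup>+y. f y \<partial>measure_pmf (p t x)) = (\<integral>\<^sup>+\<omega>. f (path Y S t \<omega>) \<partial>P x)"
    if "x \<in> E" for t x f
    using someI_ex[OF ex[OF that, of t]] unfolding p_def by blast+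
  have psg: "(\<integral>\<^sup>+y. f y \<partial>measure_pmf (p t x)) = semigroup f t x" if "x \<in> E" "0 \<le> t" for f t x
    using that by (simp add: p semigroup_eq_expectation)
  have pmf_semigroup: "ennreal (pmf (p t x) y) = semigroup (indicator {y}) t x" if "x \<in> E" "0 \<le> t" for t x y
    using psg[OF that, of "indicator {y}"] by (simp add: emeasure_pmf_single)
  have ind1: "indicator A z \<le> (1::ennreal)" for A and z :: 'a by (simp add: indicator_def)
  have ck: "p (s + t) x = bind_pmf (p s x) (p t)" if "0 \<le> s" "0 \<le> t" "x \<in> E" for s t x
  proof (rule pmf_eqI)
    fix y
    have "ennreal (pmf (bind_pmf (p s x) (p t)) y) = (\<integral>\<^sup>+z. semigroup (indicator {y}) t z \<partial>measure_pmf (p s x))"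
      unfolding ennreal_pmf_bind
      using p(1)[OF that(3), of s] that by (intro nn_integral_cong_AE AE_pmfI pmf_semigroup) auto
    also have "\<dots> = semigroup (indicator {y}) (s + t) x"
      using that by (simp add: psg semigroup_compose ind1)
    also have "\<dots> = ennreal (pmf (p (s + t) x) y)" using that by (simp add: pmf_semigroup)
    finally show "pmf (p (s + t) x) y = pmf (bind_pmf (p s x) (p t)) y" by simp
  qed
  have supp: "set_pmf (p t x) = E" if "0 < t" "x \<in> E" for t x
  proof
    show "E \<subseteq> set_pmf (p t x)"
    proof
      fix y assume "y \<in> E"
      then have "0 < ennreal (pmf (p t x) y)"
        using that semigroup_pos_irreducible[OF irr that(2), of y t] by (simp add: pmf_semigroup)
      then show "y \<in> set_pmf (p t x)" by (simp add: pmf_positive_iff)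
    qed
  qed (rule p(1)[OF that(2)])
  obtain x0 where x0: "x0 \<in> E" using E_ne by blast
  have "\<exists>\<pi>. set_pmf \<pi> \<subseteq> E \<and>
    (\<forall>h\<ge>0. \<forall>f. (\<forall>x. f x \<le> 1) \<longrightarrow> (\<integral>\<^sup>+x. semigroup f h x \<partial>measure_pmf \<pi>) = (\<integral>\<^sup>+x. f x \<partial>measure_pmf \<pi>))"
    by (rule ex_invariant_pmf[OF countable_E set_jump_pmf x0 cycle_sum_finite[OF rec x0]])
  then obtain \<pi> where \<pi>0: "set_pmf \<pi> \<subseteq> E \<and>
    (\<forall>h\<ge>0. \<forall>f. (\<forall>x. f x \<le> 1) \<longrightarrow> (\<integral>\<^sup>+x. semigroup f h x \<partial>measure_pmf \<pi>) = (\<integral>\<^sup>+x. f x \<partial>measure_pmf \<pi>))"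
    by (rule exE)
  then have \<pi>: "set_pmf \<pi> \<subseteq> E"
      "\<And>h f. 0 \<le> h \<Longrightarrow> (\<And>x. f x \<le> 1) \<Longrightarrow> (\<integral>\<^sup>+x. semigroup f h x \<partial>measure_pmf \<pi>) = (\<integral>\<^sup>+x. f x \<partial>measure_pmf \<pi>)"
    by simp_all
  have inv: "bind_pmf \<pi> (p t) = \<pi>" if "0 \<le> t" for t
  proof (rule pmf_eqI)
    fix y
    have "ennreal (pmf (bind_pmf \<pi> (p t)) y) = (\<integral>\<^sup>+z. semigroup (indicator {y}) t z \<partial>measure_pmf \<pi>)"
      unfolding ennreal_pmf_bind
      using \<pi>(1) that by (intro nn_integral_cong_AE AE_pmfI pmf_semigroup) auto
    also have "\<dots> = ennreal (pmf \<pi> y)"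
      using \<pi>(2)[OF that, of "indicator {y}"] by (simp add: ind1 emeasure_pmf_single)
    finally show "pmf (bind_pmf \<pi> (p t)) y = pmf \<pi> y" by simp
  qed
  show ?thesis
  proof (intro exI[of _ p] exI[of _ \<pi>] conjI allI impI ballI)
  qed (simp_all add: p ck supp \<pi>(1) inv)
qed

end

section \<open>The generator of the scaled chain\<close>

lemma frechet_derivative_eq_partial:
  fixes f :: "real^'d::finite \<Rightarrow> real"
  assumes "f differentiable (at x)"
  shows "frechet_derivative f (at x) h = (\<Sum>i\<in>UNIV. h $ i * partial_deriv i f x)"
proof -
  have lin: "linear (frechet_derivative f (at x))"
    using assms by (rule linear_frechet_derivative)
  have "h = (\<Sum>i\<in>UNIV. (h $ i) *\<^sub>R axis i 1)"
    using basis_expansion[of h] by (simp add: scalar_mult_eq_scaleR)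
  then have "frechet_derivative f (at x) h = frechet_derivative f (at x) (\<Sum>i\<in>UNIV. (h $ i) *\<^sub>R axis i 1)"
    by (rule arg_cong)
  also have "\<dots> = (\<Sum>i\<in>UNIV. h $ i * partial_deriv i f x)"
    by (simp add: linear_sum[OF lin] linear_cmul[OF lin] partial_deriv_def)
  finally show ?thesis .
qed

lemma DERIV_line:
  fixes f :: "real^'d::finite \<Rightarrow> real"
  assumes "\<And>x. f differentiable (at x)"
  shows "((\<lambda>s. f (x + s *\<^sub>R h)) has_real_derivative (\<Sum>i\<in>UNIV. h $ i * partial_deriv i f (x + s *\<^sub>R h))) (at s)"
proof -
  have 1: "((\<lambda>s. x + s *\<^sub>R h) has_derivative (\<lambda>v. v *\<^sub>R h)) (at s)"
    by (auto intro!: derivative_eq_intros)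
  have 2: "(f has_derivative frechet_derivative f (at (x + s *\<^sub>R h))) (at (x + s *\<^sub>R h))"
    using assms frechet_derivative_works by blast
  have 3: "((\<lambda>s. f (x + s *\<^sub>R h)) has_derivative (\<lambda>v. frechet_derivative f (at (x + s *\<^sub>R h)) (v *\<^sub>R h))) (at s)"
    by (rule has_derivative_compose[OF 1 2])
  have 4: "frechet_derivative f (at (x + s *\<^sub>R h)) (v *\<^sub>R h) =
      (\<Sum>i\<in>UNIV. h $ i * partial_deriv i f (x + s *\<^sub>R h)) * v" for v
    by (simp add: frechet_derivative_eq_partial assms sum_distrib_left ac_simps)
  show ?thesis using 3 unfolding has_field_derivative_def 4 .
qed

text \<open>Pairing with this rank-one matrix in the Frobenius inner product gives the quadratic
  form in \<open>h\<close>. Second moments of jumps become sums of matrices, and Cauchy-Schwarz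
  applies to them.\<close>

definition outer :: "real^'d::finite \<Rightarrow> real^'d^'d" where
  "outer h = (\<chi> i j. h $ i * h $ j)"

lemma inner_outer: "A \<bullet> outer h = (\<Sum>i\<in>UNIV. \<Sum>j\<in>UNIV. A $ i $ j * (h $ i * h $ j))"
  by (simp add: outer_def inner_vec_def)

lemma norm_outer: "norm (outer h) = (norm h)\<^sup>2"
proof -
  have "(norm (outer h))\<^sup>2 = outer h \<bullet> outer h" by (simp add: power2_norm_eq_inner)
  also have "\<dots> = (\<Sum>i\<in>UNIV. \<Sum>j\<in>UNIV. (h $ i * h $ i) * (h $ j * h $ j))"
    unfolding inner_outer by (simp add: outer_def ac_simps)
  also have "\<dots> = (h \<bullet> h) * (h \<bullet> h)"
    by (simp add: sum_product[symmetric] inner_vec_def)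
  also have "\<dots> = ((norm h)\<^sup>2)\<^sup>2"
    by (simp only: power2_norm_eq_inner power2_eq_square[of "h \<bullet> h"])
  finally show ?thesis by (rule power2_eq_imp_eq) simp_all
qed

lemma hess_lipD:
  assumes fin: "hess_lip f x \<rho> \<le> ennreal L" and L: "0 \<le> L" and y: "y \<in> ball x \<rho>" and z: "z \<in> ball x \<rho>"
  shows "norm (hess f y - hess f z) \<le> L * norm (y - z)"
proof (cases "y = z")
  case False
  have "ennreal (norm (hess f y - hess f z) / norm (y - z)) \<le> hess_lip f x \<rho>"
    unfolding hess_lip_def by (rule SUP_upper2[OF y], rule SUP_upper[OF z])
  also note fin
  finally have "norm (hess f y - hess f z) / norm (y - z) \<le> L" using L by simp
  then show ?thesis using False by (simp add: divide_le_eq)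
qed simp

text \<open>The Lagrange remainder evaluates the Hessian at an intermediate point, whose distance to
  \<open>x\<close> is below \<open>\<rho>\<close>; replacing it by the Hessian at \<open>x\<close>
  costs at most \<open>L * \<rho>\<close>. Keeping the radius in place of a third power of
  \<open>norm h\<close> leaves an error that involves only second moments of the jumps.\<close>

lemma Taylor_C2:
  fixes V :: "real^'d::finite \<Rightarrow> real"
  assumes C2: "C2 V" and L: "hess_lip V x \<rho> \<le> ennreal L" "0 \<le> L" and h: "norm h \<le> \<rho>"
  shows "V (x + h) \<le> V x + grad V x \<bullet> h + 1/2 * (hess V x \<bullet> outer h) + 1/2 * (L * \<rho> * (norm h)\<^sup>2)"
proof (cases "h = 0")
  case True
  then show ?thesis by (simp add: inner_outer)
next
  case False
  then have h0: "0 < norm h" by simp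
  have d1: "V differentiable (at y)" and d2: "partial_deriv i V differentiable (at y)" for i y
    using C2 unfolding C2_def by auto
  define diff where "diff m s = (if m = 0 then V (x + s *\<^sub>R h)
     else if m = 1 then (\<Sum>i\<in>UNIV. h $ i * partial_deriv i V (x + s *\<^sub>R h))
     else hess V (x + s *\<^sub>R h) \<bullet> outer h)" for m :: nat and s
  have D0: "(diff 0 has_real_derivative diff 1 s) (at s)" for s
    using DERIV_line[OF d1, of x h s] by (simp add: diff_def[abs_def])
  have D1: "(diff 1 has_real_derivative diff 2 s) (at s)" for s
  proof -
    have "((\<lambda>s. \<Sum>i\<in>UNIV. h $ i * partial_deriv i V (x + s *\<^sub>R h)) has_real_derivative
        (\<Sum>i\<in>UNIV. h $ i * (\<Sum>j\<in>UNIV. h $ j * partial_deriv j (partial_deriv i V) (x + s *\<^sub>R h)))) (at s)"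
      by (intro DERIV_sum DERIV_cmult DERIV_line d2)
    also have "(\<Sum>i\<in>UNIV. h $ i * (\<Sum>j\<in>UNIV. h $ j * partial_deriv j (partial_deriv i V) (x + s *\<^sub>R h))) =
        (\<Sum>j\<in>UNIV. \<Sum>i\<in>UNIV. h $ i * (h $ j * partial_deriv j (partial_deriv i V) (x + s *\<^sub>R h)))"
      unfolding sum_distrib_left by (rule sum.swap)
    also have "\<dots> = hess V (x + s *\<^sub>R h) \<bullet> outer h"
      unfolding inner_outer by (simp add: hess_def ac_simps)
    finally show ?thesis by (simp add: diff_def[abs_def])
  qed
  have "\<exists>t>0. t < 1 \<and> diff 0 1 = (\<Sum>m<2. diff m 0 / fact m * 1 ^ m) + diff 2 t / fact 2 * 1 ^ 2"
  proof (rule Maclaurin)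
    show "\<forall>m t. m < 2 \<and> 0 \<le> t \<and> t \<le> 1 \<longrightarrow> (diff m has_real_derivative diff (Suc m) t) (at t)"
    proof (intro allI impI)
      fix m :: nat and t :: real assume m: "m < 2 \<and> 0 \<le> t \<and> t \<le> 1"
      then consider "m = 0" | "m = 1" by linarith
      then show "(diff m has_real_derivative diff (Suc m) t) (at t)"
        using D0[of t] D1[of t] by cases (simp_all add: numeral_2_eq_2)
    qed
  qed simp_all
  then obtain t where t: "0 < t" "t < 1"
    and eq: "diff 0 1 = (\<Sum>m<2. diff m 0 / fact m * 1 ^ m) + diff 2 t / fact 2 * 1 ^ 2" by blast
  have eq': "V (x + h) = V x + grad V x \<bullet> h + 1/2 * (hess V (x + t *\<^sub>R h) \<bullet> outer h)"
    using eq by (simp add: diff_def numeral_2_eq_2 grad_def inner_vec_def ac_simps)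
  have "norm (hess V (x + t *\<^sub>R h) - hess V x) \<le> L * norm (x + t *\<^sub>R h - x)"
  proof (rule hess_lipD[OF L])
    \<comment> \<open>\<open>t < 1\<close> keeps the intermediate point inside the open ball even
      for a jump of maximal length \<open>\<rho>\<close>.\<close>
    have "norm (t *\<^sub>R h) < norm h" using t h0 by simp
    then show "x + t *\<^sub>R h \<in> ball x \<rho>" using h by (simp add: dist_norm)
    have "0 < \<rho>" using h h0 by linarith
    then show "x \<in> ball x \<rho>" by simp
  qed
  also have "\<dots> \<le> L * \<rho>"
    using t h L(2) mult_mono[of t 1 "norm h" \<rho>] by (intro mult_left_mono) simp_all
  finally have n: "norm (hess V (x + t *\<^sub>R h) - hess V x) \<le> L * \<rho>" .
  have "(hess V (x + t *\<^sub>R h) - hess V x) \<bullet> outer h \<le> norm (hess V (x + t *\<^sub>R h) - hess V x) * norm (outer h)"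
    by (rule norm_cauchy_schwarz)
  also have "\<dots> \<le> L * \<rho> * (norm h)\<^sup>2"
    unfolding norm_outer using n by (rule mult_right_mono) simp
  finally show ?thesis unfolding eq' by (simp add: inner_diff_left)
qed

section \<open>Moments of the jump rates\<close>

lemma has_sum_jump_rate:
  fixes f :: "real^'d::finite \<Rightarrow> 'b::real_normed_vector"
  assumes x: "x \<in> E"
  shows "((\<lambda>l. jump_rate E q l x *\<^sub>R f l) has_sum I) UNIV \<longleftrightarrow>
    ((\<lambda>y. q x y *\<^sub>R f (y - x)) has_sum I) (E - {x})"
proof -
  have "((\<lambda>l. jump_rate E q l x *\<^sub>R f l) has_sum I) UNIV \<longleftrightarrow>
      ((\<lambda>l. jump_rate E q l x *\<^sub>R f l) has_sum I) ((\<lambda>y. y - x) ` (E - {x}))"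
  proof (rule has_sum_cong_neutral)
    fix l assume "l \<in> UNIV - (\<lambda>y. y - x) ` (E - {x})"
    moreover have "l \<in> (\<lambda>y. y - x) ` (E - {x})" if "x + l \<in> E" "l \<noteq> 0"
      using that by (intro image_eqI[of _ _ "x + l"]) simp_all
    ultimately have "x + l \<notin> E \<or> l = 0" by blast
    then show "jump_rate E q l x *\<^sub>R f l = 0" by (auto simp: jump_rate_def)
  qed auto
  also have "\<dots> \<longleftrightarrow> (((\<lambda>l. jump_rate E q l x *\<^sub>R f l) \<circ> (\<lambda>y. y - x)) has_sum I) (E - {x})"
    by (rule has_sum_reindex) (simp add: inj_on_def)
  also have "\<dots> \<longleftrightarrow> ((\<lambda>y. q x y *\<^sub>R f (y - x)) has_sum I) (E - {x})"
    by (rule has_sum_cong) (use x in \<open>auto simp: jump_rate_def\<close>)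
  finally show ?thesis .
qed

lemma rates_moment_summable:
  fixes f :: "'a \<Rightarrow> 'b::banach"
  assumes rates: "transition_rates E q" and x: "x \<in> E"
    and bnd: "\<And>y. y \<in> E - {x} \<Longrightarrow> q x y > 0 \<Longrightarrow> norm (f y) \<le> B"
  shows "(\<lambda>y. q x y *\<^sub>R f y) summable_on (E - {x})"
proof -
  have s: "(\<lambda>y. q x y) summable_on (E - {x})"
    using rates x unfolding transition_rates_def by auto
  have "(\<lambda>y. q x y * B) summable_on (E - {x})" using s by (rule summable_on_cmult_left)
  then have "(\<lambda>y. norm (q x y *\<^sub>R f y)) summable_on (E - {x})"
  proof (rule summable_on_comparison_test)
    fix y assume y: "y \<in> E - {x}"
    have q0: "q x y \<ge> 0" using rates x y unfolding transition_rates_def by auto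
    then show "norm (q x y *\<^sub>R f y) \<le> q x y * B"
      using bnd[OF y] by (cases "q x y = 0") (auto intro!: mult_left_mono)
  qed simp
  then show ?thesis by (rule abs_summable_summable)
qed

text \<open>\<open>infsum\<close> is 0 for a family that is not summable, so \<open>is_drift\<close>
  and \<open>is_diffusion\<close> yield genuine moments only once summability is shown. Bounded
  jumps and summable rates provide it.\<close>

lemma rates_moments:
  fixes F :: "real^'d::finite \<Rightarrow> real^'d" and a :: "real^'d \<Rightarrow> real^'d^'d"
  assumes rates: "transition_rates E q" and x: "x \<in> E"
    and bnd: "\<And>y. y \<in> E - {x} \<Longrightarrow> q x y > 0 \<Longrightarrow> norm (y - x) \<le> jmax"
    and F: "is_drift E q F" and a: "is_diffusion E q a"
  shows "((\<lambda>y. q x y) has_sum exit_rate E q x) (E - {x})"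
    and "((\<lambda>y. q x y *\<^sub>R (y - x)) has_sum F x) (E - {x})"
    and "((\<lambda>y. q x y *\<^sub>R outer (y - x)) has_sum a x) (E - {x})"
proof -
  show "((\<lambda>y. q x y) has_sum exit_rate E q x) (E - {x})"
    using rates x unfolding transition_rates_def exit_rate_def by auto
  have "(\<lambda>y. q x y *\<^sub>R (y - x)) summable_on (E - {x})"
    by (rule rates_moment_summable[OF rates x, where B=jmax]) (rule bnd)
  then obtain I where I: "((\<lambda>y. q x y *\<^sub>R (y - x)) has_sum I) (E - {x})"
    unfolding summable_on_def by blast
  from I have "((\<lambda>l. jump_rate E q l x *\<^sub>R l) has_sum I) UNIV"
    using has_sum_jump_rate[OF x, of q "\<lambda>l. l" I] by simp
  then have "F x = I" using F x unfolding is_drift_def by (simp add: infsumI)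
  with I show "((\<lambda>y. q x y *\<^sub>R (y - x)) has_sum F x) (E - {x})" by simp
  have "(\<lambda>y. q x y *\<^sub>R outer (y - x)) summable_on (E - {x})"
    by (rule rates_moment_summable[OF rates x, where B="jmax\<^sup>2"])
       (auto simp: norm_outer intro!: power_mono bnd)
  then obtain A where A: "((\<lambda>y. q x y *\<^sub>R outer (y - x)) has_sum A) (E - {x})"
    unfolding summable_on_def by blast
  then have A': "((\<lambda>l. jump_rate E q l x *\<^sub>R outer l) has_sum A) UNIV"
    using has_sum_jump_rate[OF x, of q outer A] by simp
  have "a x $ i $ j = A $ i $ j" for i j
  proof -
    have "((\<lambda>l. (jump_rate E q l x *\<^sub>R outer l) $ i $ j) has_sum A $ i $ j) UNIV"
      using has_sum_bounded_linear[OF bounded_linear_compose[OF bounded_linear_vec_nth[of j] bounded_linear_vec_nth[of i]] A']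
      by (simp add: o_def)
    then have "((\<lambda>l. (l $ i) * (l $ j) * jump_rate E q l x) has_sum A $ i $ j) UNIV"
      by (simp add: outer_def ac_simps)
    then show ?thesis using a x unfolding is_diffusion_def by (simp add: infsumI)
  qed
  then have "a x = A" by (simp add: vec_eq_iff)
  with A show "((\<lambda>y. q x y *\<^sub>R outer (y - x)) has_sum a x) (E - {x})" by simp
qed

lemma inner_mat_1: "A \<bullet> mat 1 = (\<Sum>i\<in>UNIV. A $ i $ i)" for A :: "real^'d^'d::finite"
  by (simp add: inner_vec_def mat_def if_distrib cong: if_cong)

text \<open>The trace of the outer product. It writes the square in the Taylor error as a linear
  function of \<open>outer h\<close>, whose sum against the rates is the diffusion matrix.\<close>

lemma outer_inner_mat_1: "outer h \<bullet> mat 1 = (norm h)\<^sup>2"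
  unfolding inner_mat_1 power2_norm_eq_inner by (simp add: outer_def inner_vec_def)

lemma outer_scaleR: "outer (c *\<^sub>R h) = c\<^sup>2 *\<^sub>R outer h"
  by (simp add: outer_def vec_eq_iff power2_eq_square)

text \<open>The generator of the scaled chain applied to \<open>V\<close>, up to the third-order Taylor remainder.\<close>

lemma generator_Taylor:
  fixes V :: "real^'d::finite \<Rightarrow> real" and F :: "real^'d \<Rightarrow> real^'d" and a :: "real^'d \<Rightarrow> real^'d^'d"
  assumes rates: "transition_rates E q" and x: "x \<in> E"
    and bnd: "\<And>y. y \<in> E - {x} \<Longrightarrow> q x y > 0 \<Longrightarrow> norm (y - x) \<le> jmax"
    and F: "is_drift E q F" and a: "is_diffusion E q a"
    and C2: "C2 V" and V0: "\<And>y. 0 \<le> V y" and c: "c > 0"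
    and L: "hess_lip V ((x - z) /\<^sub>R c) (jmax / c) \<le> ennreal L" "0 \<le> L"
  shows "(\<integral>\<^sup>+y. ennreal (q x y * V ((y - z) /\<^sub>R c)) \<partial>count_space (E - {x})) \<le>
    ennreal (exit_rate E q x * V ((x - z) /\<^sub>R c) + grad V ((x - z) /\<^sub>R c) \<bullet> (F x /\<^sub>R c) +
      1/2 * (hess V ((x - z) /\<^sub>R c) \<bullet> (a x /\<^sub>R c\<^sup>2)) + 1/2 * (L * (jmax / c)) * ((a x /\<^sub>R c\<^sup>2) \<bullet> mat 1))"
proof -
  let ?u = "(x - z) /\<^sub>R c"
  define h where "h y = (y - x) /\<^sub>R c" for y
  \<comment> \<open>The Taylor bound is affine in \<open>h y\<close> and \<open>outer (h y)\<close>,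
    so its sum against the rates is computed from the total rate, the drift and the diffusion
    matrix.\<close>
  define B where "B y = V ?u + grad V ?u \<bullet> h y + 1/2 * (hess V ?u \<bullet> outer (h y)) + 1/2 * (L * (jmax / c)) * (outer (h y) \<bullet> mat 1)" for y
  note m = rates_moments[OF rates x bnd F a]
  have q0: "q x y \<ge> 0" if "y \<in> E - {x}" for y using rates x that unfolding transition_rates_def by auto
  have le: "V ((y - z) /\<^sub>R c) \<le> B y" if "y \<in> E - {x}" "q x y > 0" for y
  proof -
    have "(y - z) /\<^sub>R c = ?u + h y" unfolding h_def by (simp add: scaleR_diff_right)
    moreover have "norm (h y) \<le> jmax / c"
      using bnd[OF that] c by (simp add: h_def divide_inverse mult.commute mult_left_mono)
    from Taylor_C2[OF C2 L this]
    have "V (?u + h y) \<le> B y" unfolding B_def outer_inner_mat_1 by simp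
    ultimately show ?thesis by simp
  qed
  have s1: "((\<lambda>y. q x y * (grad V ?u \<bullet> h y)) has_sum grad V ?u \<bullet> (F x /\<^sub>R c)) (E - {x})"
    using has_sum_bounded_linear[OF bounded_linear_inner_right has_sum_bounded_linear[OF bounded_linear_scaleR_right m(2), of "inverse c"], of "grad V ?u"]
    by (simp add: h_def o_def ac_simps)
  have o: "outer (h y) = (1 / c\<^sup>2) *\<^sub>R outer (y - x)" for y
    unfolding h_def outer_scaleR by (simp add: power_inverse inverse_eq_divide power_divide)
  have m3: "((\<lambda>y. q x y *\<^sub>R outer (h y)) has_sum a x /\<^sub>R c\<^sup>2) (E - {x})"
    using has_sum_bounded_linear[OF bounded_linear_scaleR_right m(3), of "inverse (c\<^sup>2)"] unfolding o by (simp add: o_def ac_simps inverse_eq_divide)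
  have s2: "((\<lambda>y. q x y * (hess V ?u \<bullet> outer (h y))) has_sum hess V ?u \<bullet> (a x /\<^sub>R c\<^sup>2)) (E - {x})"
    using has_sum_bounded_linear[OF bounded_linear_inner_right m3, of "hess V ?u"] by (simp add: o_def)
  have s3: "((\<lambda>y. q x y * (outer (h y) \<bullet> mat 1)) has_sum (a x /\<^sub>R c\<^sup>2) \<bullet> mat 1) (E - {x})"
    using has_sum_bounded_linear[OF bounded_linear_inner_left m3, of "mat 1"] by (simp add: o_def)
  have hs: "((\<lambda>y. q x y * B y) has_sum (exit_rate E q x * V ?u + grad V ?u \<bullet> (F x /\<^sub>R c) +
      1/2 * (hess V ?u \<bullet> (a x /\<^sub>R c\<^sup>2)) + 1/2 * (L * (jmax / c)) * ((a x /\<^sub>R c\<^sup>2) \<bullet> mat 1))) (E - {x})"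
    using has_sum_add[OF has_sum_add[OF has_sum_add[OF has_sum_cmult_left[OF m(1), of "V ?u"] s1]
        has_sum_cmult_right[OF s2, of "1/2"]] has_sum_cmult_right[OF s3, of "1/2 * (L * (jmax / c))"]]
    unfolding B_def by (simp add: algebra_simps)
  \<comment> \<open>Nonnegative summands allow the sum to be read as an integral in
    \<open>ennreal\<close>. They come from \<open>V\<close>: the bound lies above \<open>V\<close>
    wherever the rate is positive.\<close>
  have qB: "0 \<le> q x y * B y" "q x y * V ((y - z) /\<^sub>R c) \<le> q x y * B y" if y: "y \<in> E - {x}" for y
  proof -
    show le': "q x y * V ((y - z) /\<^sub>R c) \<le> q x y * B y"
      using le[OF y] q0[OF y] by (cases "q x y = 0") (simp_all add: mult_left_mono)
    have "0 \<le> q x y * V ((y - z) /\<^sub>R c)" using q0[OF y] V0 by simp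
    with le' show "0 \<le> q x y * B y" by simp
  qed
  have "(\<integral>\<^sup>+y. ennreal (q x y * V ((y - z) /\<^sub>R c)) \<partial>count_space (E - {x})) \<le>
     (\<integral>\<^sup>+y. ennreal (q x y * B y) \<partial>count_space (E - {x}))"
    by (intro nn_integral_mono ennreal_leI) (simp add: qB(2))
  also have "\<dots> = ennreal (infsum (\<lambda>y. q x y * B y) (E - {x}))"
    using hs qB(1) by (intro nn_integral_conv_infsum) (auto simp: summable_on_def)
  also note infsumI[OF hs]
  finally show ?thesis .
qed

section \<open>Lyapunov bounds for the chain\<close>

context conservative_jump_process
begin

lemma stationary_Lyapunov_bound:
  fixes V :: "'a \<Rightarrow> real"
  assumes V: "\<And>x. 0 \<le> V x" and b: "0 \<le> b" and c: "0 < c"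
    and \<nu>: "set_pmf \<nu> \<subseteq> E"
      "\<And>f t. 0 \<le> t \<Longrightarrow> (\<integral>\<^sup>+x. semigroup f t x \<partial>measure_pmf \<nu>) = (\<integral>\<^sup>+x. f x \<partial>measure_pmf \<nu>)"
    and Lyap: "\<And>x t. x \<in> E \<Longrightarrow> 0 \<le> t \<Longrightarrow>
      ennreal c * (\<integral>\<^sup>+s. indicator {..t} s * semigroup (\<lambda>x. ennreal (V x)) s x \<partial>lborel) \<le> ennreal (V x + b * t)"
  shows "(\<integral>\<^sup>+x. ennreal (V x) \<partial>measure_pmf \<nu>) \<le> ennreal (b / c)"
proof -
  define f where "f m x = ennreal (min (V x) (real m))" for m x
  have trunc: "(\<integral>\<^sup>+x. f m x \<partial>measure_pmf \<nu>) \<le> ennreal (b / c)" for m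
  proof -
    have f_le: "f m x \<le> ennreal (V x)" "f m x \<le> ennreal (real m) * 1" for x
      unfolding f_def by (auto intro!: ennreal_leI)
    \<comment> \<open>Over \<open>[0, t]\<close> the semigroup applied to \<open>f m\<close>
      integrates to at most \<open>m * t\<close> and to at most \<open>(V x + b * t) / c\<close>.
      Keeping the minimum leaves the constant \<open>m\<close> as a dominating function while
      \<open>V x / (c * t)\<close> vanishes for large \<open>t\<close>, although \<open>V\<close> is
      not known to be integrable for \<open>\<nu>\<close>.\<close>
    have bnd: "(\<integral>\<^sup>+x. f m x \<partial>measure_pmf \<nu>) \<le> (\<integral>\<^sup>+x. ennreal (min (real m) (V x / (c * t) + b / c)) \<partial>measure_pmf \<nu>)"
      if t: "t > 0" for t
    proof -
      have "ennreal t * (\<integral>\<^sup>+x. f m x \<partial>measure_pmf \<nu>) =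
          (\<integral>\<^sup>+s. (\<integral>\<^sup>+x. f m x \<partial>measure_pmf \<nu>) * indicator {0..t} s \<partial>lborel)"
        using t by (subst nn_integral_cmult_indicator) (simp_all add: mult.commute)
      also have "\<dots> = (\<integral>\<^sup>+s. \<integral>\<^sup>+x. indicator {0..t} s * semigroup (f m) s x \<partial>measure_pmf \<nu> \<partial>lborel)"
        by (intro nn_integral_cong) (auto simp: indicator_def \<nu>(2))
      also have "\<dots> = (\<integral>\<^sup>+x. \<integral>\<^sup>+s. indicator {0..t} s * semigroup (f m) s x \<partial>lborel \<partial>measure_pmf \<nu>)"
        by (rule nn_integral_pmf_swap) measurable
      also have "\<dots> \<le> (\<integral>\<^sup>+x. ennreal t * ennreal (min (real m) (V x / (c * t) + b / c)) \<partial>measure_pmf \<nu>)"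
      proof (rule nn_integral_mono_AE, rule AE_pmfI)
        fix x assume "x \<in> set_pmf \<nu>"
        then have x: "x \<in> E" using \<nu> by blast
        have "(\<integral>\<^sup>+s. indicator {0..t} s * semigroup (f m) s x \<partial>lborel) \<le> (\<integral>\<^sup>+s. ennreal (real m) * indicator {0..t} s \<partial>lborel)"
        proof (rule nn_integral_mono)
          fix s
          have "semigroup (f m) s x \<le> semigroup (\<lambda>x. ennreal (real m) * 1) s x" by (rule semigroup_mono) (rule f_le)
          also have "\<dots> = ennreal (real m) * semigroup (\<lambda>_. 1) s x" by (rule semigroup_cmult)
          also have "\<dots> \<le> ennreal (real m) * 1" by (intro mult_left_mono semigroup_le_1) simp_all
          finally show "indicator {0..t} s * semigroup (f m) s x \<le> ennreal (real m) * indicator {0..t} s"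
            by (auto simp: indicator_def)
        qed
        also have "\<dots> = ennreal (real m * t)"
          using t by (subst nn_integral_cmult_indicator) (simp_all add: ennreal_mult)
        finally have 1: "(\<integral>\<^sup>+s. indicator {0..t} s * semigroup (f m) s x \<partial>lborel) \<le> ennreal (real m * t)" .
        let ?I = "\<integral>\<^sup>+s. indicator {0..t} s * semigroup (f m) s x \<partial>lborel"
        have "ennreal c * ?I \<le> ennreal c * (\<integral>\<^sup>+s. indicator {..t} s * semigroup (\<lambda>x. ennreal (V x)) s x \<partial>lborel)"
          by (intro mult_left_mono nn_integral_mono mult_mono semigroup_mono f_le) (auto simp: indicator_def)
        also have "\<dots> \<le> ennreal (V x + b * t)" using t by (intro Lyap x) simp
        finally have 2: "ennreal c * ?I \<le> ennreal (V x + b * t)" .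
        have "?I < \<infinity>" using 1 by (rule order_le_less_trans) simp
        then obtain I where I: "?I = ennreal I" "0 \<le> I" by (cases ?I) auto
        have "I \<le> real m * t" using 1 t unfolding I by simp
        moreover have "c * I \<le> V x + b * t"
        proof -
          have "ennreal (c * I) \<le> ennreal (V x + b * t)"
            using 2 c I(2) unfolding I(1) by (simp add: ennreal_mult del: ennreal_plus)
          then show ?thesis using V[of x] b t by (subst (asm) ennreal_le_iff) simp_all
        qed
        ultimately have "I \<le> t * min (real m) (V x / (c * t) + b / c)"
        proof -
          assume "c * I \<le> V x + b * t"
          then have "I \<le> (V x + b * t) / c" using c by (simp add: pos_le_divide_eq mult.commute)
          also have "\<dots> = t * (V x / (c * t) + b / c)" using c t by (simp add: field_simps)
          finally have "I \<le> t * (V x / (c * t) + b / c)" .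
          moreover assume "I \<le> real m * t"
          ultimately show ?thesis by (simp add: min_def mult.commute)
        qed
        moreover have "0 \<le> min (real m) (V x / (c * t) + b / c)" using V[of x] b c t by simp
        ultimately show "?I \<le> ennreal t * ennreal (min (real m) (V x / (c * t) + b / c))"
          unfolding I using t by (simp add: ennreal_mult[symmetric])
      qed
      also have "\<dots> = ennreal t * (\<integral>\<^sup>+x. ennreal (min (real m) (V x / (c * t) + b / c)) \<partial>measure_pmf \<nu>)"
        by (simp add: nn_integral_cmult)
      finally show ?thesis using t by (simp add: ennreal_mult_le_mult_iff)
    qed
    have "(\<lambda>k. \<integral>\<^sup>+x. ennreal (min (real m) (V x / (c * real (Suc k)) + b / c)) \<partial>measure_pmf \<nu>) \<longlonglongrightarrow>
        (\<integral>\<^sup>+x. ennreal (min (real m) (b / c)) \<partial>measure_pmf \<nu>)"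
    proof (rule nn_integral_dominated_convergence[where w="\<lambda>_. ennreal (real m)"])
      show "AE x in measure_pmf \<nu>. (\<lambda>k. ennreal (min (real m) (V x / (c * real (Suc k)) + b / c))) \<longlonglongrightarrow>
          ennreal (min (real m) (b / c))"
      proof (rule AE_I2)
        fix x
        have "(\<lambda>k. V x / c * inverse (real (Suc k)) + b / c) \<longlonglongrightarrow> V x / c * 0 + b / c"
          by (intro tendsto_intros LIMSEQ_inverse_real_of_nat)
        then have "(\<lambda>k. V x / (c * real (Suc k)) + b / c) \<longlonglongrightarrow> b / c"
          by (simp add: divide_inverse mult.assoc)
        then show "(\<lambda>k. ennreal (min (real m) (V x / (c * real (Suc k)) + b / c))) \<longlonglongrightarrow>
          ennreal (min (real m) (b / c))"
          by (intro tendsto_ennrealI tendsto_min tendsto_const)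
      qed
    qed (auto intro!: AE_I2 ennreal_leI)
    then have "(\<integral>\<^sup>+x. f m x \<partial>measure_pmf \<nu>) \<le> (\<integral>\<^sup>+x. ennreal (min (real m) (b / c)) \<partial>measure_pmf \<nu>)"
      by (rule LIMSEQ_le_const) (intro exI[of _ 0] allI impI bnd, simp)
    also have "\<dots> \<le> ennreal (b / c)" by (simp add: ennreal_leI)
    finally show ?thesis .
  qed
  have "(\<integral>\<^sup>+x. ennreal (V x) \<partial>measure_pmf \<nu>) = (\<integral>\<^sup>+x. (SUP m. f m x) \<partial>measure_pmf \<nu>)"
  proof (rule nn_integral_cong)
    fix x
    show "ennreal (V x) = (SUP m. f m x)"
    proof (rule antisym)
      obtain m where "V x \<le> real m" using real_arch_simple by blast
      then have "ennreal (V x) = f m x" by (simp add: f_def min_def)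
      also have "\<dots> \<le> (SUP m. f m x)" by (rule SUP_upper) simp
      finally show "ennreal (V x) \<le> (SUP m. f m x)" .
    qed (auto intro!: SUP_least ennreal_leI simp: f_def)
  qed
  also have "\<dots> = (SUP m. \<integral>\<^sup>+x. f m x \<partial>measure_pmf \<nu>)"
    by (rule nn_integral_monotone_convergence_SUP) (auto simp: incseq_def le_fun_def f_def intro!: ennreal_leI)
  also have "\<dots> \<le> ennreal (b / c)" by (rule SUP_least) (rule trunc)
  finally show ?thesis .
qed

end

context ctmc_process
begin

lemma hold_rate_nn_integral_jump_pmf:
  assumes x: "x \<in> E"
  shows "ennreal (hold_rate x) * (\<integral>\<^sup>+y. f y \<partial>measure_pmf (jump_pmf x)) = (\<integral>\<^sup>+y. ennreal (q x y) * f y \<partial>count_space (E - {x}))"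
proof -
  have "ennreal (hold_rate x) * (\<integral>\<^sup>+y. f y \<partial>measure_pmf (jump_pmf x)) =
      (\<integral>\<^sup>+y. ennreal (hold_rate x) * (ennreal (pmf (jump_pmf x) y) * f y) \<partial>count_space UNIV)"
    unfolding nn_integral_measure_pmf by (simp add: nn_integral_cmult)
  also have "\<dots> = (\<integral>\<^sup>+y. ennreal (q x y) * f y * indicator (E - {x}) y \<partial>count_space UNIV)"
  proof (rule nn_integral_cong)
    fix y
    have "ennreal (hold_rate x) * ennreal (pmf (jump_pmf x) y) = ennreal (q x y) * indicator (E - {x}) y"
      using exit_pos[OF x] rates_nonneg[OF x, of y]
      by (auto simp: pmf_jump_pmf jump_prob_def hold_rate_E proj_id x indicator_def ennreal_mult[symmetric])
    then show "ennreal (hold_rate x) * (ennreal (pmf (jump_pmf x) y) * f y) = ennreal (q x y) * f y * indicator (E - {x}) y"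
      by (simp add: mult.assoc[symmetric]) (simp add: ac_simps)
  qed
  also have "\<dots> = (\<integral>\<^sup>+y. ennreal (q x y) * f y \<partial>count_space (E - {x}))"
    by (simp add: nn_integral_count_space_indicator)
  finally show ?thesis .
qed

end

context ctmc_nonexplosive
begin

text \<open>The Lyapunov inequality is first read as one between nonnegative integrals. Its finite
  right side, together with \<open>c > 0\<close>, bounds the mean of the time integral, and only
  then are signed integrals formed. The time integral of \<open>V\<close> may be infinite on a null
  set, which is why its integrability is stated almost everywhere.\<close>

lemma Lyapunov_expectation:
  fixes V :: "'a \<Rightarrow> real"
  assumes V: "\<And>x. 0 \<le> V x" and b: "0 \<le> b" and c0: "0 < c"
    and gen: "\<And>x. x \<in> E \<Longrightarrow> ennreal (hold_rate x) * (\<integral>\<^sup>+y. ennreal (V y) \<partial>measure_pmf (jump_pmf x)) + ennreal (c * V x)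
        \<le> ennreal (hold_rate x * V x + b)"
    and x: "x \<in> E" and t: "0 \<le> t"
  shows "integrable (P x) (\<lambda>\<omega>. V (path Y S t \<omega>))"
    and "AE \<omega> in P x. set_integrable lborel {0..t} (\<lambda>s. - c * V (path Y S s \<omega>) + b)"
    and "integrable (P x) (\<lambda>\<omega>. LBINT s:{0..t}. - c * V (path Y S s \<omega>) + b)"
    and "(\<integral>\<omega>. V (path Y S t \<omega>) \<partial>P x) \<le> V x + (\<integral>\<omega>. (LBINT s:{0..t}. - c * V (path Y S s \<omega>) + b) \<partial>P x)"
proof -
  have c: "0 \<le> c" using c0 by simp
  interpret p: prob_space "P x" by (rule prob_P[OF x])
  interpret pair_sigma_finite "lborel :: real measure" "P x" ..
  have mj: "(\<lambda>z. V (path Y S (fst z) (snd z))) \<in> borel_measurable (borel \<Otimes>\<^sub>M P x)"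
    by (rule measurable_compose[OF measurable_path_joint[OF x]]) simp
  have mt [measurable]: "(\<lambda>\<omega>. V (path Y S s \<omega>)) \<in> borel_measurable (P x)" for s
    by (rule measurable_compose[OF measurable_path[OF x]]) simp
  have ms: "(\<lambda>s. V (path Y S s \<omega>)) \<in> borel_measurable borel" if "\<omega> \<in> space (P x)" for \<omega>
    using measurable_compose[OF measurable_Pair2'[OF that] mj] by simp
  have mj' [measurable]: "(\<lambda>(s, \<omega>). V (path Y S s \<omega>)) \<in> borel_measurable (lborel \<Otimes>\<^sub>M P x)"
    using mj by (simp add: case_prod_beta' cong: measurable_cong_sets sets_pair_measure_cong)
  have mswap [measurable]: "(\<lambda>(\<omega>, s). V (path Y S s \<omega>)) \<in> borel_measurable (P x \<Otimes>\<^sub>M lborel)"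
    using measurable_pair_swap[OF mj'] by (simp add: case_prod_beta')
  define T where "T \<omega> = (\<integral>\<^sup>+s. indicator {0..t} s * ennreal (V (path Y S s \<omega>)) \<partial>lborel)" for \<omega>
  have mT [measurable]: "T \<in> borel_measurable (P x)" unfolding T_def[abs_def] by measurable
  let ?I = "\<integral>\<^sup>+s. indicator {..t} s * semigroup (\<lambda>x. ennreal (V x)) s x \<partial>lborel"
  have IT: "(\<integral>\<^sup>+\<omega>. T \<omega> \<partial>P x) = ?I"
  proof -
    have "(\<integral>\<^sup>+\<omega>. T \<omega> \<partial>P x) = (\<integral>\<^sup>+s. \<integral>\<^sup>+\<omega>. indicator {0..t} s * ennreal (V (path Y S s \<omega>)) \<partial>P x \<partial>lborel)"
      unfolding T_def by (rule Fubini') measurable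
    also have "\<dots> = ?I"
    proof (rule nn_integral_cong)
      fix s :: real
      have "(\<integral>\<^sup>+\<omega>. indicator {0..t} s * ennreal (V (path Y S s \<omega>)) \<partial>P x) =
          indicator {0..t} s * (\<integral>\<^sup>+\<omega>. ennreal (V (path Y S s \<omega>)) \<partial>P x)"
        by (rule nn_integral_cmult) measurable
      also have "\<dots> = indicator {..t} s * semigroup (\<lambda>x. ennreal (V x)) s x"
        by (cases "s < 0") (auto simp: indicator_def semigroup_neg semigroup_eq_expectation[OF x])
      finally show "(\<integral>\<^sup>+\<omega>. indicator {0..t} s * ennreal (V (path Y S s \<omega>)) \<partial>P x) =
          indicator {..t} s * semigroup (\<lambda>x. ennreal (V x)) s x" .
    qed
    finally show ?thesis .
  qed
  have main: "(\<integral>\<^sup>+\<omega>. ennreal (V (path Y S t \<omega>)) \<partial>P x) + ennreal c * (\<integral>\<^sup>+\<omega>. T \<omega> \<partial>P x) \<le> ennreal (V x + b * t)"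
  proof -
    have "semigroup (\<lambda>x. ennreal (V x)) t x + ennreal c * ?I \<le> ennreal (V x + b * t)"
      by (rule semigroup_Lyapunov[where E=E and V=V, OF V b c set_jump_pmf gen x t])
    then show ?thesis unfolding IT semigroup_eq_expectation[OF x t] .
  qed
  have fin1: "(\<integral>\<^sup>+\<omega>. ennreal (V (path Y S t \<omega>)) \<partial>P x) < \<infinity>"
  proof -
    have "(\<integral>\<^sup>+\<omega>. ennreal (V (path Y S t \<omega>)) \<partial>P x) \<le>
      (\<integral>\<^sup>+\<omega>. ennreal (V (path Y S t \<omega>)) \<partial>P x) + ennreal c * (\<integral>\<^sup>+\<omega>. T \<omega> \<partial>P x)" by simp
    also note main
    also have "ennreal (V x + b * t) < \<infinity>" by simp
    finally show ?thesis .
  qed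
  have "ennreal c * (\<integral>\<^sup>+\<omega>. T \<omega> \<partial>P x) \<le>
      (\<integral>\<^sup>+\<omega>. ennreal (V (path Y S t \<omega>)) \<partial>P x) + ennreal c * (\<integral>\<^sup>+\<omega>. T \<omega> \<partial>P x)" by simp
  also note main
  also have "ennreal (V x + b * t) < \<infinity>" by simp
  finally have "ennreal c * (\<integral>\<^sup>+\<omega>. T \<omega> \<partial>P x) < \<infinity>" .
  then have fin2: "(\<integral>\<^sup>+\<omega>. T \<omega> \<partial>P x) < \<infinity>"
    using c0 by (auto simp: ennreal_mult_less_top)
  show int1: "integrable (P x) (\<lambda>\<omega>. V (path Y S t \<omega>))"
    by (rule integrableI_nonneg) (use fin1 V in auto)
  have AET: "AE \<omega> in P x. T \<omega> \<noteq> \<infinity>"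
    using fin2 by (intro nn_integral_noteq_infinite) auto
  have sint: "set_integrable lborel {0..t} (\<lambda>s. V (path Y S s \<omega>)) \<and> (LBINT s:{0..t}. V (path Y S s \<omega>)) = enn2real (T \<omega>)"
    if "\<omega> \<in> space (P x)" "T \<omega> \<noteq> \<infinity>" for \<omega>
  proof -
    have T: "T \<omega> = (\<integral>\<^sup>+s. ennreal (indicator {0..t} s *\<^sub>R V (path Y S s \<omega>)) \<partial>lborel)"
      unfolding T_def by (intro nn_integral_cong) (simp add: indicator_def)
    have "integrable lborel (\<lambda>s. indicator {0..t} s *\<^sub>R V (path Y S s \<omega>))"
      using that T ms[OF that(1)] V by (intro integrableI_nonneg) (auto simp: less_top)
    moreover have "(\<integral>s. indicator {0..t} s *\<^sub>R V (path Y S s \<omega>) \<partial>lborel) = enn2real (T \<omega>)"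
      unfolding T using ms[OF that(1)] V by (intro integral_eq_nn_integral) auto
    ultimately show ?thesis unfolding set_integrable_def set_lebesgue_integral_def by blast
  qed
  have cint: "set_integrable lborel {0..t} (\<lambda>s. b)"
    unfolding set_integrable_def by (intro integrable_scaleR_left integrable_real_indicator) (use t in simp_all)
  have ex: "set_integrable lborel {0..t} (\<lambda>s. - c * V (path Y S s \<omega>) + b) \<and>
      (LBINT s:{0..t}. - c * V (path Y S s \<omega>) + b) = b * t - c * enn2real (T \<omega>)"
    if "\<omega> \<in> space (P x)" "T \<omega> \<noteq> \<infinity>" for \<omega>
  proof -
    note si = sint[OF that]
    have si0: "set_integrable lborel {0..t} (\<lambda>s. V (path Y S s \<omega>))" by (rule conjunct1[OF si])
    have si1: "set_integrable lborel {0..t} (\<lambda>s. - c * V (path Y S s \<omega>))"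
      by (rule set_integrable_mult_right[of "- c" lborel "{0..t}" "\<lambda>s. V (path Y S s \<omega>)"]) (rule si0)
    have "(LBINT s:{0..t}. - c * V (path Y S s \<omega>) + b) =
        (LBINT s:{0..t}. - c * V (path Y S s \<omega>)) + (LBINT s:{0..t}. b)"
      by (rule set_integral_add(2)[OF si1 cint])
    also have "(LBINT s:{0..t}. - c * V (path Y S s \<omega>)) = - c * enn2real (T \<omega>)"
      by (simp only: set_integral_mult_right conjunct2[OF si])
    also have "(LBINT s:{0..t}. b) = b * t"
    proof -
      have "(LBINT s:{0..t}. b) = (LINT s|lborel. indicator {0..t} s) *\<^sub>R b"
        unfolding set_lebesgue_integral_def
        by (intro integral_scaleR_left integrable_real_indicator) (use t in simp_all)
      also have "(LINT s|lborel. indicator {0..t} s) = t" by (subst Bochner_Integration.integral_indicator) (use t in simp_all)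
      finally show ?thesis by simp
    qed
    finally show ?thesis using set_integral_add(1)[OF si1 cint] by simp
  qed
  show "AE \<omega> in P x. set_integrable lborel {0..t} (\<lambda>s. - c * V (path Y S s \<omega>) + b)"
    using AET AE_space by eventually_elim (use ex in blast)
  have AEeq: "AE \<omega> in P x. (LBINT s:{0..t}. - c * V (path Y S s \<omega>) + b) = b * t - c * enn2real (T \<omega>)"
    using AET AE_space by eventually_elim (use ex in blast)
  have mL: "(\<lambda>\<omega>. LBINT s:{0..t}. - c * V (path Y S s \<omega>) + b) \<in> borel_measurable (P x)"
    unfolding set_lebesgue_integral_def by measurable
  have intT: "integrable (P x) (\<lambda>\<omega>. enn2real (T \<omega>))"
  proof (rule integrableI_nonneg)
    have "(\<integral>\<^sup>+\<omega>. ennreal (enn2real (T \<omega>)) \<partial>P x) = (\<integral>\<^sup>+\<omega>. T \<omega> \<partial>P x)"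
      using AET by (intro nn_integral_cong_AE) (auto elim!: eventually_mono simp: less_top)
    then show "(\<integral>\<^sup>+\<omega>. ennreal (enn2real (T \<omega>)) \<partial>P x) < \<infinity>" using fin2 by simp
  qed auto
  have int2: "integrable (P x) (\<lambda>\<omega>. b * t - c * enn2real (T \<omega>))" using intT by auto
  show "integrable (P x) (\<lambda>\<omega>. LBINT s:{0..t}. - c * V (path Y S s \<omega>) + b)"
    using int2 by (subst integrable_cong_AE[OF mL _ AEeq]) auto
  have "(\<integral>\<omega>. (LBINT s:{0..t}. - c * V (path Y S s \<omega>) + b) \<partial>P x) = (\<integral>\<omega>. b * t - c * enn2real (T \<omega>) \<partial>P x)"
    by (rule integral_cong_AE[OF mL _ AEeq]) measurable
  also have "\<dots> = b * t - c * (\<integral>\<omega>. enn2real (T \<omega>) \<partial>P x)"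
    using intT by (simp add: p.prob_space)
  finally have e1: "(\<integral>\<omega>. (LBINT s:{0..t}. - c * V (path Y S s \<omega>) + b) \<partial>P x) = b * t - c * (\<integral>\<omega>. enn2real (T \<omega>) \<partial>P x)" .
  have e2: "(\<integral>\<^sup>+\<omega>. ennreal (V (path Y S t \<omega>)) \<partial>P x) = ennreal (\<integral>\<omega>. V (path Y S t \<omega>) \<partial>P x)"
    using int1 V by (intro nn_integral_eq_integral) auto
  have e3: "(\<integral>\<^sup>+\<omega>. T \<omega> \<partial>P x) = ennreal (\<integral>\<omega>. enn2real (T \<omega>) \<partial>P x)"
  proof -
    have "(\<integral>\<^sup>+\<omega>. T \<omega> \<partial>P x) = (\<integral>\<^sup>+\<omega>. ennreal (enn2real (T \<omega>)) \<partial>P x)"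
      using AET by (intro nn_integral_cong_AE) (auto elim!: eventually_mono simp: less_top)
    also have "\<dots> = ennreal (\<integral>\<omega>. enn2real (T \<omega>) \<partial>P x)"
      using intT by (intro nn_integral_eq_integral) auto
    finally show ?thesis .
  qed
  have p1: "0 \<le> (\<integral>\<omega>. V (path Y S t \<omega>) \<partial>P x)" "0 \<le> (\<integral>\<omega>. enn2real (T \<omega>) \<partial>P x)"
    using V by simp_all
  have "ennreal ((\<integral>\<omega>. V (path Y S t \<omega>) \<partial>P x) + c * (\<integral>\<omega>. enn2real (T \<omega>) \<partial>P x)) \<le> ennreal (V x + b * t)"
    using main c p1 unfolding e2 e3 by (simp add: ennreal_mult)
  then have "(\<integral>\<omega>. V (path Y S t \<omega>) \<partial>P x) + c * (\<integral>\<omega>. enn2real (T \<omega>) \<partial>P x) \<le> V x + b * t"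
    using V[of x] b t by (subst (asm) ennreal_le_iff) simp_all
  then show "(\<integral>\<omega>. V (path Y S t \<omega>) \<partial>P x) \<le> V x + (\<integral>\<omega>. (LBINT s:{0..t}. - c * V (path Y S s \<omega>) + b) \<partial>P x)"
    unfolding e1 by simp
qed

end

section \<open>Positive exit rates, scaling and the error in the drift\<close>

lemma exit_rate_pos:
  assumes rates: "transition_rates E q" and irr: "irreducible_rates E q" and x: "x \<in> E" and y: "y \<in> E" "y \<noteq> x"
  shows "0 < exit_rate E q x"
proof -
  have "(x, y) \<in> {(u, v). u \<in> E \<and> v \<in> E \<and> u \<noteq> v \<and> q u v > 0}\<^sup>*"
    using irr x y unfolding irreducible_rates_def by blast
  then have "\<exists>v. v \<in> E \<and> x \<noteq> v \<and> q x v > 0"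
  proof (cases rule: converse_rtranclE)
    case (step v)
    then show ?thesis by blast
  qed (use y in simp)
  then obtain v where v: "v \<in> E" "x \<noteq> v" "q x v > 0" by blast
  have "sum (\<lambda>y. q x y) {v} \<le> (\<Sum>\<^sub>\<infinity>y\<in>E - {x}. q x y)"
    using rates x v unfolding transition_rates_def by (intro finite_sum_le_infsum) auto
  then show ?thesis using v(3) by (simp add: exit_rate_def)
qed

text \<open>A one-point space has no jumps, so drift and diffusion vanish at its point. But the
  drift vanishes only at \<open>z\<close>, where the diffusion is positive definite. Together with
  irreducibility this excludes absorbing states.\<close>

lemma not_singleton:
  fixes F :: "real^'d::finite \<Rightarrow> real^'d" and a :: "real^'d \<Rightarrow> real^'d^'d"
  assumes x: "x \<in> E" and F: "is_drift E q F" and a: "is_diffusion E q a"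
    and zero: "\<And>x. F x = 0 \<longleftrightarrow> x = z" and pd: "pos_def (a z /\<^sub>R c)"
  shows "\<exists>y\<in>E. y \<noteq> x"
proof (rule ccontr)
  assume "\<not> (\<exists>y\<in>E. y \<noteq> x)"
  then have "\<And>y. y \<in> E \<Longrightarrow> y = x" by blast
  from this[of "x + _"] have j: "jump_rate E q l x = 0" for l
    unfolding jump_rate_def by (cases "x + l \<in> E") simp_all
  have "F x = 0" using F x unfolding is_drift_def by (simp add: j)
  then have "x = z" using zero by simp
  have "a x = 0" using a x unfolding is_diffusion_def by (simp add: j vec_eq_iff)
  then have "pos_def (0 :: real^'d^'d)" using pd \<open>x = z\<close> by simp
  moreover have "(1 :: real^'d) \<noteq> 0" by (simp add: vec_eq_iff)
  ultimately have "0 < (1 :: real^'d) \<bullet> ((0 :: real^'d^'d) *v 1)" unfolding pos_def_def by blast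
  then show False by simp
qed

lemma unscale_scale: "n \<ge> 1 \<Longrightarrow> unscale xb n (scale xb n x) = x"
  by (simp add: unscale_def scale_def)

lemma scale_unscale: "n \<ge> 1 \<Longrightarrow> scale xb n (unscale xb n x) = x"
  by (simp add: unscale_def scale_def)

lemma eventually_indices: "\<forall>\<^sub>F n in sequentially. n \<in> indices E q"
proof -
  have "(\<lambda>n. max_jump E q / sqrt (real n)) \<longlonglongrightarrow> 0"
    by (rule real_tendsto_divide_at_top[OF tendsto_const])
       (rule filterlim_compose[OF sqrt_at_top filterlim_real_sequentially])
  then have "\<forall>\<^sub>F n in sequentially. max_jump E q / sqrt (real n) < 1"
    by (rule order_tendstoD) simp
  then show ?thesis
    using eventually_ge_at_top[of "1::nat"] unfolding indices_def by eventually_elim simp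
qed

lemma norm_jump_le:
  fixes E :: "nat \<Rightarrow> (real^'d::finite) set"
  assumes bdd: "bdd_above (jump_sizes E q)" and n: "n \<ge> 1" and x: "x \<in> E n"
    and y: "y \<in> E n - {x}" and q: "q n x y > 0"
  shows "norm (y - x) \<le> max_jump E q"
proof -
  have "jump_rate (E n) (q n) (y - x) x > 0" using x y q by (simp add: jump_rate_def)
  then have "norm (y - x) \<in> jump_sizes E q" unfolding jump_sizes_def using n x by blast
  then show ?thesis unfolding max_jump_def using bdd by (intro cSup_upper) auto
qed

lemma max_jump_nonneg: "bdd_above (jump_sizes E q) \<Longrightarrow> 0 \<le> max_jump E q"
  unfolding max_jump_def by (intro cSup_upper) auto

lemma diff_gen_eq:
  "diff_gen F a xb n V u = grad V u \<bullet> F_hat F xb n u + 1/2 * (hess V u \<bullet> a_bar a xb n 0)"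
  by (simp add: diff_gen_def grad_def hess_def inner_vec_def mult.commute)

text \<open>The constant comes from replacing \<open>a_bar\<close> at \<open>u\<close> by its value at 0 and from the Taylor remainder.\<close>

lemma generator_error_bound:
  fixes A A0 H :: "real^'d^'d::finite"
  assumes a: "norm (A - A0) \<le> K / s * w" and K: "0 \<le> K" and s: "s \<ge> 1" and w: "0 \<le> w"
    and H: "norm H * (1 + w) \<le> C * V" and L: "L * (1 + w) \<le> C * V" "0 \<le> L"
    and A0: "norm A0 \<le> N" and jm: "0 \<le> jm"
  shows "1/2 * (H \<bullet> (A - A0)) + 1/2 * (L * (jm / s)) * (A \<bullet> mat 1) \<le>
    (1/2 * K + 1/2 * jm * ((N + K) * norm (mat 1 :: real^'d^'d))) * C * V / s"
proof -
  let ?m = "norm (mat 1 :: real^'d^'d)"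
  have N: "0 \<le> N" using A0 norm_ge_zero[of A0] by linarith
  have CV: "0 \<le> C * V" using L w by (meson add_nonneg_nonneg mult_nonneg_nonneg order_trans zero_le_one)
  have "norm H + norm H * w \<le> C * V" using H by (simp add: distrib_left)
  \<comment> \<open>The weight \<open>1 + w\<close> in the bound for \<open>H\<close> absorbs the
    linear growth of \<open>A - A0\<close>.\<close>
  then have Hw: "norm H * w \<le> C * V" using norm_ge_zero[of H] by linarith
  have "H \<bullet> (A - A0) \<le> norm H * norm (A - A0)" by (rule norm_cauchy_schwarz)
  also have "\<dots> \<le> norm H * (K / s * w)" using a by (rule mult_left_mono) simp
  also have "\<dots> = K / s * (norm H * w)" by simp
  also have "\<dots> \<le> K / s * (C * V)" using Hw K s by (intro mult_left_mono) simp_all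
  finally have 1: "H \<bullet> (A - A0) \<le> K / s * (C * V)" .
  \<comment> \<open>\<open>A\<close> itself grows at most linearly in \<open>w\<close>; the weight
    in the bound for \<open>L\<close> absorbs this in the Taylor remainder.\<close>
  have "norm A \<le> norm A0 + norm (A - A0)" using norm_triangle_ineq[of A0 "A - A0"] by simp
  also have "\<dots> \<le> N + K * w"
  proof -
    have "K * 1 \<le> K * s" using s K by (rule mult_left_mono)
    then have "K / s \<le> K" using s by (simp add: pos_divide_le_eq)
    then have "K / s * w \<le> K * w" using w by (rule mult_right_mono)
    then show ?thesis using a A0 by linarith
  qed
  also have "\<dots> \<le> (N + K) * (1 + w)" using N K w by (simp add: algebra_simps)
  finally have nA: "norm A \<le> (N + K) * (1 + w)" .
  have "A \<bullet> mat 1 \<le> norm A * ?m" by (rule norm_cauchy_schwarz)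
  also have "\<dots> \<le> (N + K) * (1 + w) * ?m" using nA by (rule mult_right_mono) simp
  finally have "L * (A \<bullet> mat 1) \<le> L * ((N + K) * (1 + w) * ?m)" using L(2) by (rule mult_left_mono)
  also have "\<dots> = (N + K) * ?m * (L * (1 + w))" by simp
  also have "\<dots> \<le> (N + K) * ?m * (C * V)" using L(1) N K by (intro mult_left_mono) simp_all
  finally have 2: "L * (A \<bullet> mat 1) \<le> (N + K) * ?m * (C * V)" .
  have "L * (jm / s) * (A \<bullet> mat 1) = jm / s * (L * (A \<bullet> mat 1))" by simp
  also have "\<dots> \<le> jm / s * ((N + K) * ?m * (C * V))" using 2 jm s by (intro mult_left_mono) simp_all
  finally have 3: "L * (jm / s) * (A \<bullet> mat 1) \<le> jm / s * ((N + K) * ?m * (C * V))" .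
  have 4: "1/2 * (L * (jm / s)) * (A \<bullet> mat 1) = 1/2 * (L * (jm / s) * (A \<bullet> mat 1))"
    by (simp only: mult.assoc)
  have 5: "1/2 * x + 1/2 * y \<le> 1/2 * x' + 1/2 * y'" if "x \<le> x'" "y \<le> y'" for x y x' y' :: real
    using that by linarith
  have "1/2 * (H \<bullet> (A - A0)) + 1/2 * (L * (jm / s)) * (A \<bullet> mat 1) \<le>
     1/2 * (K / s * (C * V)) + 1/2 * (jm / s * ((N + K) * ?m * (C * V)))"
    unfolding 4 by (rule 5[OF 1 3])
  also have "\<dots> = (1/2 * K + 1/2 * jm * ((N + K) * ?m)) * C * V / s"
    using s by (simp add: field_simps)
  finally show ?thesis .
qed

text \<open>The seminorm \<open>l\<close> is extended-valued. Since \<open>w \<ge> 1\<close> and the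
  right side is finite, it is a real number \<open>L\<close>, and each summand inherits the weighted
  bound of the sum.\<close>

lemma regularity_bounds:
  assumes "(ennreal g + ennreal h + l) * ennreal w \<le> ennreal M" "0 \<le> g" "0 \<le> h" "1 \<le> w" "0 \<le> M"
  obtains L where "0 \<le> L" "l \<le> ennreal L" "L * w \<le> M" "h * w \<le> M"
proof -
  have lw: "l * ennreal w \<le> ennreal M"
    using assms(1) by (rule order_trans[rotated]) (intro mult_right_mono, simp_all add: add_increasing)
  have "ennreal h * ennreal w \<le> ennreal M"
    using assms(1) by (rule order_trans[rotated]) (intro mult_right_mono, simp_all add: add_increasing add_increasing2)
  then have h: "h * w \<le> M" using assms by (simp add: ennreal_mult[symmetric])
  have "l * 1 \<le> l * ennreal w" using assms(4) by (intro mult_left_mono) simp_all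
  then have "l \<le> ennreal M" using lw by simp
  then obtain L where L: "l = ennreal L" "0 \<le> L" by (cases l) (auto simp: top_unique)
  have "L * w \<le> M" using lw L assms by (simp add: ennreal_mult[symmetric])
  with L h show ?thesis by (intro that[of L]) auto
qed

theorem theorem3p3:
  fixes E :: "nat \<Rightarrow> (real^'d::finite) set"
    and q :: "nat \<Rightarrow> real^'d \<Rightarrow> real^'d \<Rightarrow> real"
    and P :: "nat \<Rightarrow> real^'d \<Rightarrow> 'w measure"
    and Y :: "nat \<Rightarrow> nat \<Rightarrow> 'w \<Rightarrow> real^'d"
    and S :: "nat \<Rightarrow> nat \<Rightarrow> 'w \<Rightarrow> ennreal"
    and F :: "nat \<Rightarrow> real^'d \<Rightarrow> real^'d"
    and a :: "nat \<Rightarrow> real^'d \<Rightarrow> real^'d^'d"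
    and xb :: "nat \<Rightarrow> real^'d"
    and V :: "real^'d \<Rightarrow> real"
    and b \<delta> K C :: real
  assumes "standing_assumptions E q P Y S F a xb"
    and "UL_A E q P Y S F a xb V b \<delta> K"
    and "C > 0"
    and "\<And>n x. n \<in> indices E q \<Longrightarrow>
      (ennreal (norm (grad V x)) + ennreal (norm (hess V x)) +
         hess_lip V x (max_jump E q / sqrt (real n))) * ennreal (1 + norm x) \<le> ennreal (C * V x)"
  shows "(\<forall>\<^sub>F n in sequentially.
           (\<forall>x\<in>E_hat E xb n. \<forall>t\<ge>0.
              integrable (P_hat P xb n x) (\<lambda>\<omega>. V (X_hat Y S xb n t \<omega>)) \<and>
              (AE \<omega> in P_hat P xb n x.
                 set_integrable lborel {0..t} (\<lambda>s. - (\<delta> / 2) * V (X_hat Y S xb n s \<omega>) + b)) \<and>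
              integrable (P_hat P xb n x)
                (\<lambda>\<omega>. LBINT s:{0..t}. (- (\<delta> / 2) * V (X_hat Y S xb n s \<omega>) + b)) \<and>
              (\<integral>\<omega>. V (X_hat Y S xb n t \<omega>) \<partial>P_hat P xb n x)
                \<le> V x + (\<integral>\<omega>. (LBINT s:{0..t}. (- (\<delta> / 2) * V (X_hat Y S xb n s \<omega>) + b))
                           \<partial>P_hat P xb n x)) \<and>
           ergodic (E_hat E xb n) (P_hat P xb n) (X_hat Y S xb n)) \<and>
         (\<forall>\<nu>. (\<forall>\<^sub>F n in sequentially.
                 stationary (E_hat E xb n) (P_hat P xb n) (X_hat Y S xb n) (\<nu> n)) \<longrightarrow>
            limsup (\<lambda>n. \<integral>\<^sup>+x. ennreal (V x) \<partial>measure_pmf (\<nu> n)) \<le> ennreal (2 * b / \<delta>))"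
proof -
  have V1: "1 \<le> V x" and C2: "C2 V" and b: "0 < b" and \<delta>: "0 < \<delta>" for x
    using assms(2) unfolding UL_A_def sub_exponential_def by auto
  have V0: "0 \<le> V x" for x using V1[of x] by linarith
  have gen: "diff_gen F a xb n V u \<le> - \<delta> * V u + b" if "n \<in> indices E q" for n u
  proof -
    have "diff_gen F a xb n V u \<le> - \<delta> * V u + b * indicator (cball 0 K) u"
      using assms(2) that unfolding UL_A_def by blast
    also have "\<dots> \<le> - \<delta> * V u + b" using b by (simp add: indicator_def)
    finally show ?thesis .
  qed
  note sa = assms(1)[unfolded standing_assumptions_def]
  have bdd: "bdd_above (jump_sizes E q)" by (rule conjunct1[OF sa])
  note sa2 = conjunct2[OF sa]
  have chain: "ctmc (E n) (q n) (P n) (Y n) (S n)" "nonexplosive (E n) (P n) (S n)"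
      "irreducible_rates (E n) (q n)" "positive_recurrent (E n) (q n) (P n) (Y n) (S n)"
      "is_drift (E n) (q n) (F n)" "is_diffusion (E n) (q n) (a n)"
      "F n x = 0 \<longleftrightarrow> x = xb n" "pos_def (a_bar a xb n 0)" if "n \<in> indices E q" for n x
    using bspec[OF conjunct1[OF sa2] that] by simp_all
  note sa4 = conjunct2[OF conjunct2[OF sa2]]
  obtain Ka0 where Ka0: "norm (a_bar a xb n x - a_bar a xb n 0) \<le> Ka0 / sqrt (real n) * norm x"
    if "n \<in> indices E q" for n x
    using conjunct1[OF sa4] by blast
  \<comment> \<open>The sign of the given constant is unspecified; the error estimate multiplies by
    it and asks for a nonnegative one.\<close>
  define Ka where "Ka = max Ka0 0"
  have Ka: "norm (a_bar a xb n x - a_bar a xb n 0) \<le> Ka / sqrt (real n) * norm x" if "n \<in> indices E q" for n x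
  proof -
    have "Ka0 / sqrt (real n) * norm x \<le> Ka / sqrt (real n) * norm x"
      unfolding Ka_def by (intro mult_right_mono divide_right_mono) simp_all
    then show ?thesis using Ka0[OF that, of x] by linarith
  qed
  have Ka_nonneg: "0 \<le> Ka" unfolding Ka_def by simp
  obtain ab where "(\<lambda>n. a_bar a xb n 0) \<longlonglongrightarrow> ab"
    using conjunct2[OF sa4] by blast
  then have "Bseq (\<lambda>n. a_bar a xb n 0)" by (intro convergent_imp_Bseq convergentI)
  \<comment> \<open>Convergence gives a bound uniform in \<open>n\<close>, so that
    \<open>\<kappa>\<close> below does not depend on \<open>n\<close>.\<close>
  then obtain N where N: "norm (a_bar a xb n 0) \<le> N" for n unfolding Bseq_def by blast
  define jm where "jm = max_jump E q"
  \<comment> \<open>The factor of \<open>V / sqrt n\<close> in the error estimate: the first summand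
    comes from freezing the diffusion matrix at 0, the second from the Taylor remainder.\<close>
  define \<kappa> where "\<kappa> = (1/2 * Ka + 1/2 * jm * ((N + Ka) * norm (mat 1 :: real^'d^'d))) * C"
  have ev: "\<forall>\<^sub>F n in sequentially. n \<in> indices E q \<and> \<kappa> / sqrt (real n) < \<delta> / 2"
  proof -
    have "(\<lambda>n. \<kappa> / sqrt (real n)) \<longlonglongrightarrow> 0"
      by (rule real_tendsto_divide_at_top[OF tendsto_const])
         (rule filterlim_compose[OF sqrt_at_top filterlim_real_sequentially])
    then have "\<forall>\<^sub>F n in sequentially. \<kappa> / sqrt (real n) < \<delta> / 2"
      by (rule order_tendstoD) (use \<delta> in simp)
    with eventually_indices[of E q] show ?thesis by eventually_elim simp
  qed
  have main: "(\<forall>x\<in>E_hat E xb n. \<forall>t\<ge>0.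
              integrable (P_hat P xb n x) (\<lambda>\<omega>. V (X_hat Y S xb n t \<omega>)) \<and>
              (AE \<omega> in P_hat P xb n x.
                 set_integrable lborel {0..t} (\<lambda>s. - (\<delta> / 2) * V (X_hat Y S xb n s \<omega>) + b)) \<and>
              integrable (P_hat P xb n x)
                (\<lambda>\<omega>. LBINT s:{0..t}. (- (\<delta> / 2) * V (X_hat Y S xb n s \<omega>) + b)) \<and>
              (\<integral>\<omega>. V (X_hat Y S xb n t \<omega>) \<partial>P_hat P xb n x)
                \<le> V x + (\<integral>\<omega>. (LBINT s:{0..t}. (- (\<delta> / 2) * V (X_hat Y S xb n s \<omega>) + b))
                           \<partial>P_hat P xb n x)) \<and>
           ergodic (E_hat E xb n) (P_hat P xb n) (X_hat Y S xb n)"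
    and bound: "\<And>\<nu>. stationary (E_hat E xb n) (P_hat P xb n) (X_hat Y S xb n) \<nu> \<Longrightarrow>
            (\<integral>\<^sup>+x. ennreal (V x) \<partial>measure_pmf \<nu>) \<le> ennreal (2 * b / \<delta>)"
    if n: "n \<in> indices E q \<and> \<kappa> / sqrt (real n) < \<delta> / 2" for n
  proof -
    from n have nI: "n \<in> indices E q" and \<kappa>: "\<kappa> / sqrt (real n) < \<delta> / 2" by auto
    have n1: "1 \<le> n" using nI unfolding indices_def by simp
    let ?s = "sqrt (real n)" and ?g = "scale xb n"
    have s1: "1 \<le> ?s" using n1 by simp
    note ch = chain[OF nI]
    have rates: "transition_rates (E n) (q n)" using ch(1) unfolding ctmc_def by blast
    have az: "pos_def (a n (xb n) /\<^sub>R real n)" using ch(8) by (simp add: a_bar_def unscale_def)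
    have exit: "0 < exit_rate (E n) (q n) x" if x: "x \<in> E n" for x
    proof -
      obtain y where "y \<in> E n" "y \<noteq> x" using not_singleton[OF x ch(5,6,7) az] by blast
      then show ?thesis by (rule exit_rate_pos[OF rates ch(3) x])
    qed
    interpret c: ctmc_nonexplosive "E n" "q n" "P n" "Y n" "S n"
      by unfold_locales (rule ch(1), rule exit, assumption, rule ch(2))
    \<comment> \<open>\<open>V\<close> in the coordinates of the unscaled chain, to which the
      results on jump processes apply.\<close>
    define W where "W x = V (?g x)" for x
    have W0: "0 \<le> W x" for x unfolding W_def by (rule V0)
    have Wgen: "ennreal (c.hold_rate x) * (\<integral>\<^sup>+y. ennreal (W y) \<partial>measure_pmf (c.jump_pmf x)) + ennreal (\<delta> / 2 * W x)
        \<le> ennreal (c.hold_rate x * W x + b)" if x: "x \<in> E n" for x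
    proof -
      let ?u = "?g x"
      have u: "(x - xb n) /\<^sub>R ?s = ?u" by (simp add: scale_def)
      obtain L where L: "0 \<le> L" "hess_lip V ?u (jm / ?s) \<le> ennreal L" "L * (1 + norm ?u) \<le> C * V ?u"
          "norm (hess V ?u) * (1 + norm ?u) \<le> C * V ?u"
        using regularity_bounds[OF assms(4)[OF nI, of ?u, folded jm_def]] assms(3) V0[of ?u]
        by (auto intro: mult_nonneg_nonneg)
      let ?G = "exit_rate (E n) (q n) x * V ?u + grad V ?u \<bullet> (F n x /\<^sub>R ?s) +
        1/2 * (hess V ?u \<bullet> (a n x /\<^sub>R ?s\<^sup>2)) + 1/2 * (L * (jm / ?s)) * ((a n x /\<^sub>R ?s\<^sup>2) \<bullet> mat 1)"
      have Fh: "F n x /\<^sub>R ?s = F_hat F xb n ?u" and ah: "a n x /\<^sub>R ?s\<^sup>2 = a_bar a xb n ?u"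
        using n1 by (simp_all add: F_hat_def a_bar_def unscale_scale)
      have "ennreal (c.hold_rate x) * (\<integral>\<^sup>+y. ennreal (W y) \<partial>measure_pmf (c.jump_pmf x)) =
          (\<integral>\<^sup>+y. ennreal (q n x y) * ennreal (W y) \<partial>count_space (E n - {x}))"
        by (rule c.hold_rate_nn_integral_jump_pmf[OF x])
      also have "\<dots> = (\<integral>\<^sup>+y. ennreal (q n x y * V ((y - xb n) /\<^sub>R ?s)) \<partial>count_space (E n - {x}))"
        using c.rates_nonneg[OF x] V0
        by (intro nn_integral_cong) (simp add: W_def scale_def ennreal_mult)
      also have "\<dots> \<le> ennreal ?G"
        using generator_Taylor[OF rates x _ ch(5,6) C2 V0, where c="?s" and z="xb n" and jmax=jm and L=L]
          norm_jump_le[OF bdd n1 x] L(1,2) s1 unfolding u jm_def by simp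
      also have "?G \<le> exit_rate (E n) (q n) x * V ?u - \<delta> / 2 * V ?u + b"
      proof -
        have "1/2 * (hess V ?u \<bullet> (a_bar a xb n ?u - a_bar a xb n 0)) +
            1/2 * (L * (jm / ?s)) * (a_bar a xb n ?u \<bullet> mat 1) \<le> \<kappa> * V ?u / ?s"
          unfolding \<kappa>_def jm_def
          by (rule generator_error_bound[OF Ka[OF nI] Ka_nonneg s1 norm_ge_zero L(4,3,1) N max_jump_nonneg[OF bdd], unfolded jm_def])
        also have "\<dots> = \<kappa> / ?s * V ?u" by simp
        also have "\<dots> \<le> \<delta> / 2 * V ?u" using \<kappa> V0 by (intro mult_right_mono) simp_all
        finally have err: "1/2 * (hess V ?u \<bullet> (a_bar a xb n ?u - a_bar a xb n 0)) +
            1/2 * (L * (jm / ?s)) * (a_bar a xb n ?u \<bullet> mat 1) \<le> \<delta> / 2 * V ?u" .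
        \<comment> \<open>The matrix frozen at 0 is split off, so that the drift condition for
          \<open>diff_gen\<close> can be inserted; the error then spends half of
          \<open>\<delta> * V\<close>.\<close>
        have "1/2 * (hess V ?u \<bullet> a_bar a xb n ?u) =
            1/2 * (hess V ?u \<bullet> (a_bar a xb n ?u - a_bar a xb n 0)) + 1/2 * (hess V ?u \<bullet> a_bar a xb n 0)"
          by (simp add: inner_diff_right algebra_simps)
        moreover have "\<delta> / 2 * V ?u = (\<delta> * V ?u) / 2" "- \<delta> * V ?u = - (\<delta> * V ?u)" by simp_all
        ultimately show ?thesis
          using gen[OF nI, of ?u] err unfolding diff_gen_eq Fh ah by linarith
      qed
      finally have le: "ennreal (c.hold_rate x) * (\<integral>\<^sup>+y. ennreal (W y) \<partial>measure_pmf (c.jump_pmf x)) \<le>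
          ennreal (exit_rate (E n) (q n) x * V ?u - \<delta> / 2 * V ?u + b)" by (simp add: ennreal_leI)
      show ?thesis
      proof (cases "0 \<le> exit_rate (E n) (q n) x * V ?u - \<delta> / 2 * V ?u + b")
        case True
        have "ennreal (c.hold_rate x) * (\<integral>\<^sup>+y. ennreal (W y) \<partial>measure_pmf (c.jump_pmf x)) + ennreal (\<delta> / 2 * W x) \<le>
           ennreal (exit_rate (E n) (q n) x * V ?u - \<delta> / 2 * V ?u + b) + ennreal (\<delta> / 2 * W x)"
          using le by (rule add_right_mono)
        also have "\<dots> = ennreal (c.hold_rate x * W x + b)"
          using True \<delta> V0[of ?u] by (simp add: ennreal_plus[symmetric] c.hold_rate_E[OF x] W_def del: ennreal_plus)
        finally show ?thesis .
      next
        \<comment> \<open>Here \<open>ennreal\<close> of the right side is 0, so the mean of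
          \<open>W\<close> after a jump would vanish; this contradicts \<open>W \<ge> 1\<close> and
          the positive rate.\<close>
        case False
        have "0 < c.hold_rate x" by (rule c.hold_rate_pos)
        have "(\<integral>\<^sup>+y. ennreal 1 \<partial>measure_pmf (c.jump_pmf x)) \<le> (\<integral>\<^sup>+y. ennreal (W y) \<partial>measure_pmf (c.jump_pmf x))"
          using V1 by (intro nn_integral_mono ennreal_leI) (simp add: W_def)
        then have "ennreal (c.hold_rate x) * 1 \<le> ennreal (c.hold_rate x) * (\<integral>\<^sup>+y. ennreal (W y) \<partial>measure_pmf (c.jump_pmf x))"
          by (intro mult_left_mono) simp_all
        also have "\<dots> \<le> 0" using le False by (simp add: ennreal_neg)
        finally show ?thesis using \<open>0 < c.hold_rate x\<close> by simp
      qed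
    qed
    have ehat: "unscale xb n u \<in> E n" "?g (unscale xb n u) = u" if "u \<in> E_hat E xb n" for u
      using that n1 by (auto simp: E_hat_def unscale_scale)
    have ehatI: "x \<in> E n \<Longrightarrow> ?g x \<in> E_hat E xb n" for x by (simp add: E_hat_def)
    have X: "X_hat Y S xb n t \<omega> = ?g (path (Y n) (S n) t \<omega>)" for t \<omega> by (simp add: X_hat_def)
    obtain p \<pi> where
        sg1: "\<forall>t\<ge>0. \<forall>x\<in>E n. set_pmf (p t x) \<subseteq> E n \<and>
          (\<forall>f. (\<integral>\<^sup>+y. f y \<partial>measure_pmf (p t x)) = (\<integral>\<^sup>+\<omega>. f (path (Y n) (S n) t \<omega>) \<partial>P n x))"
      and sg2: "\<forall>s\<ge>0. \<forall>t\<ge>0. \<forall>x\<in>E n. p (s + t) x = bind_pmf (p s x) (p t)"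
      and sg3: "\<forall>t>0. \<forall>x\<in>E n. set_pmf (p t x) = E n"
      and sg4: "set_pmf \<pi> \<subseteq> E n" "\<forall>t\<ge>0. bind_pmf \<pi> (p t) = \<pi>"
      using c.ex_semigroup_pmf[OF ch(3,4)] by (elim exE conjE) (rule that; assumption)
    have p: "set_pmf (p t x) \<subseteq> E n"
        "(\<integral>\<^sup>+y. f y \<partial>measure_pmf (p t x)) = (\<integral>\<^sup>+\<omega>. f (path (Y n) (S n) t \<omega>) \<partial>P n x)"
      if "0 \<le> t" "x \<in> E n" for t x f
      using sg1 that by blast+
    have ck: "p (s + t) x = bind_pmf (p s x) (p t)" if "0 \<le> s" "0 \<le> t" "x \<in> E n" for s t x
      using sg2 that by blast
    have supp: "set_pmf (p t x) = E n" if "0 < t" "x \<in> E n" for t x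
      using sg3 that by blast
    have \<pi>: "set_pmf \<pi> \<subseteq> E n" "0 \<le> t \<Longrightarrow> bind_pmf \<pi> (p t) = \<pi>" for t
      using sg4 by blast+
    \<comment> \<open>Scaling is a bijection between the two state spaces for
      \<open>n \<ge> 1\<close>; transition laws and invariant law are transported along it.\<close>
    define p' where "p' t u = map_pmf ?g (p t (unscale xb n u))" for t u
    have tp: "trans_prob (P_hat P xb n) (X_hat Y S xb n) t u A = measure_pmf.prob (p' t u) A"
      if t: "0 \<le> t" and u: "u \<in> E_hat E xb n" for t u A
    proof -
      let ?x = "unscale xb n u"
      interpret pr: prob_space "P n ?x" by (rule c.prob_P[OF ehat(1)[OF u]])
      have m: "{\<omega> \<in> space (P n ?x). ?g (path (Y n) (S n) t \<omega>) \<in> A} \<in> sets (P n ?x)"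
        using measurable_sets[OF c.measurable_path[OF ehat(1)[OF u], of t], of "?g -` A \<inter> E n"]
          measurable_space[OF c.measurable_path[OF ehat(1)[OF u], of t]]
        by (simp add: vimage_def Int_def conj_commute cong: conj_cong)
      have "emeasure (measure_pmf (p' t u)) A = (\<integral>\<^sup>+y. indicator A (?g y) \<partial>measure_pmf (p t ?x))"
        unfolding p'_def by (subst nn_integral_indicator[symmetric], simp, rule nn_integral_map_pmf)
      also have "\<dots> = (\<integral>\<^sup>+\<omega>. indicator A (?g (path (Y n) (S n) t \<omega>)) \<partial>P n ?x)"
        by (rule p(2)[OF t ehat(1)[OF u]])
      also have "\<dots> = (\<integral>\<^sup>+\<omega>. indicator {\<omega> \<in> space (P n ?x). ?g (path (Y n) (S n) t \<omega>) \<in> A} \<omega> \<partial>P n ?x)"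
        by (intro nn_integral_cong) (simp add: indicator_def)
      also have "\<dots> = emeasure (P n ?x) {\<omega> \<in> space (P n ?x). ?g (path (Y n) (S n) t \<omega>) \<in> A}"
        using m by simp
      finally show ?thesis
        unfolding trans_prob_def P_hat_def X by (simp add: measure_def)
    qed
    have p'_supp0: "set_pmf (p' t u) \<subseteq> E_hat E xb n" if "0 \<le> t" "u \<in> E_hat E xb n" for t u
      using p(1)[OF that(1) ehat(1)[OF that(2)]] unfolding p'_def E_hat_def by auto
    have bind_p': "bind_pmf (map_pmf ?g r) (p' t) = map_pmf ?g (bind_pmf r (p t))" if "set_pmf r \<subseteq> E n" for r t
      unfolding bind_map_pmf map_bind_pmf p'_def using n1 by (simp add: unscale_scale)
    have erg: "ergodic (E_hat E xb n) (P_hat P xb n) (X_hat Y S xb n)"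
    proof (rule ergodic_pmfI[where p=p' and \<pi>="map_pmf ?g \<pi>"])
      show "p' (s + t) u = bind_pmf (p' s u) (p' t)" if "s \<ge> 0" "t \<ge> 0" "u \<in> E_hat E xb n" for s t u
        using ck[OF that(1,2) ehat(1)[OF that(3)]] bind_p'[OF p(1)[OF that(1) ehat(1)[OF that(3)]], of t]
        unfolding p'_def[of "s + t"] p'_def[of s] by simp
      show "set_pmf (p' t u) = E_hat E xb n" if "t > 0" "u \<in> E_hat E xb n" for t u
        unfolding p'_def E_hat_def by (simp add: supp[OF that(1) ehat(1)[OF that(2)]])
      show "set_pmf (map_pmf ?g \<pi>) \<subseteq> E_hat E xb n" using \<pi>(1) by (auto simp: E_hat_def)
      show "bind_pmf (map_pmf ?g \<pi>) (p' t) = map_pmf ?g \<pi>" if "t \<ge> 0" for t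
        using bind_p'[OF \<pi>(1), of t] \<pi>(2)[OF that] by simp
    qed (auto simp: tp p'_supp0)
    have d2: "0 \<le> \<delta> / 2" "0 < \<delta> / 2" using \<delta> by auto
    show "(\<forall>x\<in>E_hat E xb n. \<forall>t\<ge>0.
              integrable (P_hat P xb n x) (\<lambda>\<omega>. V (X_hat Y S xb n t \<omega>)) \<and>
              (AE \<omega> in P_hat P xb n x.
                 set_integrable lborel {0..t} (\<lambda>s. - (\<delta> / 2) * V (X_hat Y S xb n s \<omega>) + b)) \<and>
              integrable (P_hat P xb n x)
                (\<lambda>\<omega>. LBINT s:{0..t}. (- (\<delta> / 2) * V (X_hat Y S xb n s \<omega>) + b)) \<and>
              (\<integral>\<omega>. V (X_hat Y S xb n t \<omega>) \<partial>P_hat P xb n x)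
                \<le> V x + (\<integral>\<omega>. (LBINT s:{0..t}. (- (\<delta> / 2) * V (X_hat Y S xb n s \<omega>) + b))
                           \<partial>P_hat P xb n x)) \<and>
           ergodic (E_hat E xb n) (P_hat P xb n) (X_hat Y S xb n)"
    proof (intro conjI[OF _ erg] ballI allI impI)
      fix u and t :: real assume u: "u \<in> E_hat E xb n" and t: "0 \<le> t"
      note Ly = c.Lyapunov_expectation[where V=W, OF W0 less_imp_le[OF b] d2(2) Wgen ehat(1)[OF u] t]
      have "W (unscale xb n u) = V u" unfolding W_def ehat(2)[OF u] ..
      with Ly show "integrable (P_hat P xb n u) (\<lambda>\<omega>. V (X_hat Y S xb n t \<omega>)) \<and>
              (AE \<omega> in P_hat P xb n u.
                 set_integrable lborel {0..t} (\<lambda>s. - (\<delta> / 2) * V (X_hat Y S xb n s \<omega>) + b)) \<and>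
              integrable (P_hat P xb n u)
                (\<lambda>\<omega>. LBINT s:{0..t}. (- (\<delta> / 2) * V (X_hat Y S xb n s \<omega>) + b)) \<and>
              (\<integral>\<omega>. V (X_hat Y S xb n t \<omega>) \<partial>P_hat P xb n u)
                \<le> V u + (\<integral>\<omega>. (LBINT s:{0..t}. (- (\<delta> / 2) * V (X_hat Y S xb n s \<omega>) + b))
                           \<partial>P_hat P xb n u)"
        unfolding W_def X P_hat_def by (intro conjI) simp_all
    qed
    show "(\<integral>\<^sup>+x. ennreal (V x) \<partial>measure_pmf \<nu>) \<le> ennreal (2 * b / \<delta>)"
      if st: "stationary (E_hat E xb n) (P_hat P xb n) (X_hat Y S xb n) \<nu>" for \<nu>
    proof -
      have inv: "set_pmf \<nu> \<subseteq> E_hat E xb n" "\<And>t. 0 \<le> t \<Longrightarrow> bind_pmf \<nu> (p' t) = \<nu>"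
        using st stationary_iff_bind_pmf[of "E_hat E xb n" "P_hat P xb n" "X_hat Y S xb n" p' \<nu>] tp p'_supp0
        by auto
      \<comment> \<open>The stationary law is pulled back to the unscaled state space, on which the
        semigroup of the chain acts.\<close>
      define \<mu> where "\<mu> = map_pmf (unscale xb n) \<nu>"
      have \<nu>: "\<nu> = map_pmf ?g \<mu>"
        unfolding \<mu>_def map_pmf_comp using n1 by (simp add: scale_unscale)
      have \<mu>E: "set_pmf \<mu> \<subseteq> E n" unfolding \<mu>_def using inv(1) ehat(1) by auto
      have \<mu>: "bind_pmf \<mu> (p t) = \<mu>" if "0 \<le> t" for t
      proof -
        have "map_pmf ?g (bind_pmf \<mu> (p t)) = map_pmf ?g \<mu>"
          using inv(2)[OF that] bind_p'[OF \<mu>E, of t] unfolding \<nu>[symmetric] by simp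
        then have "map_pmf (unscale xb n) (map_pmf ?g (bind_pmf \<mu> (p t))) = map_pmf (unscale xb n) (map_pmf ?g \<mu>)"
          by simp
        then show ?thesis unfolding map_pmf_comp using n1 by (simp add: unscale_scale)
      qed
      have sginv: "(\<integral>\<^sup>+x. c.semigroup f t x \<partial>measure_pmf \<mu>) = (\<integral>\<^sup>+x. f x \<partial>measure_pmf \<mu>)" if "0 \<le> t" for f t
      proof -
        have "(\<integral>\<^sup>+x. c.semigroup f t x \<partial>measure_pmf \<mu>) = (\<integral>\<^sup>+x. \<integral>\<^sup>+y. f y \<partial>measure_pmf (p t x) \<partial>measure_pmf \<mu>)"
          using \<mu>E that by (intro nn_integral_cong_AE AE_pmfI) (auto simp: p(2) c.semigroup_eq_expectation)
        also have "\<dots> = (\<integral>\<^sup>+x. f x \<partial>measure_pmf (bind_pmf \<mu> (p t)))" by simp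
        finally show ?thesis by (simp only: \<mu>[OF that])
      qed
      have "(\<integral>\<^sup>+x. ennreal (W x) \<partial>measure_pmf \<mu>) \<le> ennreal (b / (\<delta> / 2))"
      proof (rule c.stationary_Lyapunov_bound[OF W0 less_imp_le[OF b] d2(2) \<mu>E sginv])
        fix x and t :: real assume x: "x \<in> E n" and t: "0 \<le> t"
        have "c.semigroup (\<lambda>x. ennreal (W x)) t x +
            ennreal (\<delta> / 2) * (\<integral>\<^sup>+s. indicator {..t} s * c.semigroup (\<lambda>x. ennreal (W x)) s x \<partial>lborel) \<le> ennreal (W x + b * t)"
          by (rule c.semigroup_Lyapunov[where E="E n" and V=W, OF W0 less_imp_le[OF b] d2(1) c.set_jump_pmf Wgen x t])
        then show "ennreal (\<delta> / 2) * (\<integral>\<^sup>+s. indicator {..t} s * c.semigroup (\<lambda>x. ennreal (W x)) s x \<partial>lborel) \<le> ennreal (W x + b * t)"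
          by (rule order_trans[rotated]) simp
      qed
      then show ?thesis unfolding \<nu> W_def by (simp add: mult.commute)
    qed
  qed
  show ?thesis
  proof (intro conjI allI impI)
    show "\<forall>\<^sub>F n in sequentially.
           (\<forall>x\<in>E_hat E xb n. \<forall>t\<ge>0.
              integrable (P_hat P xb n x) (\<lambda>\<omega>. V (X_hat Y S xb n t \<omega>)) \<and>
              (AE \<omega> in P_hat P xb n x.
                 set_integrable lborel {0..t} (\<lambda>s. - (\<delta> / 2) * V (X_hat Y S xb n s \<omega>) + b)) \<and>
              integrable (P_hat P xb n x)
                (\<lambda>\<omega>. LBINT s:{0..t}. (- (\<delta> / 2) * V (X_hat Y S xb n s \<omega>) + b)) \<and>
              (\<integral>\<omega>. V (X_hat Y S xb n t \<omega>) \<partial>P_hat P xb n x)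
                \<le> V x + (\<integral>\<omega>. (LBINT s:{0..t}. (- (\<delta> / 2) * V (X_hat Y S xb n s \<omega>) + b))
                           \<partial>P_hat P xb n x)) \<and>
           ergodic (E_hat E xb n) (P_hat P xb n) (X_hat Y S xb n)"
      using ev by (rule eventually_mono) (rule main)
    fix \<nu> assume "\<forall>\<^sub>F n in sequentially.
                 stationary (E_hat E xb n) (P_hat P xb n) (X_hat Y S xb n) (\<nu> n)"
    with ev have "\<forall>\<^sub>F n in sequentially. (\<integral>\<^sup>+x. ennreal (V x) \<partial>measure_pmf (\<nu> n)) \<le> ennreal (2 * b / \<delta>)"
      by eventually_elim (rule bound)
    then show "limsup (\<lambda>n. \<integral>\<^sup>+x. ennreal (V x) \<partial>measure_pmf (\<nu> n)) \<le> ennreal (2 * b / \<delta>)"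
      by (rule Limsup_bounded)
  qed
qed

end
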